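(* Let $n\geq 1$ be a natural number, let $p,q$ be real numbers with $1<p\leq 2$ and $1<q\leq p-1+\frac{p}{n}$, and let $\mathbb{S}=(0,+\infty)\times\mathbb{R}^n$. Let $u$ be an entire weak super-solution and $v$ an entire weak sub-solution in $\mathbb{S}$ of the equation $$w_t-\Delta_p(w)=|w|^{q-1}w,$$ such that $u\geq v$ in $\mathbb{S}$. Then $u\equiv v$ in $\mathbb{S}$.
   Context: Points of $\mathbb{S}=(0,+\infty)\times\mathbb{R}^n$ are written $(t,x)$ with $t>0$, $x=(x_1,\dots,x_n)\in\mathbb{R}^n$. The $p$-Laplacian is $\Delta_p(w):=\mathrm{div}_x\left(|\nabla_x w|^{p-2}\nabla_x w\right)$, where $\nabla_x w=(w_{x_1},\dots,w_{x_n})$ is the gradient in the $x$ variables; the vector $|\nabla_x w|^{p-2}\nabla_x w$ is taken to be $0$ where $\nabla_x w=0$. Derivatives of $u$ and $v$ are understood in the weak (distributional) sense. Functions are real-valued, and inequalities and identities between measurable functions are understood almost everywhere in $\mathbb{S}$. Entire weak super-solution: a measurable function $u=u(t,x)$ defined in $\mathbb{S}$ is called an entire weak super-solution of $w_t-\Delta_p(w)=|w|^{q-1}w$ in $\mathbb{S}$ if $u\in L_{q,loc}(\mathbb{S})$, $u_t\in L_{1,loc}(\mathbb{S})$, $|\nabla_x u|^{p}\in L_{1,loc}(\mathbb{S})$, and $$\int_{\mathbb{S}}\left[u_t\varphi+\sum_{i=1}^n|\nabla_x u|^{p-2}u_{x_i}\varphi_{x_i}-|u|^{q-1}u\,\varphi\right]dt\,dx\geq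 0$$ for every non-negative function $\varphi\in C^\infty(\mathbb{S})$ with compact support in $\mathbb{S}$. Here "loc" refers to compact subsets of the open set $\mathbb{S}$. Entire weak sub-solution: a function $v=v(t,x)$ is an entire weak sub-solution of the equation if $-v$ is an entire weak super-solution of the equation. No condition is imposed on the behaviour of $u$ and $v$ on the hyperplane $t=0$, nor on the growth of $u$, $v$ or their derivatives at infinity. *)

theory Defs
  imports "HOL-Analysis.Analysis"
begin

text \<open>Functions below are total; only their values on the open set \<open>\<Omega>\<close> are ever used.\<close>

primrec Ck_on :: "nat \<Rightarrow> 'a::euclidean_space set \<Rightarrow> ('a \<Rightarrow> real) \<Rightarrow> bool" where
  "Ck_on 0 \<Omega> f \<longleftrightarrow> continuous_on \<Omega> f"
| "Ck_on (Suc k) \<Omega> f \<longleftrightarrow>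
     (\<forall>z\<in>\<Omega>. f differentiable (at z)) \<and>
     (\<forall>e\<in>Basis. Ck_on k \<Omega> (\<lambda>z. frechet_derivative f (at z) e))"

definition test_fn :: "'a::euclidean_space set \<Rightarrow> ('a \<Rightarrow> real) \<Rightarrow> bool" where
  "test_fn \<Omega> \<phi> \<longleftrightarrow> (\<forall>k. Ck_on k \<Omega> \<phi>) \<and>
     compact (closure {z\<in>\<Omega>. \<phi> z \<noteq> 0}) \<and> closure {z\<in>\<Omega>. \<phi> z \<noteq> 0} \<subseteq> \<Omega>"

definition L1_loc :: "'a::euclidean_space set \<Rightarrow> ('a \<Rightarrow> real) \<Rightarrow> bool" where
  "L1_loc \<Omega> f \<longleftrightarrow> (\<forall>K. compact K \<and> K \<subseteq> \<Omega> \<longrightarrow> integrable (lebesgue_on K) f)"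

definition Lq_loc :: "real \<Rightarrow> 'a::euclidean_space set \<Rightarrow> ('a \<Rightarrow> real) \<Rightarrow> bool" where
  "Lq_loc q \<Omega> f \<longleftrightarrow> f \<in> borel_measurable (lebesgue_on \<Omega>) \<and> L1_loc \<Omega> (\<lambda>z. \<bar>f z\<bar> powr q)"

definition weak_deriv ::
    "'a::euclidean_space set \<Rightarrow> 'a \<Rightarrow> ('a \<Rightarrow> real) \<Rightarrow> ('a \<Rightarrow> real) \<Rightarrow> bool" where
  "weak_deriv \<Omega> e f g \<longleftrightarrow> L1_loc \<Omega> f \<and> L1_loc \<Omega> g \<and>
     (\<forall>\<phi>. test_fn \<Omega> \<phi> \<longrightarrow>
       (LINT z|lebesgue_on \<Omega>. f z * frechet_derivative \<phi> (at z) e)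
         = - (LINT z|lebesgue_on \<Omega>. g z * \<phi> z))"

definition half_space :: "(real \<times> (real ^ 'n)) set" where
  "half_space = {0<..} \<times> UNIV"

text \<open>
  Here \<open>ut\<close> and \<open>G\<close> are the weak time derivative and the weak spatial gradient of \<open>u\<close>; they are
  determined almost everywhere by \<open>u\<close>, so it does not matter which representatives are chosen.
  At zeros of \<open>G\<close> the flux \<open>norm G powr (p - 2) * G $ i\<close> is \<open>0\<close> (\<open>0 powr a = 0\<close>).
  The integrability conditions make the integrand below integrable for every test function
  (\<open>p, q > 1\<close>).
\<close>

definition weak_super_solution ::
    "real \<Rightarrow> real \<Rightarrow> (real \<times> (real ^ 'n) \<Rightarrow> real) \<Rightarrow> bool" where
  "weak_super_solution p q u \<longleftrightarrow>
     Lq_loc q half_space u \<and>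
     (\<exists>(ut :: real \<times> (real ^ 'n) \<Rightarrow> real) (G :: real \<times> (real ^ 'n) \<Rightarrow> real ^ 'n).
        weak_deriv half_space (1, 0) u ut \<and>
        (\<forall>i. weak_deriv half_space (0, axis i 1) u (\<lambda>z. G z $ i)) \<and>
        L1_loc half_space (\<lambda>z. norm (G z) powr p) \<and>
        (\<forall>\<phi>. test_fn half_space \<phi> \<and> (\<forall>z\<in>half_space. 0 \<le> \<phi> z) \<longrightarrow>
          (LINT z|lebesgue_on half_space.
              ut z * \<phi> z
            + (\<Sum>i\<in>UNIV. norm (G z) powr (p - 2) * G z $ i *
                 frechet_derivative \<phi> (at z) (0, axis i 1))
            - \<bar>u z\<bar> powr (q - 1) * u z * \<phi> z) \<ge> 0))"

definition weak_sub_solution ::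
    "real \<Rightarrow> real \<Rightarrow> (real \<times> (real ^ 'n) \<Rightarrow> real) \<Rightarrow> bool" where
  "weak_sub_solution p q v \<longleftrightarrow> weak_super_solution p q (\<lambda>z. - v z)"

end

theory Submission
  imports Defs "HOL-Computational_Algebra.Polynomial"
begin

text \<open>Write \<open>w = u - v \<ge> 0\<close>, \<open>A(\<xi>) = \<bar>\<xi>\<bar>\<^sup>p\<^sup>-\<^sup>2 \<xi>\<close>, \<open>B = A(\<nabla>u) - A(\<nabla>v)\<close> and \<open>h = \<bar>u\<bar>\<^sup>q\<^sup>-\<^sup>1 u - \<bar>v\<bar>\<^sup>q\<^sup>-\<^sup>1 v\<close>.
  Adding the two weak inequalities gives \<open>w\<^sub>t - div B \<ge> h\<close> in the weak sense. Three facts drive the proof.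
  Because \<open>p \<le> 2\<close>, the flux is monotone in the strong form \<open>B \<bullet> \<nabla>w \<ge> c \<bar>B\<bar> powr (p/(p-1))\<close> (lemma
  \<open>flux_monotone\<close>); the source satisfies \<open>h \<ge> c w powr q\<close> (lemma \<open>source_monotone\<close>); and the scaling
  of the equation, \<open>w ~ R powr (-\<kappa>)\<close> on the set \<open>\<bar>x\<bar> \<lesssim> R\<close>, \<open>t \<lesssim> R powr (\<kappa> (q-1))\<close> with \<open>\<kappa> = p/(q-p+1)\<close>,
  makes the integral of \<open>w powr q\<close> over that set of size \<open>R powr (n - \<kappa>)\<close>, which is bounded exactly when
  \<open>q \<le> p - 1 + p/n\<close>.

  Testing with \<open>(w + \<epsilon>) powr (-s) \<zeta>\<close>, where \<open>\<zeta>\<close> is a cutoff function and \<open>s > 0\<close> is small, and applying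
  Young's inequality pointwise (lemma \<open>pointwise_first\<close>) bounds the integral of
  \<open>\<bar>B\<bar> powr (p/(p-1)) (w + \<epsilon>) powr (-s-1) \<zeta>\<close>; this is \<open>first_estimate\<close>. Testing with \<open>\<zeta>\<close> itself and
  absorbing the flux term by means of the first estimate (lemma \<open>pointwise_second\<close>) bounds the integral of
  \<open>w powr q \<zeta>\<close> uniformly in \<open>R\<close> (lemma \<open>Y_bounded\<close>), so \<open>w powr q\<close> is integrable over the whole
  half-space. The bounds on the rescaled derivatives of \<open>\<zeta>\<close> contain a factor that tends to \<open>0\<close> pointwise as
  \<open>R \<rightarrow> \<infinity>\<close> (lemma \<open>lam_tendsto\<close>), so the same computation with small Young constants (lemma \<open>Y_small\<close>) and dominated convergence show that the integral of
  \<open>w powr q\<close> vanishes. This treats the critical and the subcritical exponents at once. Near \<open>t = 0\<close> no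
  boundary condition is needed since the cutoff in time increases there and its derivative has the
  favourable sign.

  The function \<open>(w + \<epsilon>) powr (-s) \<zeta>\<close> is not smooth. The inequality is therefore tested with
  \<open>(w\<^sub>k + \<epsilon>) powr (-s) \<zeta>\<close> for mollifications \<open>w\<^sub>k\<close> of \<open>w\<close>, which is an honest test function, and the limit is
  taken in the resulting inequality (lemma \<open>negative_power_inequality_borel\<close>). Only the \<open>L\<^sup>1\<close> convergence of
  mollifications is needed: the products \<open>B \<bullet> \<nabla>w\<^sub>k\<close> are dominated by \<open>\<bar>B\<bar> powr (p/(p-1))\<close> plus the mollification of
  \<open>\<bar>\<nabla>w\<bar> powr p\<close>, which converges in \<open>L\<^sup>1\<close>.\<close>

section \<open>Smooth functions\<close>

text \<open>A function on the whole space with continuous partial derivatives of every order. Smoothness on \<open>UNIV\<close>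
  suffices for every function constructed below and implies \<open>Ck_on\<close> on every subset.\<close>

definition smooth :: "('a::euclidean_space \<Rightarrow> real) \<Rightarrow> bool" where
  "smooth f \<longleftrightarrow> (\<forall>k. Ck_on k UNIV f)"

text \<open>The derivative in the fixed direction \<open>e\<close>, as a function of the point.\<close>

abbreviation dir_deriv :: "('a::euclidean_space \<Rightarrow> real) \<Rightarrow> 'a \<Rightarrow> 'a \<Rightarrow> real" where
  "dir_deriv f e \<equiv> (\<lambda>z. frechet_derivative f (at z) e)"

lemma Ck_on_subset: "Ck_on k T f \<Longrightarrow> S \<subseteq> T \<Longrightarrow> Ck_on k S f"
  by (induction k arbitrary: f) (auto intro: continuous_on_subset)

lemma Ck_on_Suc_D: "Ck_on (Suc k) S f \<Longrightarrow> Ck_on k S f"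
proof (induction k arbitrary: f)
  case 0
  then show ?case
    by (auto intro!: differentiable_imp_continuous_on simp: differentiable_on_def differentiable_at_withinI)
next
  case (Suc k)
  then show ?case by (metis Ck_on.simps(2))
qed

lemma Ck_on_SucI:
  assumes "\<And>z. (f has_derivative D z) (at z)" "\<And>e. e \<in> Basis \<Longrightarrow> Ck_on k UNIV (\<lambda>z. D z e)"
  shows "Ck_on (Suc k) UNIV f"
proof -
  have "frechet_derivative f (at z) = D z" for z
    using frechet_derivative_at[OF assms(1)] by simp
  with assms show ?thesis by (auto simp: differentiable_def)
qed

lemma Ck_on_has_derivative:
  assumes "Ck_on (Suc k) UNIV f"
  shows "(f has_derivative frechet_derivative f (at z)) (at z)"
  using assms frechet_derivative_works by auto

lemma Ck_on_const: "Ck_on k UNIV (\<lambda>z::'a::euclidean_space. c)"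
proof (induction k arbitrary: c)
  case (Suc k)
  show ?case by (rule Ck_on_SucI[where D="\<lambda>z e. 0"]) (auto intro: Suc)
qed simp

lemma Ck_on_linear:
  assumes "bounded_linear f" shows "Ck_on k UNIV f"
proof (cases k)
  case 0 then show ?thesis by (simp add: assms linear_continuous_on)
next
  case (Suc k')
  then show ?thesis
    using Ck_on_SucI[where D="\<lambda>z. f", OF bounded_linear_imp_has_derivative[OF assms] Ck_on_const]
    by (simp del: Ck_on.simps)
qed

lemma Ck_on_add:
  assumes "Ck_on k UNIV f" "Ck_on k UNIV g" shows "Ck_on k UNIV (\<lambda>z. f z + g z)"
  using assms
proof (induction k arbitrary: f g)
  case 0 then show ?case by (auto intro: continuous_on_add)
next
  case (Suc k)
  show ?case
    by (rule Ck_on_SucI[OF has_derivative_add[OF Suc.prems[THEN Ck_on_has_derivative]]])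
       (use Suc in auto)
qed

lemma Ck_on_mult:
  assumes "Ck_on k UNIV f" "Ck_on k UNIV g" shows "Ck_on k UNIV (\<lambda>z. f z * g z)"
  using assms
proof (induction k arbitrary: f g)
  case 0 then show ?case by (auto intro: continuous_on_mult)
next
  case (Suc k)
  show ?case
    by (rule Ck_on_SucI[OF has_derivative_mult[OF Suc.prems[THEN Ck_on_has_derivative]]])
       (intro Ck_on_add Suc.IH Suc.prems[THEN Ck_on_Suc_D]; use Suc.prems in auto)
qed

lemma Ck_on_powr:
  assumes "Ck_on k UNIV f" "\<And>z. f z > 0" shows "Ck_on k UNIV (\<lambda>z. f z powr a)"
  using assms
proof (induction k arbitrary: a)
  case 0 then show ?case by (auto intro!: continuous_on_powr continuous_on_const simp: less_imp_neq[symmetric])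
next
  case (Suc k)
  show ?case
  proof (rule Ck_on_SucI)
    show "((\<lambda>z. f z powr a) has_derivative (\<lambda>e. a * (f z powr (a - 1)) * frechet_derivative f (at z) e)) (at z)" for z
    proof -
      have "((\<lambda>x. x powr a) has_field_derivative a * f z powr (a - 1)) (at (f z))"
        using Suc.prems by (auto intro!: has_real_derivative_powr)
      from DERIV_compose_FDERIV[OF this Ck_on_has_derivative[OF Suc.prems(1)]]
      show ?thesis by (simp add: mult_ac)
    qed
    show "Ck_on k UNIV (\<lambda>z. a * (f z powr (a - 1)) * frechet_derivative f (at z) e)" if "e \<in> Basis" for e
      using that Suc.prems
      by (intro Ck_on_mult Ck_on_const Suc.IH Ck_on_Suc_D[OF Suc.prems(1)]) auto
  qed
qed

text \<open>The functions \<open>P(1/x) exp(-1/x)\<close>, extended by \<open>0\<close> to \<open>x \<le> 0\<close>. With \<open>P\<close> ranging over all polynomials the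
  family is closed under differentiation, which yields smoothness of each member.\<close>

definition bump_poly :: "real poly \<Rightarrow> real \<Rightarrow> real" where
  "bump_poly P x = (if x > 0 then poly P (1/x) * exp (- (1/x)) else 0)"

lemma poly_exp_tendsto: "((\<lambda>y. poly P y * exp (- y)) \<longlongrightarrow> (0::real)) at_top"
proof -
  have "((\<lambda>y::real. \<Sum>i\<le>degree P. coeff P i * (y ^ i / exp y)) \<longlongrightarrow> (\<Sum>i\<le>degree P. coeff P i * 0)) at_top"
    by (intro tendsto_sum tendsto_mult tendsto_const tendsto_power_div_exp_0)
  moreover have "(\<lambda>y::real. \<Sum>i\<le>degree P. coeff P i * (y ^ i / exp y)) = (\<lambda>y. poly P y * exp (- y))"
    by (auto simp: poly_altdef sum_distrib_right exp_minus divide_simps)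
  ultimately show ?thesis by simp
qed

lemma bump_poly_deriv:
  "(bump_poly P has_field_derivative bump_poly (monom 1 2 * (P - pderiv P)) x) (at x)"
proof -
  consider "x > 0" | "x < 0" | "x = 0" by linarith
  then show ?thesis
  proof cases
    case 1
    have "((\<lambda>x. poly P (1/x) * exp (- (1/x))) has_field_derivative
        bump_poly (monom 1 2 * (P - pderiv P)) x) (at x)"
      using 1 by (auto intro!: derivative_eq_intros poly_DERIV[THEN DERIV_chain2]
          simp: bump_poly_def poly_monom field_simps power2_eq_square)
    then show ?thesis
      by (rule DERIV_cong_ev[THEN iffD1, rotated -1])
         (use 1 in \<open>auto simp: bump_poly_def intro: eventually_mono[OF eventually_nhds_in_open[of "{0<..}"]]\<close>)
  next
    case 2
    have "((\<lambda>x. 0) has_field_derivative bump_poly (monom 1 2 * (P - pderiv P)) x) (at x)"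
      using 2 by (simp add: bump_poly_def)
    then show ?thesis
      by (rule DERIV_cong_ev[THEN iffD1, rotated -1])
         (use 2 in \<open>auto simp: bump_poly_def intro: eventually_mono[OF eventually_nhds_in_open[of "{..<0}"]]\<close>)
  next
    case 3
    have "((\<lambda>h. poly (pCons 0 P) (inverse h) * exp (- inverse h)) \<longlongrightarrow> 0) (at_right (0::real))"
      by (rule filterlim_compose[OF poly_exp_tendsto filterlim_inverse_at_top_right])
    then have "((\<lambda>h. bump_poly P h / h) \<longlongrightarrow> 0) (at_right 0)"
      by (rule tendsto_cong[THEN iffD1, rotated])
         (auto simp: bump_poly_def field_simps eventually_at_filter)
    moreover have "((\<lambda>h. bump_poly P h / h) \<longlongrightarrow> 0) (at_left 0)"
      by (rule tendsto_eventually) (auto simp: bump_poly_def eventually_at_filter)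
    ultimately have "((\<lambda>h. bump_poly P h / h) \<longlongrightarrow> 0) (at 0)"
      by (simp add: filterlim_at_split)
    then show ?thesis using 3 by (simp add: DERIV_def bump_poly_def)
  qed
qed

lemma Ck_on_bump_poly:
  assumes "Ck_on k UNIV f" shows "Ck_on k UNIV (\<lambda>z. bump_poly P (f z))"
  using assms
proof (induction k arbitrary: P)
  case 0 
  have "isCont (bump_poly P) x" for x using bump_poly_deriv DERIV_isCont by blast
  then have "continuous_on UNIV (bump_poly P)" by (simp add: continuous_at_imp_continuous_on)
  with 0 show ?case by (auto intro: continuous_on_compose2)
next
  case (Suc k)
  show ?case
  proof (rule Ck_on_SucI)
    show "((\<lambda>z. bump_poly P (f z)) has_derivative
       (\<lambda>e. bump_poly (monom 1 2 * (P - pderiv P)) (f z) * frechet_derivative f (at z) e)) (at z)" for z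
      using DERIV_compose_FDERIV[OF bump_poly_deriv Ck_on_has_derivative[OF Suc.prems(1)]]
      by (simp add: mult_ac)
    show "Ck_on k UNIV (\<lambda>z. bump_poly (monom 1 2 * (P - pderiv P)) (f z) * frechet_derivative f (at z) e)" if "e \<in> Basis" for e
      using that Suc.prems
      by (intro Ck_on_mult Suc.IH Ck_on_Suc_D[OF Suc.prems(1)]) auto
  qed
qed

lemma smooth_const: "smooth (\<lambda>z. c)" by (simp add: smooth_def Ck_on_const)
lemma smooth_linear: "bounded_linear f \<Longrightarrow> smooth f" by (simp add: smooth_def Ck_on_linear)
lemma smooth_add: "smooth f \<Longrightarrow> smooth g \<Longrightarrow> smooth (\<lambda>z. f z + g z)" by (simp add: smooth_def Ck_on_add)
lemma smooth_mult: "smooth f \<Longrightarrow> smooth g \<Longrightarrow> smooth (\<lambda>z. f z * g z)" by (simp add: smooth_def Ck_on_mult)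
lemma smooth_diff: "smooth f \<Longrightarrow> smooth g \<Longrightarrow> smooth (\<lambda>z. f z - g z)"
  using smooth_add[of f "\<lambda>z. (-1) * g z"] smooth_mult[of "\<lambda>z. -1" g, OF smooth_const] by simp
lemma smooth_powr: "smooth f \<Longrightarrow> (\<And>z. f z > 0) \<Longrightarrow> smooth (\<lambda>z. f z powr a)"
  by (simp add: smooth_def Ck_on_powr)

lemma smooth_has_derivative:
  "smooth f \<Longrightarrow> (f has_derivative frechet_derivative f (at z)) (at z)"
  unfolding smooth_def using Ck_on_has_derivative by blast

lemma smooth_continuous: "smooth f \<Longrightarrow> continuous_on S f"
  unfolding smooth_def using Ck_on.simps(1) continuous_on_subset by blast

lemma smooth_dir_deriv: "smooth f \<Longrightarrow> e \<in> Basis \<Longrightarrow> smooth (dir_deriv f e)"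
  unfolding smooth_def using Ck_on.simps(2) by blast

lemma test_fnI:
  assumes "smooth f" "compact K" "K \<subseteq> \<Omega>" "\<And>z. z \<notin> K \<Longrightarrow> f z = 0"
  shows "test_fn \<Omega> f"
proof -
  have "closure {z\<in>\<Omega>. f z \<noteq> 0} \<subseteq> K"
    using assms by (intro closure_minimal) (auto simp: compact_imp_closed)
  moreover from this have "compact (closure {z\<in>\<Omega>. f z \<noteq> 0})"
    using assms(2) compact_Int_closed[of K "closure {z\<in>\<Omega>. f z \<noteq> 0}"] by (simp add: inf_absorb2)
  ultimately show ?thesis
    using assms by (auto simp: test_fn_def smooth_def intro: Ck_on_subset)
qed

section \<open>Convolution with a smooth kernel\<close>

text \<open>Convolution of an integrable function \<open>f\<close> with a kernel \<open>\<rho>\<close> with respect to Lebesgue measure.\<close>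

definition conv :: "('a::euclidean_space \<Rightarrow> real) \<Rightarrow> ('a \<Rightarrow> real) \<Rightarrow> 'a \<Rightarrow> real" where
  "conv \<rho> f x = (LINT y|lborel. \<rho> (x - y) * f y)"

lemma compact_support_bounded:
  fixes g :: "'a::euclidean_space \<Rightarrow> real"
  assumes "continuous_on UNIV g" "compact K" "\<And>z. z \<notin> K \<Longrightarrow> g z = 0"
  obtains C where "C \<ge> 0" "\<And>z. \<bar>g z\<bar> \<le> C"
proof -
  have "compact (g ` K)"
    using assms by (intro compact_continuous_image) (auto intro: continuous_on_subset)
  then obtain C where "\<And>z. z \<in> K \<Longrightarrow> \<bar>g z\<bar> \<le> C"
    using compact_imp_bounded bounded_real by (metis imageI)
  then have "\<bar>g z\<bar> \<le> max C 0" for z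
    using assms(3)[of z] by (cases "z \<in> K") (auto simp: le_max_iff_disj)
  then show ?thesis using that[of "max C 0"] by auto
qed

lemma lborel_reflect: "distr lborel borel (\<lambda>y. x - y) = (lborel :: 'a::euclidean_space measure)"
proof -
  have "lborel = density (distr lborel borel (\<lambda>y. x - y)) (\<lambda>_. 1)"
    using lborel_affine[of "-1" x] by simp
  then show ?thesis by (metis density_1)
qed

lemma integrable_reflect:
  fixes f :: "'a::euclidean_space \<Rightarrow> real"
  shows "integrable lborel f \<Longrightarrow> integrable lborel (\<lambda>y. f (x - y))"
  using integrable_distr[of "\<lambda>y. x - y" lborel borel f] by (simp add: lborel_reflect)

lemma integral_reflect:
  fixes f :: "'a::euclidean_space \<Rightarrow> real"
  assumes "f \<in> borel_measurable borel"
  shows "(LINT y|lborel. f (x - y)) = (LINT y|lborel. f y)"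
  using integral_distr[of "\<lambda>y. x - y" lborel borel f] assms by (simp add: lborel_reflect)

lemma lborel_shift: "distr lborel borel (\<lambda>x. x - y) = (lborel :: 'a::euclidean_space measure)"
proof -
  have "(\<lambda>x. x - y) = (+) (- y)" by auto
  then show ?thesis by (simp only: lborel_distr_plus)
qed

lemma integrable_shift:
  fixes f :: "'a::euclidean_space \<Rightarrow> real"
  shows "integrable lborel f \<Longrightarrow> integrable lborel (\<lambda>x. f (x - y))"
  using integrable_distr[of "\<lambda>x. x - y" lborel borel f] by (simp add: lborel_shift)

lemma integral_shift:
  fixes f :: "'a::euclidean_space \<Rightarrow> real"
  assumes "f \<in> borel_measurable borel"
  shows "(LINT x|lborel. f (x - y)) = (LINT x|lborel. f x)"
  using integral_distr[of "\<lambda>x. x - y" lborel borel f] assms by (simp add: lborel_shift)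

lemma integrable_bounded_mult:
  fixes f g :: "'a \<Rightarrow> real" and C :: real
  assumes "integrable M f" "g \<in> borel_measurable M" "AE x in M. \<bar>g x\<bar> \<le> C"
  shows "integrable M (\<lambda>x. g x * f x)"
proof (rule Bochner_Integration.integrable_bound[of M "\<lambda>x. C * f x"])
  show "AE x in M. norm (g x * f x) \<le> norm (C * f x)"
    using assms(3) by eventually_elim (auto simp: abs_mult intro!: mult_right_mono)
qed (use assms in auto)

lemma conv_integrable:
  fixes f \<rho> :: "'a::euclidean_space \<Rightarrow> real"
  assumes "integrable lborel f" "continuous_on UNIV \<rho>" "\<And>z. \<bar>\<rho> z\<bar> \<le> C"
  shows "integrable lborel (\<lambda>y. \<rho> (x - y) * f y)"
proof (rule integrable_bounded_mult[where C=C])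
  have [measurable]: "\<rho> \<in> borel_measurable borel" using assms by (simp add: borel_measurable_continuous_onI)
  show "(\<lambda>y. \<rho> (x - y)) \<in> borel_measurable lborel" by measurable
qed (use assms in auto)

lemma conv_alt:
  assumes "f \<in> borel_measurable borel" "\<rho> \<in> borel_measurable borel"
  shows "conv \<rho> f x = (LINT y|lborel. \<rho> y * f (x - y))"
  unfolding conv_def using assms by (subst integral_reflect[symmetric, where x=x]) auto

lemma conv_continuous:
  assumes "integrable lborel f" "continuous_on UNIV \<rho>" "\<And>z. \<bar>\<rho> z\<bar> \<le> C"
  shows "continuous_on UNIV (conv \<rho> f)"
proof (rule continuous_at_imp_continuous_on, rule ballI)
  fix x
  have [measurable]: "\<rho> \<in> borel_measurable borel" using assms by (simp add: borel_measurable_continuous_onI)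
  note assms(1)[measurable]
  show "isCont (conv \<rho> f) x"
    unfolding continuous_at_sequentially o_def
  proof (intro allI impI)
    fix u assume u: "u \<longlonglongrightarrow> x"
    show "(\<lambda>n. conv \<rho> f (u n)) \<longlonglongrightarrow> conv \<rho> f x"
      unfolding conv_def
    proof (rule integral_dominated_convergence[where w="\<lambda>y. C * \<bar>f y\<bar>"])
      show "AE y in lborel. (\<lambda>n. \<rho> (u n - y) * f y) \<longlonglongrightarrow> \<rho> (x - y) * f y"
      proof (rule AE_I2)
        fix y
        have "isCont \<rho> (x - y)" using assms(2) by (simp add: continuous_on_eq_continuous_at)
        then have "(\<lambda>n. \<rho> (u n - y)) \<longlonglongrightarrow> \<rho> (x - y)"
          by (rule isCont_tendsto_compose) (intro tendsto_diff u tendsto_const)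
        then show "(\<lambda>n. \<rho> (u n - y) * f y) \<longlonglongrightarrow> \<rho> (x - y) * f y" by (intro tendsto_mult tendsto_const)
      qed
      show "AE y in lborel. norm (\<rho> (u n - y) * f y) \<le> C * \<bar>f y\<bar>" for n
        using assms(3) by (auto simp: abs_mult intro!: mult_right_mono)
    qed (use assms in auto)
  qed
qed

lemma sum_inner_Basis_delta:
  fixes c :: "'a::euclidean_space \<Rightarrow> real"
  assumes "e \<in> Basis" shows "(\<Sum>b\<in>Basis. (e \<bullet> b) * c b) = c e"
proof -
  have "(\<Sum>b\<in>Basis. (e \<bullet> b) * c b) = (\<Sum>b\<in>Basis. if b = e then c b else 0)"
    using assms by (intro sum.cong) (auto simp: inner_Basis)
  then show ?thesis using assms by simp
qed

lemma frechet_derivative_Basis_sum: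
  fixes g :: "'a::euclidean_space \<Rightarrow> real"
  assumes "(g has_derivative D) (at z)"
  shows "D h = (\<Sum>b\<in>Basis. (h \<bullet> b) * D b)"
proof -
  interpret D: bounded_linear D using assms by (rule has_derivative_bounded_linear)
  have "D h = D (\<Sum>b\<in>Basis. (h \<bullet> b) *\<^sub>R b)" by (simp add: euclidean_representation)
  then show ?thesis by (simp add: D.sum D.scaleR)
qed

lemma dir_deriv_outside:
  fixes g :: "'a::euclidean_space \<Rightarrow> real"
  assumes "closed K" "\<And>z. z \<notin> K \<Longrightarrow> g z = 0" "z \<notin> K"
  shows "frechet_derivative g (at z) e = 0"
proof -
  have "((\<lambda>z. 0) has_derivative (\<lambda>h. 0)) (at z)" by simp
  then have "(g has_derivative (\<lambda>h. 0)) (at z)"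
    by (rule has_derivative_transform_within_open[where s="-K"]) (use assms in auto)
  from frechet_derivative_at[OF this] show ?thesis by metis
qed

lemma smooth_Lipschitz:
  fixes \<rho> :: "'a::euclidean_space \<Rightarrow> real"
  assumes "smooth \<rho>" "compact K" "\<And>z. z \<notin> K \<Longrightarrow> \<rho> z = 0"
  obtains L where "L \<ge> 0" "\<And>x h. \<bar>frechet_derivative \<rho> (at x) h\<bar> \<le> L * norm h"
    "\<And>x y. \<bar>\<rho> x - \<rho> y\<bar> \<le> L * norm (x - y)"
proof -
  have "\<exists>C\<ge>0. \<forall>z. \<bar>dir_deriv \<rho> b z\<bar> \<le> C" if "b \<in> Basis" for b
    by (rule compact_support_bounded[OF smooth_continuous[OF smooth_dir_deriv[OF assms(1) that]] assms(2)
          dir_deriv_outside[OF compact_imp_closed[OF assms(2)] assms(3)]]) auto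
  then obtain C where C: "\<And>b z. b \<in> Basis \<Longrightarrow> \<bar>dir_deriv \<rho> b z\<bar> \<le> C b" "\<And>b. b \<in> Basis \<Longrightarrow> C b \<ge> 0"
    by metis
  let ?L = "\<Sum>b\<in>Basis. C b"
  have 1: "\<bar>frechet_derivative \<rho> (at x) h\<bar> \<le> ?L * norm h" for x h
  proof -
    have "\<bar>frechet_derivative \<rho> (at x) h\<bar> \<le> (\<Sum>b\<in>Basis. \<bar>(h \<bullet> b) * dir_deriv \<rho> b x\<bar>)"
      by (subst frechet_derivative_Basis_sum[OF smooth_has_derivative[OF assms(1)]]) (rule sum_abs)
    also have "\<dots> \<le> (\<Sum>b\<in>Basis. norm h * C b)"
      using C Basis_le_norm by (intro sum_mono) (auto simp: abs_mult intro!: mult_mono)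
    finally show ?thesis by (simp add: sum_distrib_left mult.commute)
  qed
  have pos: "?L \<ge> 0" using C by (intro sum_nonneg)
  have "norm (\<rho> x - \<rho> y) \<le> ?L * norm (x - y)" for x y
  proof (rule differentiable_bound[of UNIV \<rho> "\<lambda>z. frechet_derivative \<rho> (at z)"])
    show "onorm (frechet_derivative \<rho> (at z)) \<le> ?L" for z
      by (rule onorm_le) (use 1 in simp)
    show "(\<rho> has_derivative frechet_derivative \<rho> (at z)) (at z)" for z
      by (rule smooth_has_derivative[OF assms(1)])
  qed auto
  then show ?thesis using that[OF pos 1] by simp
qed

lemma conv_has_derivative:
  fixes \<rho> :: "'a::euclidean_space \<Rightarrow> real"
  assumes f: "integrable lborel f" and \<rho>: "smooth \<rho>" "compact K" "\<And>z. z \<notin> K \<Longrightarrow> \<rho> z = 0"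
  shows "(conv \<rho> f has_derivative (\<lambda>h. \<Sum>b\<in>Basis. (h \<bullet> b) * conv (dir_deriv \<rho> b) f x)) (at x)"
proof -
  note f[measurable]
  have [measurable]: "\<rho> \<in> borel_measurable borel"
    using \<rho> by (simp add: borel_measurable_continuous_onI smooth_continuous)
  have [measurable]: "dir_deriv \<rho> b \<in> borel_measurable borel" if "b \<in> Basis" for b
    using \<rho> that by (simp add: borel_measurable_continuous_onI smooth_continuous smooth_dir_deriv)
  obtain L where L: "L \<ge> 0" "\<And>x h. \<bar>frechet_derivative \<rho> (at x) h\<bar> \<le> L * norm h"
    "\<And>x y. \<bar>\<rho> x - \<rho> y\<bar> \<le> L * norm (x - y)"
    using smooth_Lipschitz[OF \<rho>] by metis
  obtain C where C: "\<And>z. \<bar>\<rho> z\<bar> \<le> C"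
    using compact_support_bounded[OF smooth_continuous[OF \<rho>(1)] \<rho>(2,3)] by blast
  have I1: "integrable lborel (\<lambda>y. \<rho> (x - y) * f y)" for x
    by (rule conv_integrable[OF f smooth_continuous[OF \<rho>(1)] C])
  have I2: "integrable lborel (\<lambda>y. frechet_derivative \<rho> (at (x - y)) b * f y)" if "b \<in> Basis" for b
    by (rule conv_integrable[OF f smooth_continuous[OF smooth_dir_deriv[OF \<rho>(1) that]], of "L * norm b"]) (rule L(2))
  let ?D = "\<lambda>h. \<Sum>b\<in>Basis. (h \<bullet> b) * conv (dir_deriv \<rho> b) f x"
  let ?r = "\<lambda>u y. \<rho> (u - y) - \<rho> (x - y) - frechet_derivative \<rho> (at (x - y)) (u - x)"
  have eq: "conv \<rho> f u - conv \<rho> f x - ?D (u - x) = (LINT y|lborel. ?r u y * f y)" 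
    and int: "integrable lborel (\<lambda>y. ?r u y * f y)" for u
  proof -
    have D: "frechet_derivative \<rho> (at (x - y)) (u - x) * f y
      = (\<Sum>b\<in>Basis. ((u - x) \<bullet> b) * (frechet_derivative \<rho> (at (x - y)) b * f y))" for y
      by (subst frechet_derivative_Basis_sum[OF smooth_has_derivative[OF \<rho>(1)]]) (simp add: sum_distrib_right mult.assoc)
    have R: "(\<lambda>y. ?r u y * f y) = (\<lambda>y. \<rho> (u - y) * f y - \<rho> (x - y) * f y
       - (\<Sum>b\<in>Basis. ((u - x) \<bullet> b) * (frechet_derivative \<rho> (at (x - y)) b * f y)))"
      by (simp add: left_diff_distrib D)
    show "integrable lborel (\<lambda>y. ?r u y * f y)"
      unfolding R by (intro Bochner_Integration.integrable_diff Bochner_Integration.integrable_sum integrable_mult_right I1 I2)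
    show "conv \<rho> f u - conv \<rho> f x - ?D (u - x) = (LINT y|lborel. ?r u y * f y)"
      unfolding R conv_def using I1 I2
      by (simp add: Bochner_Integration.integral_diff Bochner_Integration.integrable_diff
          Bochner_Integration.integral_sum Bochner_Integration.integrable_sum)
  qed
  show ?thesis
    unfolding has_derivative_iff_norm
  proof
    show "bounded_linear ?D"
      by (intro bounded_linear_sum bounded_linear_mult_const bounded_linear_inner_left)
    show "((\<lambda>u. norm (conv \<rho> f u - conv \<rho> f x - ?D (u - x)) / norm (u - x)) \<longlongrightarrow> 0) (at x)"
      unfolding eq tendsto_at_iff_sequentially o_def
    proof (intro allI impI)
      fix u assume u: "\<forall>i. u i \<in> UNIV - {x}" "u \<longlonglongrightarrow> x"
      have "(\<lambda>n. LINT y|lborel. ?r (u n) y * f y / norm (u n - x)) \<longlonglongrightarrow> (LINT y|(lborel::'a measure). 0)"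
      proof (rule integral_dominated_convergence[where w="\<lambda>y. 2 * L * \<bar>f y\<bar>"])
        show "(\<lambda>y. ?r (u n) y * f y / norm (u n - x)) \<in> borel_measurable lborel" for n
          using int by (intro borel_measurable_divide borel_measurable_integrable) auto
        show "AE y in lborel. norm (?r (u n) y * f y / norm (u n - x)) \<le> 2 * L * \<bar>f y\<bar>" for n
        proof (rule AE_I2)
          fix y
          have pos: "norm (u n - x) > 0" using u(1) by auto
          have "\<bar>?r (u n) y\<bar> \<le> \<bar>\<rho> (u n - y) - \<rho> (x - y)\<bar> + \<bar>frechet_derivative \<rho> (at (x - y)) (u n - x)\<bar>" by linarith
          also have "\<dots> \<le> 2 * L * norm (u n - x)"
            using L(3)[of "u n - y" "x - y"] L(2)[of "x - y" "u n - x"] by simp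
          finally have "\<bar>?r (u n) y\<bar> * \<bar>f y\<bar> \<le> 2 * L * norm (u n - x) * \<bar>f y\<bar>" by (rule mult_right_mono) simp
          then show "norm (?r (u n) y * f y / norm (u n - x)) \<le> 2 * L * \<bar>f y\<bar>"
            using pos by (simp add: abs_mult divide_simps mult_ac)
        qed
        show "AE y in lborel. (\<lambda>n. ?r (u n) y * f y / norm (u n - x)) \<longlonglongrightarrow> 0"
        proof (rule AE_I2)
          fix y
          have "((\<lambda>z. (\<rho> z - \<rho> (x - y) - frechet_derivative \<rho> (at (x - y)) (z - (x - y))) /\<^sub>R norm (z - (x - y))) \<longlongrightarrow> 0) (at (x - y))"
            using smooth_has_derivative[OF \<rho>(1), of "x - y"] by (simp add: has_derivative_def netlimit_at)
          then have "(\<lambda>n. (\<rho> (u n - y) - \<rho> (x - y) - frechet_derivative \<rho> (at (x - y)) ((u n - y) - (x - y))) /\<^sub>R norm ((u n - y) - (x - y))) \<longlonglongrightarrow> 0"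
            unfolding tendsto_at_iff_sequentially o_def
            using u by (auto dest!: spec[of _ "\<lambda>n. u n - y"] intro: tendsto_diff)
          then have "(\<lambda>n. ?r (u n) y / norm (u n - x)) \<longlonglongrightarrow> 0" by (simp add: divide_inverse mult.commute)
          from tendsto_mult_right_zero[OF this, of "f y"]
          show "(\<lambda>n. ?r (u n) y * f y / norm (u n - x)) \<longlonglongrightarrow> 0" by (simp add: mult_ac)
        qed
      qed (use f in auto)
      then have "(\<lambda>n. LINT y|lborel. ?r (u n) y * f y / norm (u n - x)) \<longlonglongrightarrow> 0"
        by simp
      from tendsto_norm_zero[OF this]
      show "(\<lambda>n. norm (LINT y|lborel. ?r (u n) y * f y) / norm (u n - x)) \<longlonglongrightarrow> 0"
        by (simp only: integral_divide_zero norm_divide real_norm_def abs_norm_cancel abs_divide)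
    qed
  qed
qed

lemma conv_dir_deriv:
  assumes "integrable lborel f" "smooth \<rho>" "compact K" "\<And>z. z \<notin> K \<Longrightarrow> \<rho> z = 0" "e \<in> Basis"
  shows "frechet_derivative (conv \<rho> f) (at x) e = conv (dir_deriv \<rho> e) f x"
  using fun_cong[OF frechet_derivative_at[OF conv_has_derivative[OF assms(1-4), of x]], of e]
  by (simp add: sum_inner_Basis_delta[OF assms(5)])

lemma smooth_conv:
  assumes "integrable lborel f" "smooth \<rho>" "compact K" "\<And>z. z \<notin> K \<Longrightarrow> \<rho> z = 0"
  shows "smooth (conv \<rho> f)"
proof -
  have "Ck_on k UNIV (conv \<rho> f)" for k
    using assms(2,4)
  proof (induction k arbitrary: \<rho>)
    case 0
    obtain C where "\<And>z. \<bar>\<rho> z\<bar> \<le> C"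
      using compact_support_bounded[OF smooth_continuous[OF 0(1)] assms(3)] 0(2) by blast
    from conv_continuous[OF assms(1) smooth_continuous[OF 0(1)] this] show ?case by simp
  next
    case (Suc k)
    have "Ck_on k UNIV (\<lambda>z. \<Sum>b\<in>Basis. (e \<bullet> b) * conv (dir_deriv \<rho> b) f z)" if e: "e \<in> Basis" for e
    proof -
      have "(\<lambda>z. \<Sum>b\<in>Basis. (e \<bullet> b) * conv (dir_deriv \<rho> b) f z) = conv (dir_deriv \<rho> e) f"
        using sum_inner_Basis_delta[OF e] by auto
      moreover have "Ck_on k UNIV (conv (dir_deriv \<rho> e) f)"
        using e Suc.prems by (intro Suc.IH smooth_dir_deriv dir_deriv_outside[OF compact_imp_closed[OF assms(3)]]) auto
      ultimately show ?thesis by simp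
    qed
    then show ?case
      by (intro Ck_on_SucI[OF conv_has_derivative[OF assms(1) Suc.prems(1) assms(3) Suc.prems(2)]]) auto
  qed
  then show ?thesis by (simp add: smooth_def)
qed

text \<open>Near \<open>0\<close> the convolution of \<open>F\<close> with the indicator function of the compact set \<open>ball - K\<close> is constant, equal to
  the integral of \<open>F\<close>; its derivative there is the integral of the derivative of \<open>F\<close>.\<close>

lemma integral_dir_deriv_zero:
  fixes F :: "'a::euclidean_space \<Rightarrow> real"
  assumes F: "smooth F" "compact K" "\<And>z. z \<notin> K \<Longrightarrow> F z = 0" and e: "e \<in> Basis"
  shows "(LINT x|lborel. frechet_derivative F (at x) e) = 0"
proof -
  define K2 where "K2 = {x - z | x z. x \<in> cball (0::'a) 1 \<and> z \<in> K}"
  have K2: "compact K2" unfolding K2_def by (intro compact_differences compact_cball F)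
  let ?f = "indicator K2 :: 'a \<Rightarrow> real"
  have f: "integrable lborel ?f"
    using K2 emeasure_compact_finite by (intro integrable_real_indicator) (auto intro: borel_compact)
  have [measurable]: "F \<in> borel_measurable borel" "dir_deriv F e \<in> borel_measurable borel"
    using F e by (auto simp: borel_measurable_continuous_onI smooth_continuous smooth_dir_deriv)
  have key: "conv G ?f x = (LINT y|lborel. G y)" 
    if x: "x \<in> ball 0 1" and G: "\<And>z. z \<notin> K \<Longrightarrow> G z = 0" and [measurable]: "G \<in> borel_measurable borel" for x G
  proof -
    have "conv G ?f x = (LINT y|lborel. G (x - y))"
      unfolding conv_def
    proof (rule Bochner_Integration.integral_cong)
      fix y
      show "G (x - y) * indicator K2 y = G (x - y)"
      proof (cases "x - y \<in> K")
        case True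
        have "y \<in> K2" unfolding K2_def
        proof (intro CollectI exI conjI)
          show "y = x - (x - y)" by simp
        qed (use True x in auto)
        then show ?thesis by simp
      qed (simp add: G)
    qed simp
    then show ?thesis using integral_reflect[of G x] that by simp
  qed
  have "((\<lambda>x. LINT y|lborel. F y) has_derivative (\<lambda>h. 0)) (at 0)" by simp
  then have "(conv F ?f has_derivative (\<lambda>h. 0)) (at 0)"
    by (rule has_derivative_transform_within_open[where s="ball 0 1"]) (use key[of _ F] F in auto)
  from frechet_derivative_at[OF this] have "frechet_derivative (conv F ?f) (at 0) e = 0" by metis
  then have "conv (dir_deriv F e) ?f 0 = 0" by (simp add: conv_dir_deriv[OF f F e])
  moreover have "conv (dir_deriv F e) ?f 0 = (LINT y|lborel. dir_deriv F e y)"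
    by (rule key) (use dir_deriv_outside[OF compact_imp_closed[OF F(2)] F(3)] in auto)
  ultimately show ?thesis by simp
qed

section \<open>Continuity of translations in \<open>L\<^sup>1\<close>\<close>

text \<open>The \<open>L\<^sup>1\<close> distance of \<open>f\<close> from its translate by \<open>y\<close>.\<close>

definition shift_dist :: "('a::euclidean_space \<Rightarrow> real) \<Rightarrow> 'a \<Rightarrow> real" where
  "shift_dist f y = (LINT x|lborel. \<bar>f (x - y) - f x\<bar>)"

lemma shift_dist_integrable:
  fixes f :: "'a::euclidean_space \<Rightarrow> real"
  shows
  "integrable lborel f \<Longrightarrow> integrable lborel (\<lambda>x. \<bar>f (x - y) - f x\<bar>)"
  by (intro integrable_abs Bochner_Integration.integrable_diff integrable_shift)

lemma shift_dist_nonneg: "shift_dist f y \<ge> 0"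
  by (simp add: shift_dist_def)

text \<open>Continuity of translations passes to limits in \<open>L\<^sup>1\<close>.\<close>

lemma shift_dist_approx:
  fixes f :: "'a::euclidean_space \<Rightarrow> real"
  assumes f: "integrable lborel f"
    and app: "\<And>\<eta>. \<eta> > 0 \<Longrightarrow> \<exists>g. integrable lborel g \<and> (LINT x|lborel. \<bar>f x - g x\<bar>) \<le> \<eta> \<and> (shift_dist g \<longlongrightarrow> 0) (at 0)"
  shows "(shift_dist f \<longlongrightarrow> 0) (at 0)"
proof (rule tendstoI)
  fix e :: real assume "e > 0"
  then obtain g where g: "integrable lborel g" "(LINT x|lborel. \<bar>f x - g x\<bar>) \<le> e/4" "(shift_dist g \<longlongrightarrow> 0) (at 0)"
    using app[of "e/4"] by auto
  have le: "shift_dist f y \<le> 2 * (LINT x|lborel. \<bar>f x - g x\<bar>) + shift_dist g y" for y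
  proof -
    have i: "integrable lborel (\<lambda>x. \<bar>f x - g x\<bar>)" using f g by auto
    have "shift_dist f y \<le> (LINT x|lborel. \<bar>f (x - y) - g (x - y)\<bar> + (\<bar>f x - g x\<bar> + \<bar>g (x - y) - g x\<bar>))"
      unfolding shift_dist_def
      by (intro integral_mono shift_dist_integrable Bochner_Integration.integrable_add f g i integrable_shift[OF i]) auto
    also have "\<dots> = (LINT x|lborel. \<bar>f (x - y) - g (x - y)\<bar>) + ((LINT x|lborel. \<bar>f x - g x\<bar>) + shift_dist g y)"
      unfolding shift_dist_def using integrable_shift[OF i, of y]
      by (simp add: shift_dist_integrable g(1) i Bochner_Integration.integrable_add)
    also have "(LINT x|lborel. \<bar>f (x - y) - g (x - y)\<bar>) = (LINT x|lborel. \<bar>f x - g x\<bar>)"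
      using f g by (intro integral_shift[of "\<lambda>x. \<bar>f x - g x\<bar>"]) auto
    finally show ?thesis by simp
  qed
  have "\<forall>\<^sub>F y in at 0. shift_dist g y < e/2"
    using g(3) \<open>e > 0\<close> by (intro order_tendstoD) auto
  then show "\<forall>\<^sub>F y in at 0. dist (shift_dist f y) 0 < e"
  proof eventually_elim
    case (elim y)
    then show ?case using le[of y] g(2) shift_dist_nonneg[of f y] by (simp add: dist_real_def)
  qed
qed

text \<open>For an open set \<open>U\<close> the positive part of \<open>1\<^sub>U - 1\<^sub>U(\<cdot> - y)\<close> tends to \<open>0\<close> pointwise as \<open>y \<rightarrow> 0\<close>. Since translation
  preserves the integral, the \<open>L\<^sup>1\<close> distance is twice the integral of that positive part.\<close>

lemma shift_dist_open:
  fixes U :: "'a::euclidean_space set"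
  assumes "open U" "emeasure lborel U < \<infinity>"
  shows "(shift_dist (\<lambda>x. indicator U x * c) \<longlongrightarrow> 0) (at 0)"
  unfolding tendsto_at_iff_sequentially o_def
proof (intro allI impI)
  fix u :: "nat \<Rightarrow> 'a" assume u: "\<forall>i. u i \<in> UNIV - {0}" "u \<longlonglongrightarrow> 0"
  let ?U = "indicator U :: 'a \<Rightarrow> real"
  have [measurable]: "U \<in> sets borel" using assms by simp
  have iU: "integrable lborel ?U" using assms by (intro integrable_real_indicator) auto
  have iUs: "integrable lborel (\<lambda>x. ?U (x - y))" for y by (rule integrable_shift[OF iU])
  let ?m = "\<lambda>n x. max 0 (?U x - ?U (x - u n))"
  have "(\<lambda>n. LINT x|lborel. ?m n x) \<longlonglongrightarrow> (LINT x|(lborel::'a measure). 0)"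
  proof (rule integral_dominated_convergence[where w="?U"])
    show "AE x in lborel. (\<lambda>n. ?m n x) \<longlonglongrightarrow> 0"
    proof (rule AE_I2)
      fix x
      show "(\<lambda>n. ?m n x) \<longlonglongrightarrow> 0"
      proof (cases "x \<in> U")
        case True
        have "(\<lambda>n. x - u n) \<longlonglongrightarrow> x - 0" by (intro tendsto_diff tendsto_const u)
        then have "\<forall>\<^sub>F n in sequentially. x - u n \<in> U"
          using assms(1) True by (intro topological_tendstoD) auto
        then show ?thesis
          by (intro tendsto_eventually) (auto elim: eventually_mono simp: True)
      qed simp
    qed
  qed (use iU in \<open>auto simp: indicator_def\<close>)
  then have m: "(\<lambda>n. 2 * \<bar>c\<bar> * (LINT x|lborel. ?m n x)) \<longlonglongrightarrow> 0"
    by (intro tendsto_mult_right_zero) simp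
  have "shift_dist (\<lambda>x. ?U x * c) (u n) = 2 * \<bar>c\<bar> * (LINT x|lborel. ?m n x)" for n
  proof -
    have im: "integrable lborel (?m n)"
      by (intro Bochner_Integration.integrable_max Bochner_Integration.integrable_diff iU iUs integrable_zero)
    have "shift_dist (\<lambda>x. ?U x * c) (u n) = (LINT x|lborel. \<bar>c\<bar> * (2 * ?m n x - ?U x + ?U (x - u n)))"
      unfolding shift_dist_def by (rule Bochner_Integration.integral_cong) (auto simp: indicator_def)
    also have "\<dots> = \<bar>c\<bar> * (2 * (LINT x|lborel. ?m n x) - (LINT x|lborel. ?U x) + (LINT x|lborel. ?U (x - u n)))"
      using im iU iUs[of "u n"] by simp
    also have "(LINT x|lborel. ?U (x - u n)) = (LINT x|lborel. ?U x)"
      by (rule integral_shift) simp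
    finally show ?thesis by simp
  qed
  with m show "(\<lambda>n. shift_dist (\<lambda>x. ?U x * c) (u n)) \<longlonglongrightarrow> 0" by simp
qed

lemma shift_dist_tendsto_0:
  fixes f :: "'a::euclidean_space \<Rightarrow> real"
  assumes "integrable lborel f"
  shows "(shift_dist f \<longlongrightarrow> 0) (at 0)"
  using assms
proof induction
  case (base A c)
  then have [measurable]: "A \<in> sets borel" by simp
  have fA: "integrable lborel (\<lambda>x. indicator A x *\<^sub>R c)"
    using base by (intro integrable_scaleR_left integrable_real_indicator) auto
  show ?case
  proof (rule shift_dist_approx[OF fA])
    fix \<eta> :: real assume "\<eta> > 0"
    then have "\<eta> / (\<bar>c\<bar> + 1) > 0" by (simp add: add_pos_nonneg divide_pos_pos)
    then obtain U where U: "open U" "A \<subseteq> U" "emeasure lborel (U - A) < ennreal (\<eta> / (\<bar>c\<bar> + 1))"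
      using outer_regular_lborel[of A] by auto
    then have [measurable]: "U \<in> sets borel" by simp
    have "emeasure lborel U = emeasure lborel A + emeasure lborel (U - A)"
      using U by (subst plus_emeasure) (auto simp: Un_absorb1)
    then have Uf: "emeasure lborel U < \<infinity>"
      using base U(3) by (auto simp: less_top[symmetric] top_unique ennreal_add_eq_top dest: less_trans[OF _ ennreal_less_top])
    have iU: "integrable lborel (indicator U :: 'a \<Rightarrow> real)" using Uf by (intro integrable_real_indicator) auto
    have "(LINT x|lborel. \<bar>indicator A x *\<^sub>R c - indicator U x * c\<bar>) = (LINT x|lborel. indicator (U - A) x * \<bar>c\<bar>)"
      using U(2) by (intro Bochner_Integration.integral_cong) (auto simp: indicator_def)
    also have "\<dots> = measure lborel (U - A) * \<bar>c\<bar>" by simp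
    also have "\<dots> \<le> \<eta> / (\<bar>c\<bar> + 1) * \<bar>c\<bar>"
      using U(3) \<open>\<eta> / (\<bar>c\<bar> + 1) > 0\<close> by (intro mult_right_mono) (auto simp: measure_def intro!: enn2real_leI)
    also have "\<dots> \<le> \<eta>" using \<open>\<eta> > 0\<close> by (simp add: divide_simps)
    finally show "\<exists>g. integrable lborel g \<and> (LINT x|lborel. \<bar>indicator A x *\<^sub>R c - g x\<bar>) \<le> \<eta> \<and> (shift_dist g \<longlongrightarrow> 0) (at 0)"
      using shift_dist_open[OF U(1) Uf, of c] iU by (intro exI[of _ "\<lambda>x. indicator U x * c"]) auto
  qed
next
  case (add f g)
  have le: "shift_dist (\<lambda>x. f x + g x) y \<le> shift_dist f y + shift_dist g y" for y
  proof -
    have "shift_dist (\<lambda>x. f x + g x) y \<le> (LINT x|lborel. \<bar>f (x - y) - f x\<bar> + \<bar>g (x - y) - g x\<bar>)"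
      unfolding shift_dist_def
      by (intro integral_mono shift_dist_integrable Bochner_Integration.integrable_add add) auto
    then show ?thesis
      unfolding shift_dist_def by (simp add: shift_dist_integrable add)
  qed
  have "((\<lambda>y. shift_dist f y + shift_dist g y) \<longlongrightarrow> 0) (at 0)"
    using tendsto_add[OF add.IH] by simp
  then show ?case
    by (rule tendsto_sandwich[rotated 2, OF tendsto_const]) (auto simp: le shift_dist_nonneg)
next
  case (lim f s)
  show ?case
  proof (rule shift_dist_approx[OF lim.hyps(4)])
    fix \<eta> :: real assume "\<eta> > 0"
    have [measurable]: "f \<in> borel_measurable borel" "s i \<in> borel_measurable borel" for i
      using lim.hyps(1)[of i] lim.hyps(4) by auto
    have "(\<lambda>i. LINT x|lborel. \<bar>f x - s i x\<bar>) \<longlonglongrightarrow> (LINT x|(lborel::'a measure). 0)"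
    proof (rule integral_dominated_convergence[where w="\<lambda>x. 3 * \<bar>f x\<bar>"])
      show "AE x in lborel. (\<lambda>i. \<bar>f x - s i x\<bar>) \<longlonglongrightarrow> 0"
      proof (rule AE_I2)
        fix x
        have "(\<lambda>i. f x - s i x) \<longlonglongrightarrow> f x - f x" by (intro tendsto_diff tendsto_const lim.hyps(2)) simp
        then show "(\<lambda>i. \<bar>f x - s i x\<bar>) \<longlonglongrightarrow> 0" by (simp add: tendsto_rabs_zero)
      qed
      show "AE x in lborel. norm \<bar>f x - s i x\<bar> \<le> 3 * \<bar>f x\<bar>" for i
      proof (rule AE_I2)
        fix x show "norm \<bar>f x - s i x\<bar> \<le> 3 * \<bar>f x\<bar>" using lim.hyps(3)[of x i] by simp
      qed
    qed (use lim.hyps(4) in auto)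
    then have "\<forall>\<^sub>F i in sequentially. (LINT x|lborel. \<bar>f x - s i x\<bar>) < \<eta>"
      using \<open>\<eta> > 0\<close> by (intro order_tendstoD(2)) auto
    then obtain i where "(LINT x|lborel. \<bar>f x - s i x\<bar>) < \<eta>"
      by (auto simp: eventually_sequentially)
    then show "\<exists>g. integrable lborel g \<and> (LINT x|lborel. \<bar>f x - g x\<bar>) \<le> \<eta> \<and> (shift_dist g \<longlongrightarrow> 0) (at 0)"
      using lim by (intro exI[of _ "s i"]) auto
  qed
qed

section \<open>Mollifiers\<close>

text \<open>A smooth probability density supported in the closed ball of radius \<open>r\<close> around \<open>0\<close>.\<close>

definition mollifier :: "real \<Rightarrow> ('a::euclidean_space \<Rightarrow> real) \<Rightarrow> bool" where
  "mollifier r \<rho> \<longleftrightarrow> smooth \<rho> \<and> (\<forall>z. \<rho> z \<ge> 0) \<and> (\<forall>z. z \<notin> cball 0 r \<longrightarrow> \<rho> z = 0) \<and> (LINT z|lborel. \<rho> z) = 1"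

lemma compact_support_integrable:
  fixes g :: "'a::euclidean_space \<Rightarrow> real"
  assumes "continuous_on UNIV g" "compact K" "\<And>z. z \<notin> K \<Longrightarrow> g z = 0"
  shows "integrable lborel g"
proof -
  have "integrable lborel (\<lambda>x. indicator K x *\<^sub>R g x)"
    using borel_integrable_compact[OF assms(2) continuous_on_subset[OF assms(1)]] by (simp add: set_integrable_def)
  also have "(\<lambda>x. indicator K x *\<^sub>R g x) = g"
  proof
    fix x show "indicator K x *\<^sub>R g x = g x" using assms(3)[of x] by (cases "x \<in> K") auto
  qed
  finally show ?thesis .
qed

text \<open>The basic smooth function that vanishes on the negative half-line and is positive on the positive one.\<close>

definition bump :: "real \<Rightarrow> real" where "bump x = (if x > 0 then exp (- (1/x)) else 0)"

lemma smooth_bump: assumes "smooth f" shows "smooth (\<lambda>z. bump (f z))"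
proof -
  have "bump = bump_poly 1" by (auto simp: bump_def bump_poly_def)
  then show ?thesis using assms Ck_on_bump_poly[of _ f 1] by (simp add: smooth_def)
qed

lemma smooth_sum: "finite A \<Longrightarrow> (\<And>i. i \<in> A \<Longrightarrow> smooth (f i)) \<Longrightarrow> smooth (\<lambda>z. \<Sum>i\<in>A. f i z)"
  by (induction A rule: finite_induct) (auto intro: smooth_add smooth_const)

lemma smooth_inner_self: "smooth (\<lambda>z::'a::euclidean_space. z \<bullet> z)"
  by (subst euclidean_inner)
     (intro smooth_sum smooth_mult smooth_linear bounded_linear_inner_left finite_Basis)

lemma mollifier_exists:
  assumes "r > 0" shows "\<exists>\<rho>::'a::euclidean_space \<Rightarrow> real. mollifier r \<rho>"
proof -
  define g :: "'a \<Rightarrow> real" where "g = (\<lambda>z. bump (r^2 - z \<bullet> z))"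
  have g: "smooth g" unfolding g_def by (intro smooth_bump smooth_diff smooth_const smooth_inner_self)
  have nn: "g z \<ge> 0" for z by (simp add: g_def bump_def)
  have out: "g z = 0" if "z \<notin> cball 0 r" for z
  proof -
    have "z \<bullet> z \<ge> r^2" using that assms by (simp add: dot_square_norm power_mono)
    then show ?thesis by (simp add: g_def bump_def)
  qed
  have i: "integrable lborel g"
    by (rule compact_support_integrable[OF smooth_continuous[OF g] compact_cball out])
  have pos: "(LINT z|lborel. g z) > 0"
  proof -
    have "(LINT z|lborel. g z) \<noteq> 0"
    proof
      assume "(LINT z|lborel. g z) = 0"
      then have ae: "AE z in lborel. g z = 0"
        using integral_nonneg_eq_0_iff_AE[OF i] nn by simp
      have nz: "z \<notin> ball 0 r" if "g z = 0" for z
      proof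
        assume "z \<in> ball 0 r"
        then have "z \<bullet> z < r^2" using assms by (simp add: dot_square_norm power_strict_mono)
        then show False using that by (simp add: g_def bump_def)
      qed
      have "AE z in lborel. z \<notin> ball (0::'a) r" using ae by (rule eventually_mono) (rule nz)
      then have "ball (0::'a) r \<in> null_sets lborel" by (subst AE_iff_null_sets) auto
      then have "ball (0::'a) r \<in> null_sets lebesgue" by (rule null_sets_completionI)
      then show False
        using open_not_negligible[of "ball (0::'a) r"] assms negligible_iff_null_sets by auto
    qed
    moreover have "(LINT z|lborel. g z) \<ge> 0" using nn by simp
    ultimately show ?thesis by linarith
  qed
  have "mollifier r (\<lambda>z. (1 / (LINT z|lborel. g z)) * g z)"
    unfolding mollifier_def using pos nn out i smooth_mult[OF smooth_const g, of "1 / (LINT z|lborel. g z)"]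
    by auto
  then show ?thesis by blast
qed

lemma mollifier_smooth: "mollifier r \<rho> \<Longrightarrow> smooth \<rho>" by (simp add: mollifier_def)
lemma mollifier_outside: "mollifier r \<rho> \<Longrightarrow> z \<notin> cball 0 r \<Longrightarrow> \<rho> z = 0" by (simp add: mollifier_def)

lemma mollifier_measurable [measurable_dest]: "mollifier r \<rho> \<Longrightarrow> \<rho> \<in> borel_measurable borel"
  by (simp add: borel_measurable_continuous_onI mollifier_def smooth_continuous)

lemma mollifier_conv_integrable:
  assumes "mollifier r \<rho>" "integrable lborel f"
  shows "integrable lborel (\<lambda>y. \<rho> (x - y) * f y)"
proof -
  obtain C where "\<And>z. \<bar>\<rho> z\<bar> \<le> C"
    using compact_support_bounded[OF smooth_continuous[OF mollifier_smooth[OF assms(1)]] compact_cball mollifier_outside[OF assms(1)]] by blast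
  from conv_integrable[OF assms(2) smooth_continuous[OF mollifier_smooth[OF assms(1)]] this]
  show ?thesis .
qed

text \<open>By Tonelli, the \<open>L\<^sup>1\<close> distance of \<open>f\<close> from its mollification is at most an average of the distances of
  \<open>f\<close> from its translates.\<close>

lemma mollifier_L1_bound:
  fixes f :: "'a::euclidean_space \<Rightarrow> real"
  assumes m: "mollifier r \<rho>" and f: "integrable lborel f"
    and b: "\<And>y. y \<in> cball 0 r \<Longrightarrow> shift_dist f y \<le> \<eta>"
  shows "integrable lborel (\<lambda>x. conv \<rho> f x - f x)" "(LINT x|lborel. \<bar>conv \<rho> f x - f x\<bar>) \<le> \<eta>"
proof -
  have [measurable]: "\<rho> \<in> borel_measurable borel" "f \<in> borel_measurable borel"
    using m f by (auto dest: mollifier_measurable)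
  have rho: "\<And>z. \<rho> z \<ge> 0" "(LINT z|lborel. \<rho> z) = 1" using m by (auto simp: mollifier_def)
  have irho: "integrable lborel \<rho>"
    by (rule compact_support_integrable[OF smooth_continuous[OF mollifier_smooth[OF m]] compact_cball mollifier_outside[OF m]])
  have [measurable]: "conv \<rho> f \<in> borel_measurable borel"
    by (rule borel_measurable_continuous_onI[OF smooth_continuous[OF
        smooth_conv[OF f mollifier_smooth[OF m] compact_cball mollifier_outside[OF m]]]])
  have \<eta>: "\<eta> \<ge> 0 \<or> (\<forall>z. \<rho> z = 0)" 
    by (cases "r \<ge> 0") (use b[of 0] shift_dist_nonneg[of f 0] mollifier_outside[OF m] in auto)
  have "\<eta> \<ge> 0" using \<eta> rho(2) by auto
  have le: "ennreal \<bar>conv \<rho> f x - f x\<bar> \<le> (\<integral>\<^sup>+y. ennreal (\<rho> y * \<bar>f (x - y) - f x\<bar>) \<partial>lborel)" for x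
  proof -
    have i1: "integrable lborel (\<lambda>y. \<rho> y * f (x - y))"
      using integrable_reflect[OF mollifier_conv_integrable[OF m f, of x], of x] by simp
    have i2: "integrable lborel (\<lambda>y. \<rho> y * (f (x - y) - f x))"
      unfolding right_diff_distrib using i1 irho by auto
    have i3: "integrable lborel (\<lambda>y. \<rho> y * \<bar>f (x - y) - f x\<bar>)"
      using integrable_abs[OF i2] rho(1) by (simp add: abs_mult)
    have "conv \<rho> f x - f x = (LINT y|lborel. \<rho> y * (f (x - y) - f x))"
      unfolding right_diff_distrib using i1 irho rho(2) by (subst conv_alt) simp_all
    also have "\<bar>\<dots>\<bar> \<le> (LINT y|lborel. \<bar>\<rho> y * (f (x - y) - f x)\<bar>)"
      using integral_norm_bound[of lborel "\<lambda>y. \<rho> y * (f (x - y) - f x)"] by simp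
    also have "\<dots> = (LINT y|lborel. \<rho> y * \<bar>f (x - y) - f x\<bar>)"
      using rho(1) by (simp add: abs_mult)
    finally have "ennreal \<bar>conv \<rho> f x - f x\<bar> \<le> ennreal (LINT y|lborel. \<rho> y * \<bar>f (x - y) - f x\<bar>)"
      by (rule ennreal_leI)
    also have "\<dots> = (\<integral>\<^sup>+y. ennreal (\<rho> y * \<bar>f (x - y) - f x\<bar>) \<partial>lborel)"
      using rho(1) by (intro nn_integral_eq_integral[symmetric] i3) auto
    finally show ?thesis .
  qed
  have "(\<integral>\<^sup>+x. ennreal \<bar>conv \<rho> f x - f x\<bar> \<partial>lborel)
     \<le> (\<integral>\<^sup>+x. (\<integral>\<^sup>+y. ennreal (\<rho> y * \<bar>f (x - y) - f x\<bar>) \<partial>lborel) \<partial>lborel)"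
    by (intro nn_integral_mono le)
  also have "\<dots> = (\<integral>\<^sup>+y. (\<integral>\<^sup>+x. ennreal (\<rho> y * \<bar>f (x - y) - f x\<bar>) \<partial>lborel) \<partial>lborel)"
    by (rule lborel_pair.Fubini') measurable
  also have "\<dots> \<le> (\<integral>\<^sup>+y. ennreal (\<rho> y * \<eta>) \<partial>lborel)"
  proof (rule nn_integral_mono)
    fix y
    have "(\<integral>\<^sup>+x. ennreal (\<rho> y * \<bar>f (x - y) - f x\<bar>) \<partial>lborel) = ennreal (\<rho> y * shift_dist f y)"
      unfolding shift_dist_def using rho(1) shift_dist_integrable[OF f, of y]
      by (subst nn_integral_eq_integral) auto
    also have "\<dots> \<le> ennreal (\<rho> y * \<eta>)"
      using b[of y] rho(1)[of y] mollifier_outside[OF m, of y]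
      by (cases "y \<in> cball 0 r") (auto intro!: ennreal_leI mult_left_mono)
    finally show "(\<integral>\<^sup>+x. ennreal (\<rho> y * \<bar>f (x - y) - f x\<bar>) \<partial>lborel) \<le> ennreal (\<rho> y * \<eta>)" .
  qed
  also have "\<dots> = ennreal \<eta>"
    using rho irho \<open>\<eta> \<ge> 0\<close> by (subst nn_integral_eq_integral) auto
  finally have fin: "(\<integral>\<^sup>+x. ennreal \<bar>conv \<rho> f x - f x\<bar> \<partial>lborel) \<le> ennreal \<eta>" .
  show i: "integrable lborel (\<lambda>x. conv \<rho> f x - f x)"
    using fin by (intro integrableI_bounded) (auto intro: le_less_trans[OF _ ennreal_less_top])
  show "(LINT x|lborel. \<bar>conv \<rho> f x - f x\<bar>) \<le> \<eta>"
    using fin \<open>\<eta> \<ge> 0\<close> by (subst (asm) nn_integral_eq_integral[OF integrable_abs[OF i]]) auto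
qed

lemma mollifier_L1_tendsto:
  fixes f :: "'a::euclidean_space \<Rightarrow> real"
  assumes m: "\<And>k. mollifier (r k) (\<rho> k)" and r: "r \<longlonglongrightarrow> 0" and f: "integrable lborel f"
  shows "\<And>k. integrable lborel (conv (\<rho> k) f)" "(\<lambda>k. LINT x|lborel. \<bar>conv (\<rho> k) f x - f x\<bar>) \<longlonglongrightarrow> 0"
proof -
  have sd: "shift_dist f y \<le> 2 * (LINT x|lborel. \<bar>f x\<bar>)" for y
  proof -
    have "shift_dist f y \<le> (LINT x|lborel. \<bar>f (x - y)\<bar> + \<bar>f x\<bar>)" unfolding shift_dist_def
      by (intro integral_mono shift_dist_integrable Bochner_Integration.integrable_add integrable_abs integrable_shift f) auto
    also have "\<dots> = (LINT x|lborel. \<bar>f (x - y)\<bar>) + (LINT x|lborel. \<bar>f x\<bar>)"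
      by (intro Bochner_Integration.integral_add integrable_abs integrable_shift f)
    also have "(LINT x|lborel. \<bar>f (x - y)\<bar>) = (LINT x|lborel. \<bar>f x\<bar>)"
      by (rule integral_shift[of "\<lambda>x. \<bar>f x\<bar>"]) (use f in auto)
    finally show ?thesis by simp
  qed
  show "integrable lborel (conv (\<rho> k) f)" for k
    using Bochner_Integration.integrable_add[OF mollifier_L1_bound(1)[OF m f sd, of k] f] by simp
  show "(\<lambda>k. LINT x|lborel. \<bar>conv (\<rho> k) f x - f x\<bar>) \<longlonglongrightarrow> 0"
  proof (rule tendstoI)
    fix e :: real assume "e > 0"
    have "\<forall>\<^sub>F y in at 0. shift_dist f y < e/2"
      using shift_dist_tendsto_0[OF f] \<open>e > 0\<close> by (intro order_tendstoD) auto
    then obtain d where d: "d > 0" "\<And>y. y \<noteq> 0 \<Longrightarrow> dist y 0 < d \<Longrightarrow> shift_dist f y < e/2"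
      unfolding eventually_at by auto
    have b: "shift_dist f y \<le> e/2" if "y \<in> cball 0 s" "s < d" for y s
      using d(2)[of y] that \<open>e > 0\<close> by (cases "y = 0") (auto simp: shift_dist_def)
    have "\<forall>\<^sub>F k in sequentially. r k < d" using r d by (intro order_tendstoD)
    then show "\<forall>\<^sub>F k in sequentially. dist (LINT x|lborel. \<bar>conv (\<rho> k) f x - f x\<bar>) 0 < e"
    proof eventually_elim
      case (elim k)
      have "(LINT x|lborel. \<bar>conv (\<rho> k) f x - f x\<bar>) \<le> e/2"
        by (rule mollifier_L1_bound(2)[OF m f b]) (use elim in auto)
      then show ?case using \<open>e > 0\<close> by (simp add: dist_real_def)
    qed
  qed
qed

lemma mollifier_conv_nonneg:
  fixes f :: "'a::euclidean_space \<Rightarrow> real"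
  assumes "mollifier r \<rho>" "integrable lborel f" "\<And>x. f x \<ge> 0"
  shows "conv \<rho> f x \<ge> 0"
  unfolding conv_def using assms by (intro Bochner_Integration.integral_nonneg) (auto simp: mollifier_def)

section \<open>Testing with a negative power: the mollification argument\<close>

text \<open>Dominated convergence with dominating functions that vary with \<open>k\<close> and converge in \<open>L\<^sup>1\<close>: truncating \<open>F k\<close> at
  the level of the limiting bound \<open>g0\<close> changes it by at most \<open>\<bar>g k - g0\<bar>\<close>.\<close>

lemma dominated_convergence_L1:
  fixes F :: "nat \<Rightarrow> 'a \<Rightarrow> real"
  assumes [measurable]: "\<And>k. F k \<in> borel_measurable M" "F0 \<in> borel_measurable M"
    and g: "\<And>k. integrable M (g k)" "integrable M g0"
    and lim: "AE x in M. (\<lambda>k. F k x) \<longlonglongrightarrow> F0 x" "AE x in M. (\<lambda>k. g k x) \<longlonglongrightarrow> g0 x"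
    and bnd: "\<And>k x. \<bar>F k x\<bar> \<le> g k x"
    and L1: "(\<lambda>k. LINT x|M. \<bar>g k x - g0 x\<bar>) \<longlonglongrightarrow> 0"
  shows "\<And>k. integrable M (F k)" "integrable M F0" "(\<lambda>k. LINT x|M. F k x) \<longlonglongrightarrow> (LINT x|M. F0 x)"
proof -
  have [measurable]: "g k \<in> borel_measurable M" "g0 \<in> borel_measurable M" for k using g by auto
  show iF: "integrable M (F k)" for k
    by (rule Bochner_Integration.integrable_bound[OF g(1)[of k]])
       (use bnd in \<open>auto intro!: AE_I2 order_trans[OF bnd]\<close>)
  have le: "AE x in M. \<bar>F0 x\<bar> \<le> g0 x"
    using lim
  proof eventually_elim
    case (elim x)
    show ?case
      by (rule LIMSEQ_le[OF tendsto_rabs[OF elim(1)] elim(2)]) (use bnd in auto)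
  qed
  show iF0: "integrable M F0"
    by (rule Bochner_Integration.integrable_bound[OF g(2)]) (use le in auto)
  let ?c = "\<lambda>k x. max (- g0 x) (min (g0 x) (F k x))"
  have ic: "integrable M (?c k)" for k
    by (intro Bochner_Integration.integrable_max Bochner_Integration.integrable_min Bochner_Integration.integrable_minus g iF)
  have c: "(\<lambda>k. LINT x|M. ?c k x) \<longlonglongrightarrow> (LINT x|M. F0 x)"
  proof (rule integral_dominated_convergence[where w="\<lambda>x. \<bar>g0 x\<bar>"])
    show "AE x in M. (\<lambda>k. ?c k x) \<longlonglongrightarrow> F0 x"
      using lim(1) le
    proof eventually_elim
      case (elim x)
      have "(\<lambda>k. ?c k x) \<longlonglongrightarrow> max (- g0 x) (min (g0 x) (F0 x))"
        by (intro tendsto_max tendsto_min tendsto_const elim)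
      also have "max (- g0 x) (min (g0 x) (F0 x)) = F0 x" using elim(2) by (auto simp: max_def min_def)
      finally show ?case .
    qed
  qed (use g in auto)
  have "(\<lambda>k. (LINT x|M. F k x) - (LINT x|M. ?c k x)) \<longlonglongrightarrow> 0"
  proof (rule tendsto_rabs_zero_cancel, rule tendsto_sandwich[OF _ _ tendsto_const L1])
    have "\<bar>(LINT x|M. F k x) - (LINT x|M. ?c k x)\<bar> \<le> (LINT x|M. \<bar>g k x - g0 x\<bar>)" for k
    proof -
      have "\<bar>(LINT x|M. F k x) - (LINT x|M. ?c k x)\<bar> = \<bar>LINT x|M. F k x - ?c k x\<bar>"
        by (subst Bochner_Integration.integral_diff[OF iF ic]) simp
      also have "\<dots> \<le> (LINT x|M. \<bar>F k x - ?c k x\<bar>)"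
        using integral_norm_bound[of M "\<lambda>x. F k x - ?c k x"] by simp
      also have "\<dots> \<le> (LINT x|M. \<bar>g k x - g0 x\<bar>)"
      proof (rule integral_mono_AE)
        show "AE x in M. \<bar>F k x - ?c k x\<bar> \<le> \<bar>g k x - g0 x\<bar>"
          using le
        proof eventually_elim
          case (elim x)
          have "- g k x \<le> F k x" "F k x \<le> g k x" "0 \<le> g0 x" using bnd[of k x] elim by linarith+
          then show ?case by (cases "F k x \<ge> g0 x"; cases "F k x \<le> - g0 x") simp_all
        qed
      qed (use g iF ic in auto)
      finally show ?thesis .
    qed
    then show "\<forall>\<^sub>F k in sequentially. \<bar>(LINT x|M. F k x) - (LINT x|M. ?c k x)\<bar> \<le> (LINT x|M. \<bar>g k x - g0 x\<bar>)"
      by simp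
  qed simp
  from tendsto_add[OF this c] show "(\<lambda>k. LINT x|M. F k x) \<longlonglongrightarrow> (LINT x|M. F0 x)" by simp
qed

lemma Ck_on_reflect:
  fixes f :: "'a::euclidean_space \<Rightarrow> real"
  assumes "Ck_on k UNIV f" shows "Ck_on k UNIV (\<lambda>y. f (x - y))"
  using assms
proof (induction k arbitrary: f)
  case 0 then show ?case by (auto intro!: continuous_on_compose2[of UNIV f] continuous_intros)
next
  case (Suc k)
  show ?case
  proof (rule Ck_on_SucI)
    show "((\<lambda>y. f (x - y)) has_derivative (\<lambda>h. (-1) * frechet_derivative f (at (x - y)) h)) (at y)" for y
    proof -
      have D: "(f has_derivative frechet_derivative f (at (x - y))) (at (x - y))"
        by (rule Ck_on_has_derivative[OF Suc.prems])
      then have lin: "linear (frechet_derivative f (at (x - y)))"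
        using has_derivative_linear by blast
      have "((\<lambda>y. x - y) has_derivative (\<lambda>h. - h)) (at y)" by (auto intro!: derivative_eq_intros)
      from has_derivative_compose[OF this D]
      show ?thesis by (simp add: linear_neg[OF lin])
    qed
    show "Ck_on k UNIV (\<lambda>y. (-1) * frechet_derivative f (at (x - y)) e)" if "e \<in> Basis" for e
      using that Suc.prems by (intro Ck_on_mult Ck_on_const Suc.IH[of "\<lambda>z. frechet_derivative f (at z) e"]) auto
  qed
qed

lemma smooth_reflect: "smooth f \<Longrightarrow> smooth (\<lambda>y. f (x - y))"
  by (simp add: smooth_def Ck_on_reflect)

lemma dir_deriv_reflect:
  fixes f :: "'a::euclidean_space \<Rightarrow> real"
  assumes "smooth f"
  shows "frechet_derivative (\<lambda>y. f (x - y)) (at y) e = - frechet_derivative f (at (x - y)) e"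
proof -
  have D: "(f has_derivative frechet_derivative f (at (x - y))) (at (x - y))"
    by (rule smooth_has_derivative[OF assms])
  then have lin: "linear (frechet_derivative f (at (x - y)))"
    using has_derivative_linear by blast
  have "((\<lambda>y. x - y) has_derivative (\<lambda>h. - h)) (at y)" by (auto intro!: derivative_eq_intros)
  from fun_cong[OF frechet_derivative_at[OF has_derivative_compose[OF this D]], of e]
  have "frechet_derivative (\<lambda>y. f (x - y)) (at y) e = frechet_derivative f (at (x - y)) (- e)" by simp
  then show ?thesis by (simp add: linear_neg[OF lin])
qed

text \<open>\<open>g\<close> is the weak derivative of \<open>f\<close> in direction \<open>e\<close> when tested with smooth functions on the whole space
  that vanish outside \<open>K\<close>. Both functions are integrable on the whole space, so no domain appears in the integrals.\<close>

definition deriv_inside :: "'a::euclidean_space set \<Rightarrow> 'a \<Rightarrow> ('a \<Rightarrow> real) \<Rightarrow> ('a \<Rightarrow> real) \<Rightarrow> bool" where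
  "deriv_inside K e f g \<longleftrightarrow> integrable lborel f \<and> integrable lborel g \<and>
     (\<forall>\<phi>. smooth \<phi> \<longrightarrow> (\<forall>z. z \<notin> K \<longrightarrow> \<phi> z = 0) \<longrightarrow>
        (LINT z|lborel. f z * frechet_derivative \<phi> (at z) e) = - (LINT z|lborel. g z * \<phi> z))"

text \<open>Where the kernel does not see the complement of \<open>K\<close>, mollification commutes with the weak derivative.\<close>

lemma dir_deriv_conv_inside:
  fixes f g :: "'a::euclidean_space \<Rightarrow> real"
  assumes d: "deriv_inside K e f g" and e: "e \<in> Basis" and m: "mollifier r \<rho>" and x: "cball x r \<subseteq> K"
  shows "frechet_derivative (conv \<rho> f) (at x) e = conv \<rho> g x"
proof -
  have f: "integrable lborel f" using d by (simp add: deriv_inside_def)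
  have "\<rho> (x - z) = 0" if "z \<notin> K" for z
  proof (rule mollifier_outside[OF m])
    have "z \<notin> cball x r" using that x by blast
    then show "x - z \<notin> cball 0 r" by (simp add: dist_norm norm_minus_commute)
  qed
  then have "(LINT z|lborel. f z * frechet_derivative (\<lambda>y. \<rho> (x - y)) (at z) e) = - (LINT z|lborel. g z * \<rho> (x - z))"
    using d smooth_reflect[OF mollifier_smooth[OF m], of x] by (auto simp: deriv_inside_def)
  then have "(LINT z|lborel. frechet_derivative \<rho> (at (x - z)) e * f z) = (LINT z|lborel. \<rho> (x - z) * g z)"
    by (simp add: dir_deriv_reflect[OF mollifier_smooth[OF m]] mult.commute)
  then show ?thesis
    using conv_dir_deriv[OF f mollifier_smooth[OF m] compact_cball[of 0 r] mollifier_outside[OF m] e, of x]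
    by (simp add: conv_def)
qed

lemma mult_Young_simple:
  fixes a b :: real
  assumes "1 < p" "1 < p'" "1/p + 1/p' = 1" "a \<ge> 0" "b \<ge> 0"
  shows "a * b \<le> a powr p + b powr p'"
proof -
  have "a * b \<le> a powr p / p + b powr p' / p'" using assms by (intro Youngs_inequality)
  also have "\<dots> \<le> a powr p + b powr p'" using assms by (intro add_mono) (auto simp: divide_le_eq mult_le_cancel_left1)
  finally show ?thesis .
qed

text \<open>Young's inequality under the convolution integral; it replaces the convergence of mollifications in \<open>L\<^sup>p\<close>.\<close>

lemma mollifier_Young:
  fixes f H :: "'a::euclidean_space \<Rightarrow> real"
  assumes m: "mollifier r \<rho>" and f: "integrable lborel f" and H: "integrable lborel H"
    and fH: "\<And>y. \<bar>f y\<bar> powr p \<le> H y" and p: "1 < p" "1 < p'" "1/p + 1/p' = 1" and b: "b \<ge> 0"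
  shows "b * \<bar>conv \<rho> f x\<bar> \<le> b powr p' + conv \<rho> H x"
proof -
  note i = mollifier_conv_integrable[OF m]
  have irho: "integrable lborel \<rho>"
    by (rule compact_support_integrable[OF smooth_continuous[OF mollifier_smooth[OF m]] compact_cball mollifier_outside[OF m]])
  have rho: "\<And>z. \<rho> z \<ge> 0" "(LINT z|lborel. \<rho> z) = 1" using m by (auto simp: mollifier_def)
  have "b * \<bar>conv \<rho> f x\<bar> \<le> b * (LINT y|lborel. \<bar>\<rho> (x - y) * f y\<bar>)"
    unfolding conv_def using integral_norm_bound[of lborel "\<lambda>y. \<rho> (x - y) * f y"] b by (intro mult_left_mono) auto
  also have "\<dots> = (LINT y|lborel. b * \<bar>\<rho> (x - y) * f y\<bar>)" by simp
  also have "\<dots> \<le> (LINT y|lborel. b powr p' * \<rho> (x - y) + \<rho> (x - y) * H y)"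
  proof (rule integral_mono)
    fix y
    have "b * \<bar>f y\<bar> \<le> b powr p' + H y"
      using mult_Young_simple[OF p, of "\<bar>f y\<bar>" b] b fH[of y] by (simp add: mult.commute)
    from mult_left_mono[OF this rho(1)[of "x - y"]]
    show "b * \<bar>\<rho> (x - y) * f y\<bar> \<le> b powr p' * \<rho> (x - y) + \<rho> (x - y) * H y"
      using rho(1)[of "x - y"] by (simp add: abs_mult algebra_simps)
  qed (use i[OF f] i[OF H] integrable_reflect[OF irho] in auto)
  also have "\<dots> = b powr p' * (LINT y|lborel. \<rho> (x - y)) + conv \<rho> H x"
    unfolding conv_def using i[OF H] integrable_reflect[OF irho] by simp
  also have "(LINT y|lborel. \<rho> (x - y)) = 1"
    using integral_reflect[of \<rho> x] m rho by (simp add: mollifier_measurable)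
  finally show ?thesis by simp
qed

lemma powr_dir_deriv:
  fixes f \<zeta> :: "'a::euclidean_space \<Rightarrow> real"
  assumes f: "smooth f" "\<And>z. f z > 0" and z: "smooth \<zeta>"
  shows "frechet_derivative (\<lambda>z. f z powr a * \<zeta> z) (at z) e
    = f z powr a * frechet_derivative \<zeta> (at z) e + a * f z powr (a - 1) * frechet_derivative f (at z) e * \<zeta> z"
proof -
  have "((\<lambda>x. x powr a) has_field_derivative a * f z powr (a - 1)) (at (f z))"
    using f by (auto intro!: has_real_derivative_powr)
  from DERIV_compose_FDERIV[OF this smooth_has_derivative[OF f(1)]]
  have "((\<lambda>z. f z powr a) has_derivative (\<lambda>h. frechet_derivative f (at z) h * (a * f z powr (a - 1)))) (at z)" .
  from fun_cong[OF frechet_derivative_at[OF has_derivative_mult[OF this smooth_has_derivative[OF z, of z]]], of e]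
  have "frechet_derivative (\<lambda>z. f z powr a * \<zeta> z) (at z) e = f z powr a * frechet_derivative \<zeta> (at z) e
      + frechet_derivative f (at z) e * (a * f z powr (a - 1)) * \<zeta> z" by simp
  then show ?thesis by (simp add: mult_ac)
qed

lemma powr_le_one_plus: "x > 0 \<Longrightarrow> 0 \<le> a \<Longrightarrow> a \<le> 1 \<Longrightarrow> x powr a \<le> 1 + (x::real)"
  by (cases "x \<le> 1") (use powr_le1[of a x] powr_mono[of a 1 x] in auto)

text \<open>The inequality \<open>g0 - div B \<ge> h\<close>, with \<open>g0\<close> the weak derivative of \<open>w\<close> in direction \<open>e0\<close>, may be tested with
  \<open>(w + \<epsilon>) powr (-s) \<zeta>\<close>. The term with \<open>g0\<close> is integrated by parts, which turns it into the last term of \<open>J\<close>.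
  Here all functions are Borel measurable and integrable on the whole space.\<close>

lemma negative_power_inequality_borel:
  fixes w g0 h \<zeta> :: "'a::euclidean_space \<Rightarrow> real" and G B :: "'i \<Rightarrow> 'a \<Rightarrow> real" and d :: "'i \<Rightarrow> 'a"
  assumes K: "compact K" "\<delta> > 0" "\<And>x. x \<in> K \<Longrightarrow> cball x \<delta> \<subseteq> K'"
    and I: "finite I" "\<And>i. i \<in> I \<Longrightarrow> d i \<in> Basis" "e0 \<in> Basis"
    and w: "deriv_inside K' e0 w g0" "\<And>i. i \<in> I \<Longrightarrow> deriv_inside K' (d i) w (G i)" "\<And>z. w z \<ge> 0"
    and h: "integrable lborel h"
    and B: "\<And>i. i \<in> I \<Longrightarrow> integrable lborel (B i)" "\<And>i. i \<in> I \<Longrightarrow> integrable lborel (\<lambda>z. \<bar>B i z\<bar> powr p')"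
    and G: "\<And>i. i \<in> I \<Longrightarrow> integrable lborel (\<lambda>z. \<bar>G i z\<bar> powr p)"
    and p: "1 < p" "1 < p'" "1/p + 1/p' = 1"
    and ineq: "\<And>\<phi>. smooth \<phi> \<Longrightarrow> (\<And>z. z \<notin> K \<Longrightarrow> \<phi> z = 0) \<Longrightarrow> (\<And>z. \<phi> z \<ge> 0) \<Longrightarrow>
       0 \<le> (LINT z|lborel. g0 z * \<phi> z + (\<Sum>i\<in>I. B i z * frechet_derivative \<phi> (at z) (d i)) - h z * \<phi> z)"
    and \<zeta>: "smooth \<zeta>" "\<And>z. \<zeta> z \<ge> 0" "\<And>z. z \<notin> K \<Longrightarrow> \<zeta> z = 0"
    and s: "0 < s" "s < 1" "0 < \<epsilon>"
  defines "J \<equiv> \<lambda>w G z. (\<Sum>i\<in>I. B i z * ((w z + \<epsilon>) powr (-s) * frechet_derivative \<zeta> (at z) (d i)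
                        + (-s) * (w z + \<epsilon>) powr (-s - 1) * G i z * \<zeta> z))
      - h z * ((w z + \<epsilon>) powr (-s) * \<zeta> z) - 1/(1-s) * ((w z + \<epsilon>) powr (1-s) * frechet_derivative \<zeta> (at z) e0)"
  shows "integrable lborel (J w G)" "0 \<le> (LINT z|lborel. J w G z)"
proof -
  define r where "r k = \<delta> / real (Suc k)" for k
  have r: "r k > 0" "r k \<le> \<delta>" for k using K(2) by (auto simp: r_def divide_simps mult_le_cancel_left1)
  have r0: "r \<longlonglongrightarrow> 0" unfolding r_def using tendsto_mult_right_zero[OF LIMSEQ_inverse_real_of_nat, of \<delta>]
    by (simp add: divide_inverse)
  have "\<exists>\<rho>. mollifier (r k) (\<rho>::'a \<Rightarrow> real)" for k using mollifier_exists[OF r(1)] by blast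
  then obtain \<rho> :: "nat \<Rightarrow> 'a \<Rightarrow> real" where m: "\<And>k. mollifier (r k) (\<rho> k)" by metis
  have iw: "integrable lborel w" and ig0: "integrable lborel g0" using w(1) by (auto simp: deriv_inside_def)
  have iG: "integrable lborel (G i)" if "i \<in> I" for i using w(2)[OF that] by (auto simp: deriv_inside_def)
  define H where "H z = (\<Sum>i\<in>I. \<bar>G i z\<bar> powr p)" for z
  have iH: "integrable lborel H" unfolding H_def by (intro Bochner_Integration.integrable_sum G)
  have HG: "\<bar>G i z\<bar> powr p \<le> H z" if "i \<in> I" for i z
    unfolding H_def by (rule member_le_sum[OF that]) (auto simp: I)
  define W where "W k = conv (\<rho> k) w" for k
  define GG where "GG k i = conv (\<rho> k) (G i)" for k i
  define G0 where "G0 k = conv (\<rho> k) g0" for k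
  define HH where "HH k = conv (\<rho> k) H" for k
  note L1 = mollifier_L1_tendsto[OF m r0]
  note iW = L1(1)[OF iw, folded W_def] and cW = L1(2)[OF iw, folded W_def]
  note iHH = L1(1)[OF iH, folded HH_def] and cHH = L1(2)[OF iH, folded HH_def]
  note iGG = L1(1)[OF iG, folded GG_def] and cGG = L1(2)[OF iG, folded GG_def]
  note iG0 = L1(1)[OF ig0, folded G0_def] and cG0 = L1(2)[OF ig0, folded G0_def]
  have Wsm: "smooth (W k)" for k unfolding W_def
    by (rule smooth_conv[OF iw mollifier_smooth[OF m] compact_cball mollifier_outside[OF m]])
  have Wnn: "W k z \<ge> 0" for k z unfolding W_def by (rule mollifier_conv_nonneg[OF m iw w(3)])
  have HHnn: "HH k z \<ge> 0" for k z unfolding HH_def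
    by (rule mollifier_conv_nonneg[OF m iH]) (auto simp: H_def intro: sum_nonneg)
  have cb: "cball x (r k) \<subseteq> K'" if "x \<in> K" for x k
    using K(3)[OF that] r(2)[of k] by (auto simp: subset_eq)
  have WD: "frechet_derivative (W k) (at x) (d i) = GG k i x" if "x \<in> K" "i \<in> I" for x k i
    unfolding W_def GG_def by (rule dir_deriv_conv_inside[OF w(2)[OF that(2)] I(2)[OF that(2)] m cb[OF that(1)]])
  have WD0: "frechet_derivative (W k) (at x) e0 = G0 k x" if "x \<in> K" for x k
    unfolding W_def G0_def by (rule dir_deriv_conv_inside[OF w(1) I(3) m cb[OF that(1)]])
  \<comment> \<open>All the mollified functions converge almost everywhere along one common subsequence,
    obtained from the sum of their \<open>L\<^sup>1\<close> errors.\<close>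
  define S where "S k x = \<bar>W k x - w x\<bar> + \<bar>HH k x - H x\<bar> + (\<Sum>i\<in>I. \<bar>GG k i x - G i x\<bar>)" for k x
  have iS: "integrable lborel (S k)" for k unfolding S_def
    by (intro Bochner_Integration.integrable_add Bochner_Integration.integrable_sum integrable_abs
        Bochner_Integration.integrable_diff iW iw iHH iH iGG iG)
  have intS: "(LINT x|lborel. norm (S k x)) = (LINT x|lborel. \<bar>W k x - w x\<bar>) + (LINT x|lborel. \<bar>HH k x - H x\<bar>)
      + (\<Sum>i\<in>I. LINT x|lborel. \<bar>GG k i x - G i x\<bar>)" for k
  proof -
    have "norm (S k x) = S k x" for x unfolding S_def by (simp add: sum_nonneg)
    then show ?thesis unfolding S_def
      using iW[of k] iw iHH[of k] iH iGG[of _ k] iG by simp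
  qed
  have "(\<lambda>k. LINT x|lborel. norm (S k x)) \<longlonglongrightarrow> 0 + 0 + (\<Sum>i\<in>I. 0)"
    unfolding intS by (intro tendsto_add tendsto_sum cW cHH cGG)
  then have "(\<lambda>k. LINT x|lborel. norm (S k x)) \<longlonglongrightarrow> 0" by simp
  from tendsto_L1_AE_subseq[OF iS this] obtain \<sigma> :: "nat \<Rightarrow> nat" where
    \<sigma>: "strict_mono \<sigma>" "AE x in lborel. (\<lambda>n. S (\<sigma> n) x) \<longlonglongrightarrow> 0" by blast
  have AEc: "AE x in lborel. (\<lambda>n. W (\<sigma> n) x) \<longlonglongrightarrow> w x \<and> (\<lambda>n. HH (\<sigma> n) x) \<longlonglongrightarrow> H x
      \<and> (\<forall>i\<in>I. (\<lambda>n. GG (\<sigma> n) i x) \<longlonglongrightarrow> G i x)"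
    using \<sigma>(2)
  proof eventually_elim
    case (elim x)
    have sq: "f \<longlonglongrightarrow> l" if "\<And>n. \<bar>f n - l\<bar> \<le> S (\<sigma> n) x" for f and l :: real
    proof -
      have "(\<lambda>n. \<bar>f n - l\<bar>) \<longlonglongrightarrow> 0"
        by (rule tendsto_sandwich[OF _ _ tendsto_const elim]) (use that in auto)
      then show ?thesis by (simp add: tendsto_rabs_zero_iff LIM_zero_iff)
    qed
    have 1: "\<bar>GG k i x - G i x\<bar> \<le> S k x" if "i \<in> I" for i k
    proof -
      have "\<bar>GG k i x - G i x\<bar> \<le> (\<Sum>i\<in>I. \<bar>GG k i x - G i x\<bar>)"
        by (rule member_le_sum[OF that]) (auto simp: I)
      then show ?thesis by (simp add: S_def)
    qed
    have nn: "0 \<le> (\<Sum>i\<in>I. \<bar>GG k i x - G i x\<bar>)" for k by (simp add: sum_nonneg)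
    show ?case
    proof (intro conjI ballI)
      show "(\<lambda>n. W (\<sigma> n) x) \<longlonglongrightarrow> w x" by (rule sq) (use nn in \<open>simp add: S_def\<close>)
      show "(\<lambda>n. HH (\<sigma> n) x) \<longlonglongrightarrow> H x" by (rule sq) (use nn in \<open>simp add: S_def\<close>)
      show "(\<lambda>n. GG (\<sigma> n) i x) \<longlonglongrightarrow> G i x" if "i \<in> I" for i by (rule sq) (rule 1[OF that])
    qed
  qed
  obtain L where L: "L \<ge> 0" "\<And>x h. \<bar>frechet_derivative \<zeta> (at x) h\<bar> \<le> L * norm h"
    using smooth_Lipschitz[OF \<zeta>(1) K(1) \<zeta>(3)] by metis
  have Lb: "\<bar>frechet_derivative \<zeta> (at x) e\<bar> \<le> L" if "e \<in> Basis" for x e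
    using L(2)[of x e] that by simp
  obtain Cz where Cz: "Cz \<ge> 0" "\<And>z. \<bar>\<zeta> z\<bar> \<le> Cz"
    using compact_support_bounded[OF smooth_continuous[OF \<zeta>(1)] K(1) \<zeta>(3)] by blast
  have out: "frechet_derivative \<zeta> (at z) e = 0" if "z \<notin> K" for z e
    by (rule dir_deriv_outside[OF compact_imp_closed[OF K(1)] \<zeta>(3) that])
  have pw: "(x + \<epsilon>) powr a \<le> \<epsilon> powr a" if "a \<le> 0" "x \<ge> 0" for a x
    using that s(3) by (intro powr_mono2') auto
  have [measurable]: "\<zeta> \<in> borel_measurable borel" by (intro borel_measurable_continuous_onI smooth_continuous \<zeta>)
  have mD: "(\<lambda>z. frechet_derivative \<zeta> (at z) e) \<in> borel_measurable borel" if "e \<in> Basis" for e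
    by (intro borel_measurable_continuous_onI smooth_continuous smooth_dir_deriv \<zeta> that)
  have Jm: "J w1 G1 \<in> borel_measurable borel" if [measurable]: "w1 \<in> borel_measurable borel"
    "\<And>i. i \<in> I \<Longrightarrow> G1 i \<in> borel_measurable borel" for w1 G1
  proof -
    have [measurable]: "h \<in> borel_measurable borel" using h by auto
    have [measurable]: "\<And>i. i \<in> I \<Longrightarrow> B i \<in> borel_measurable borel" using B by auto
    note [measurable] = mD I
    show ?thesis unfolding J_def by measurable
  qed
  define M where "M = \<epsilon> powr (-s) * L + \<epsilon> powr (-s-1) * Cz + \<epsilon> powr (-s) * Cz + L / (1-s)"
  define bd where "bd W1 H1 z = M * (indicator K z * (1 + \<epsilon>) + W1 z + (\<Sum>i\<in>I. \<bar>B i z\<bar> + \<bar>B i z\<bar> powr p' + H1 z) + \<bar>h z\<bar>)" for W1 H1 z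
  have iK: "integrable lborel (indicator K :: 'a \<Rightarrow> real)"
    using K(1) emeasure_compact_finite by (intro integrable_real_indicator) (auto intro: borel_compact)
  have ibd: "integrable lborel (bd W1 H1)" if "integrable lborel W1" "integrable lborel H1" for W1 H1
    unfolding bd_def using that B h iK by auto
  have M: "\<epsilon> powr (-s) * L \<le> M" "\<epsilon> powr (-s-1) * Cz \<le> M" "\<epsilon> powr (-s) * Cz \<le> M" "L / (1-s) \<le> M"
    using L(1) Cz(1) s by (simp_all add: M_def)
  have M0: "M \<ge> 0" using M(1) L(1) by (meson mult_nonneg_nonneg order_trans powr_ge_zero)
  have bnd: "\<bar>J (W k) (GG k) z\<bar> \<le> bd (W k) (HH k) z" for k z
  proof (cases "z \<in> K")
    case False
    then have "J (W k) (GG k) z = 0" using \<zeta>(3) out unfolding J_def by simp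
    moreover have "bd (W k) (HH k) z \<ge> 0" unfolding bd_def using M0 Wnn HHnn
      by (intro mult_nonneg_nonneg add_nonneg_nonneg sum_nonneg) (use s in auto)
    ultimately show ?thesis by simp
  next
    case True
    have t1: "\<bar>B i z * ((W k z + \<epsilon>) powr (-s) * frechet_derivative \<zeta> (at z) (d i)
                        + (-s) * (W k z + \<epsilon>) powr (-s - 1) * GG k i z * \<zeta> z)\<bar>
        \<le> M * (\<bar>B i z\<bar> + \<bar>B i z\<bar> powr p' + HH k z)" if i: "i \<in> I" for i
    proof -
      have a: "(W k z + \<epsilon>) powr (-s) * \<bar>frechet_derivative \<zeta> (at z) (d i)\<bar> \<le> M"
        using pw[of "-s" "W k z"] Wnn s Lb[OF I(2)[OF i], of z] L(1)
        by (intro order_trans[OF mult_mono M(1)]) auto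
      have b: "s * (W k z + \<epsilon>) powr (-s - 1) * \<bar>\<zeta> z\<bar> \<le> M"
      proof -
        have "s * (W k z + \<epsilon>) powr (-s - 1) \<le> 1 * \<epsilon> powr (-s-1)"
          using pw[of "-s-1" "W k z"] Wnn s by (intro mult_mono) auto
        then show ?thesis
          using Cz by (intro order_trans[OF mult_mono M(2)]) auto
      qed
      have c: "\<bar>B i z\<bar> * \<bar>GG k i z\<bar> \<le> \<bar>B i z\<bar> powr p' + HH k z"
        unfolding GG_def HH_def by (rule mollifier_Young[OF m iG[OF i] iH HG[OF i] p]) simp
      have "\<bar>B i z * ((W k z + \<epsilon>) powr (-s) * frechet_derivative \<zeta> (at z) (d i)
                        + (-s) * (W k z + \<epsilon>) powr (-s - 1) * GG k i z * \<zeta> z)\<bar>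
         \<le> \<bar>B i z\<bar> * ((W k z + \<epsilon>) powr (-s) * \<bar>frechet_derivative \<zeta> (at z) (d i)\<bar>)
            + (s * (W k z + \<epsilon>) powr (-s - 1) * \<bar>\<zeta> z\<bar>) * (\<bar>B i z\<bar> * \<bar>GG k i z\<bar>)"
        unfolding distrib_left by (rule order_trans[OF abs_triangle_ineq]) (use s in \<open>simp add: abs_mult mult_ac\<close>)
      also have "\<dots> \<le> \<bar>B i z\<bar> * M + M * (\<bar>B i z\<bar> powr p' + HH k z)"
        using a b c M0 by (intro add_mono mult_left_mono mult_mono) auto
      finally show ?thesis by (simp add: algebra_simps)
    qed
    have t2: "\<bar>h z * ((W k z + \<epsilon>) powr (-s) * \<zeta> z)\<bar> \<le> M * \<bar>h z\<bar>"
    proof -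
      have "(W k z + \<epsilon>) powr (-s) * \<bar>\<zeta> z\<bar> \<le> M"
        using pw[of "-s" "W k z"] Wnn s Cz by (intro order_trans[OF mult_mono M(3)]) auto
      from mult_right_mono[OF this abs_ge_zero[of "h z"]] show ?thesis by (simp add: abs_mult mult_ac)
    qed
    have t3: "\<bar>1/(1-s) * ((W k z + \<epsilon>) powr (1-s) * frechet_derivative \<zeta> (at z) e0)\<bar> \<le> M * (1 + \<epsilon> + W k z)"
    proof -
      have "(W k z + \<epsilon>) powr (1-s) \<le> 1 + (W k z + \<epsilon>)"
        using Wnn[of k z] s by (intro powr_le_one_plus) auto
      then have "(W k z + \<epsilon>) powr (1-s) * \<bar>frechet_derivative \<zeta> (at z) e0\<bar> \<le> (1 + \<epsilon> + W k z) * L"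
        using Lb[OF I(3), of z] Wnn[of k z] s by (intro mult_mono) auto
      then have "1/(1-s) * ((W k z + \<epsilon>) powr (1-s) * \<bar>frechet_derivative \<zeta> (at z) e0\<bar>) \<le> 1/(1-s) * ((1 + \<epsilon> + W k z) * L)"
        using s by (intro mult_left_mono) auto
      also have "\<dots> = (L/(1-s)) * (1 + \<epsilon> + W k z)" by simp
      also have "\<dots> \<le> M * (1 + \<epsilon> + W k z)" using M(4) Wnn[of k z] s by (intro mult_right_mono) auto
      finally show ?thesis using s by (simp add: abs_mult)
    qed
    have "\<bar>J (W k) (GG k) z\<bar> \<le> \<bar>\<Sum>i\<in>I. B i z * ((W k z + \<epsilon>) powr (-s) * frechet_derivative \<zeta> (at z) (d i)
                        + (-s) * (W k z + \<epsilon>) powr (-s - 1) * GG k i z * \<zeta> z)\<bar>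
        + \<bar>h z * ((W k z + \<epsilon>) powr (-s) * \<zeta> z)\<bar> + \<bar>1/(1-s) * ((W k z + \<epsilon>) powr (1-s) * frechet_derivative \<zeta> (at z) e0)\<bar>"
      unfolding J_def by linarith
    also have "\<dots> \<le> (\<Sum>i\<in>I. M * (\<bar>B i z\<bar> + \<bar>B i z\<bar> powr p' + HH k z)) + M * \<bar>h z\<bar> + M * (1 + \<epsilon> + W k z)"
      by (intro add_mono order_trans[OF sum_abs sum_mono] t1 t2 t3)
    also have "\<dots> = bd (W k) (HH k) z"
      unfolding bd_def sum_distrib_left[symmetric] using True by (simp add: distrib_left)
    finally show ?thesis .
  qed
  have bdL1: "(\<lambda>k. LINT x|lborel. \<bar>bd (W k) (HH k) x - bd w H x\<bar>) \<longlonglongrightarrow> 0"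
  proof (rule tendsto_sandwich[OF _ _ tendsto_const])
    show "(\<lambda>k. M * ((LINT x|lborel. \<bar>W k x - w x\<bar>) + card I * (LINT x|lborel. \<bar>HH k x - H x\<bar>))) \<longlonglongrightarrow> 0"
      using tendsto_mult_left[OF tendsto_add[OF cW tendsto_mult_left[OF cHH, of "card I"]], of M] by simp
    have "(LINT x|lborel. \<bar>bd (W k) (HH k) x - bd w H x\<bar>)
       \<le> M * ((LINT x|lborel. \<bar>W k x - w x\<bar>) + card I * (LINT x|lborel. \<bar>HH k x - H x\<bar>))" for k
    proof -
      have i: "integrable lborel (\<lambda>x. \<bar>W k x - w x\<bar>)" "integrable lborel (\<lambda>x. \<bar>HH k x - H x\<bar>)"
        using iW iw iHH iH by auto
      have "(LINT x|lborel. \<bar>bd (W k) (HH k) x - bd w H x\<bar>)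
         \<le> (LINT x|lborel. M * (\<bar>W k x - w x\<bar> + card I * \<bar>HH k x - H x\<bar>))"
      proof (rule integral_mono)
        fix x
        have "bd (W k) (HH k) x - bd w H x = M * ((W k x - w x) + card I * (HH k x - H x))"
          unfolding bd_def by (simp add: sum.distrib algebra_simps)
        also have "\<bar>\<dots>\<bar> \<le> M * (\<bar>W k x - w x\<bar> + card I * \<bar>HH k x - H x\<bar>)"
          unfolding abs_mult using M0
          by (intro mult_mono order_trans[OF abs_triangle_ineq]) (auto simp: abs_mult)
        finally show "\<bar>bd (W k) (HH k) x - bd w H x\<bar> \<le> M * (\<bar>W k x - w x\<bar> + card I * \<bar>HH k x - H x\<bar>)" .
      qed (use i ibd[OF iW iHH] ibd[OF iw iH] in auto)
      also have "\<dots> = M * ((LINT x|lborel. \<bar>W k x - w x\<bar>) + card I * (LINT x|lborel. \<bar>HH k x - H x\<bar>))"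
        using i by simp
      finally show ?thesis .
    qed
    then show "\<forall>\<^sub>F k in sequentially. (LINT x|lborel. \<bar>bd (W k) (HH k) x - bd w H x\<bar>)
       \<le> M * ((LINT x|lborel. \<bar>W k x - w x\<bar>) + card I * (LINT x|lborel. \<bar>HH k x - H x\<bar>))" by simp
  qed auto
  have JAE: "AE x in lborel. (\<lambda>n. J (W (\<sigma> n)) (GG (\<sigma> n)) x) \<longlonglongrightarrow> J w G x"
    using AEc
  proof eventually_elim
    case (elim x)
    have pc: "(\<lambda>n. (W (\<sigma> n) x + \<epsilon>) powr a) \<longlonglongrightarrow> (w x + \<epsilon>) powr a" for a
      using elim w(3)[of x] s(3) by (intro tendsto_powr tendsto_add tendsto_const) auto
    show ?case unfolding J_def
      using elim by (intro tendsto_diff tendsto_sum tendsto_mult tendsto_add tendsto_const pc) auto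
  qed
  have bdAE: "AE x in lborel. (\<lambda>n. bd (W (\<sigma> n)) (HH (\<sigma> n)) x) \<longlonglongrightarrow> bd w H x"
    using AEc
  proof eventually_elim
    case (elim x)
    then show ?case unfolding bd_def by (intro tendsto_sum tendsto_mult tendsto_add tendsto_const) auto
  qed
  have Jmk: "J (W k) (GG k) \<in> borel_measurable lborel" for k
    using Jm[of "W k" "GG k"] iW[of k] iGG[of _ k] by auto
  have Jm0: "J w G \<in> borel_measurable lborel"
    using Jm[of w G] iw iG by auto
  note DCT = dominated_convergence_L1[of "\<lambda>n. J (W (\<sigma> n)) (GG (\<sigma> n))" lborel "J w G"
      "\<lambda>n. bd (W (\<sigma> n)) (HH (\<sigma> n))" "bd w H", OF Jmk Jm0 ibd[OF iW iHH] ibd[OF iw iH] JAE bdAE bnd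
      LIMSEQ_subseq_LIMSEQ[OF bdL1 \<sigma>(1), unfolded o_def]]
  show "integrable lborel (J w G)" by (rule DCT(2))
  have iJk: "integrable lborel (J (W k) (GG k))" for k
    by (rule Bochner_Integration.integrable_bound[OF ibd[OF iW[of k] iHH[of k]] Jmk])
       (use order_trans[OF bnd abs_ge_self] in auto)
  \<comment> \<open>Replacing \<open>g0\<close> by its mollification, which is the derivative of \<open>W k\<close> on \<open>K\<close>, costs \<open>err k\<close>; the
    remaining term is the derivative of \<open>\<Phi>\<close>, up to a part that belongs to \<open>J\<close>.\<close>
  define err where "err k = \<epsilon> powr (-s) * Cz * (LINT x|lborel. \<bar>G0 k x - g0 x\<bar>)" for k
  have err0: "err \<longlonglongrightarrow> 0" unfolding err_def by (rule tendsto_mult_right_zero[OF cG0])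
  have low: "- err k \<le> (LINT z|lborel. J (W k) (GG k) z)" for k
  proof -
    define \<phi> where "\<phi> z = (W k z + \<epsilon>) powr (-s) * \<zeta> z" for z
    define \<Phi> where "\<Phi> z = (1/(1-s)) * ((W k z + \<epsilon>) powr (1-s) * \<zeta> z)" for z
    have We: "smooth (\<lambda>z. W k z + \<epsilon>)" "W k z + \<epsilon> > 0" for z
      using Wsm Wnn[of k z] s by (auto intro: smooth_add smooth_const)
    have WeD: "frechet_derivative (\<lambda>z. W k z + \<epsilon>) (at z) e = frechet_derivative (W k) (at z) e" for z e
      using fun_cong[OF frechet_derivative_at[OF has_derivative_add[OF smooth_has_derivative[OF Wsm, of k z] has_derivative_const[of \<epsilon>]]], of e] by simp
    have \<phi>sm: "smooth \<phi>" unfolding \<phi>_def by (intro smooth_mult smooth_powr We \<zeta>)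
    have \<Phi>sm0: "smooth (\<lambda>z. (W k z + \<epsilon>) powr (1-s) * \<zeta> z)" by (intro smooth_mult smooth_powr We \<zeta>)
    have \<Phi>sm: "smooth \<Phi>" unfolding \<Phi>_def by (intro smooth_mult[OF smooth_const] \<Phi>sm0)
    have \<phi>nn: "\<phi> z \<ge> 0" for z using \<zeta>(2) by (simp add: \<phi>_def)
    have \<phi>0: "\<phi> z = 0" if "z \<notin> K" for z using \<zeta>(3)[OF that] by (simp add: \<phi>_def)
    have \<Phi>0: "\<Phi> z = 0" if "z \<notin> K" for z using \<zeta>(3)[OF that] by (simp add: \<Phi>_def)
    have \<phi>b: "\<bar>\<phi> z\<bar> \<le> \<epsilon> powr (-s) * Cz" for z
      unfolding \<phi>_def abs_mult using pw[of "-s" "W k z"] Wnn s Cz by (intro mult_mono) auto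
    have \<phi>D: "frechet_derivative \<phi> (at z) e = (W k z + \<epsilon>) powr (-s) * frechet_derivative \<zeta> (at z) e
       + (-s) * (W k z + \<epsilon>) powr (-s-1) * frechet_derivative (W k) (at z) e * \<zeta> z" for z e
      unfolding \<phi>_def powr_dir_deriv[OF We \<zeta>(1)] WeD ..
    have \<Phi>D: "frechet_derivative \<Phi> (at z) e = 1/(1-s) * ((W k z + \<epsilon>) powr (1-s) * frechet_derivative \<zeta> (at z) e)
       + \<phi> z * frechet_derivative (W k) (at z) e" for z e
    proof -
      have "frechet_derivative \<Phi> (at z) e = (1/(1-s)) * frechet_derivative (\<lambda>z. (W k z + \<epsilon>) powr (1-s) * \<zeta> z) (at z) e"
        unfolding \<Phi>_def
        using fun_cong[OF frechet_derivative_at[OF has_derivative_mult_right[OF smooth_has_derivative[OF \<Phi>sm0, of z], of "1/(1-s)"]], of e]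
        by simp
      also have "\<dots> = 1/(1-s) * ((W k z + \<epsilon>) powr (1-s) * frechet_derivative \<zeta> (at z) e)
       + \<phi> z * frechet_derivative (W k) (at z) e"
        unfolding powr_dir_deriv[OF We \<zeta>(1)] WeD \<phi>_def using s by (simp add: field_simps)
      finally show ?thesis .
    qed
    have [measurable]: "\<phi> \<in> borel_measurable borel"
      by (intro borel_measurable_continuous_onI smooth_continuous \<phi>sm)
    have i0: "integrable lborel (\<lambda>z. \<phi> z * (g0 z - G0 k z))"
      by (rule integrable_bounded_mult[where C="\<epsilon> powr (-s) * Cz"]) (use ig0 iG0 \<phi>b in auto)
    have i\<Phi>: "integrable lborel (\<lambda>z. frechet_derivative \<Phi> (at z) e0)"
      by (rule compact_support_integrable[OF smooth_continuous[OF smooth_dir_deriv[OF \<Phi>sm I(3)]] K(1)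
            dir_deriv_outside[OF compact_imp_closed[OF K(1)] \<Phi>0]])
    have eq: "g0 z * \<phi> z + (\<Sum>i\<in>I. B i z * frechet_derivative \<phi> (at z) (d i)) - h z * \<phi> z
      = J (W k) (GG k) z + \<phi> z * (g0 z - G0 k z) + frechet_derivative \<Phi> (at z) e0" for z
    proof (cases "z \<in> K")
      case True
      have S: "(\<Sum>i\<in>I. B i z * frechet_derivative \<phi> (at z) (d i)) = (\<Sum>i\<in>I. B i z * ((W k z + \<epsilon>) powr (-s) * frechet_derivative \<zeta> (at z) (d i)
                        + (-s) * (W k z + \<epsilon>) powr (-s - 1) * GG k i z * \<zeta> z))"
        by (intro sum.cong refl) (simp only: \<phi>D WD[OF True])
      show ?thesis unfolding S \<Phi>D WD0[OF True] J_def \<phi>_def[symmetric] by (simp add: algebra_simps)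
    next
      case False
      have "frechet_derivative \<phi> (at z) e = 0" "frechet_derivative \<Phi> (at z) e = 0" for e
        by (rule dir_deriv_outside[OF compact_imp_closed[OF K(1)] _ False]; simp add: \<phi>0 \<Phi>0)+
      then show ?thesis using False \<phi>0 \<zeta>(3) out by (simp add: J_def)
    qed
    have "0 \<le> (LINT z|lborel. g0 z * \<phi> z + (\<Sum>i\<in>I. B i z * frechet_derivative \<phi> (at z) (d i)) - h z * \<phi> z)"
      by (rule ineq[OF \<phi>sm \<phi>0 \<phi>nn])
    also have "\<dots> = (LINT z|lborel. J (W k) (GG k) z) + (LINT z|lborel. \<phi> z * (g0 z - G0 k z))
        + (LINT z|lborel. frechet_derivative \<Phi> (at z) e0)"
      unfolding eq using iJk i0 i\<Phi> by simp
    also have "(LINT z|lborel. frechet_derivative \<Phi> (at z) e0) = 0"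
      by (rule integral_dir_deriv_zero[OF \<Phi>sm K(1) \<Phi>0 I(3)])
    also have "(LINT z|lborel. \<phi> z * (g0 z - G0 k z)) \<le> (LINT z|lborel. (\<epsilon> powr (-s) * Cz) * \<bar>G0 k z - g0 z\<bar>)"
    proof (rule integral_mono[OF i0])
      fix z
      have "\<phi> z * (g0 z - G0 k z) \<le> \<bar>\<phi> z\<bar> * \<bar>G0 k z - g0 z\<bar>"
        by (metis abs_ge_self abs_minus_commute abs_mult)
      also have "\<dots> \<le> (\<epsilon> powr (-s) * Cz) * \<bar>G0 k z - g0 z\<bar>" by (intro mult_right_mono \<phi>b) auto
      finally show "\<phi> z * (g0 z - G0 k z) \<le> (\<epsilon> powr (-s) * Cz) * \<bar>G0 k z - g0 z\<bar>" .
    qed (use iG0 ig0 in auto)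
    finally show ?thesis by (simp add: err_def)
  qed
  have "(\<lambda>n. - err (\<sigma> n)) \<longlonglongrightarrow> - 0"
    using LIMSEQ_subseq_LIMSEQ[OF err0 \<sigma>(1)] by (intro tendsto_minus) (simp add: o_def)
  from LIMSEQ_le[OF this DCT(3)] low show "0 \<le> (LINT z|lborel. J w G z)" by auto
qed

section \<open>Testing with a negative power: locally integrable functions\<close>

lemma lebesgue_on_transfer:
  fixes F F' :: "'a::euclidean_space \<Rightarrow> real"
  assumes "\<Omega> \<in> sets lebesgue" "F' \<in> borel_measurable borel" "\<And>z. z \<notin> \<Omega> \<Longrightarrow> F' z = 0"
    and "AE z in lborel. z \<in> \<Omega> \<longrightarrow> F z = F' z"
  shows "integrable (lebesgue_on \<Omega>) F \<longleftrightarrow> integrable lborel F'"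
    and "(LINT z|lebesgue_on \<Omega>. F z) = (LINT z|lborel. F' z)"
proof -
  have F'm: "F' \<in> borel_measurable lebesgue" "F' \<in> borel_measurable lborel"
    using assms(2) by (auto intro: measurable_completion)
  have ae: "AE z in lebesgue. F' z = indicator \<Omega> z *\<^sub>R F z"
    using assms(3,4) by (auto simp: AE_completion_iff indicator_def elim!: eventually_mono)
  have m: "(\<lambda>z. indicator \<Omega> z *\<^sub>R F z) \<in> borel_measurable lebesgue"
    by (rule borel_measurable_AE[OF F'm(1) ae])
  have \<Omega>: "\<Omega> \<inter> space lebesgue \<in> sets lebesgue" using assms(1) by simp
  have "integrable (lebesgue_on \<Omega>) F \<longleftrightarrow> integrable lebesgue F'"
    unfolding integrable_restrict_space[OF \<Omega>] using ae by (intro integrable_cong_AE m F'm) auto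
  then show "integrable (lebesgue_on \<Omega>) F \<longleftrightarrow> integrable lborel F'"
    using integrable_completion[OF F'm(2)] by simp
  have "(LINT z|lebesgue_on \<Omega>. F z) = (LINT z|lebesgue. F' z)"
    unfolding integral_restrict_space[OF \<Omega>] using ae by (intro integral_cong_AE m F'm) auto
  then show "(LINT z|lebesgue_on \<Omega>. F z) = (LINT z|lborel. F' z)"
    using integral_completion[OF F'm(2)] by simp
qed

text \<open>\<open>f'\<close> is a Borel measurable function that agrees almost everywhere with \<open>f\<close> on \<open>K\<close> and vanishes outside \<open>K\<close>.\<close>

definition borel_rep :: "'a::euclidean_space set \<Rightarrow> ('a \<Rightarrow> real) \<Rightarrow> ('a \<Rightarrow> real) \<Rightarrow> bool" where
  "borel_rep K f f' \<longleftrightarrow> f' \<in> borel_measurable borel \<and> (\<forall>z. z \<notin> K \<longrightarrow> f' z = 0) \<and>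
     (AE z in lborel. z \<in> K \<longrightarrow> f z = f' z)"

lemma borel_rep_exists:
  assumes "integrable (lebesgue_on K) f" "compact K"
  shows "\<exists>f'. borel_rep K f f' \<and> integrable lborel f'"
proof -
  have K: "K \<in> sets borel" "K \<inter> space lebesgue \<in> sets lebesgue" using assms(2) by (auto simp: borel_compact)
  have "integrable lebesgue (\<lambda>z. indicator K z *\<^sub>R f z)"
    using assms(1) unfolding integrable_restrict_space[OF K(2)] .
  then have "(\<lambda>z. indicator K z *\<^sub>R f z) \<in> borel_measurable lebesgue" by auto
  then obtain g where g: "g \<in> borel_measurable lborel" "AE z in lborel. indicator K z *\<^sub>R f z = g z"
    using completion_ex_borel_measurable_real by blast
  have [measurable]: "g \<in> borel_measurable borel" using g(1) by simp
  have "borel_rep K f (\<lambda>z. indicator K z * g z)"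
    unfolding borel_rep_def using g(2) K(1) by (auto simp: indicator_def elim!: eventually_mono)
  moreover have "integrable lborel (\<lambda>z. indicator K z * g z)"
    using assms(1) lebesgue_on_transfer(1)[of K "\<lambda>z. indicator K z * g z" f] calculation K
    by (auto simp: borel_rep_def)
  ultimately show ?thesis by blast
qed

lemma L1_loc_borel_rep:
  assumes "L1_loc \<Omega> f" "compact K" "K \<subseteq> \<Omega>"
  shows "\<exists>f'. borel_rep K f f' \<and> integrable lborel f'"
  by (intro borel_rep_exists) (use assms in \<open>auto simp: L1_loc_def\<close>)

lemma weak_deriv_deriv_inside:
  fixes f g f' g' :: "'a::euclidean_space \<Rightarrow> real"
  assumes "weak_deriv \<Omega> e f g" and e: "e \<in> Basis" and \<Omega>: "open \<Omega>" and K: "compact K" "K \<subseteq> \<Omega>"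
    and f: "borel_rep K f f'" "integrable lborel f'" and g: "borel_rep K g g'" "integrable lborel g'"
  shows "deriv_inside K e f' g'"
  unfolding deriv_inside_def
proof (intro conjI allI impI f g)
  fix \<phi> :: "'a \<Rightarrow> real" assume \<phi>: "smooth \<phi>" "\<forall>z. z \<notin> K \<longrightarrow> \<phi> z = 0"
  have out: "frechet_derivative \<phi> (at z) e = 0" if "z \<notin> K" for z
    by (rule dir_deriv_outside[OF compact_imp_closed[OF K(1)] _ that]) (use \<phi> in auto)
  have \<Omega>m: "\<Omega> \<in> sets lebesgue" using \<Omega> by auto
  have [measurable]: "\<phi> \<in> borel_measurable borel" "(\<lambda>z. frechet_derivative \<phi> (at z) e) \<in> borel_measurable borel"
    using \<phi> e by (auto intro!: borel_measurable_continuous_onI smooth_continuous smooth_dir_deriv)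
  have [measurable]: "f' \<in> borel_measurable borel" "g' \<in> borel_measurable borel" using f g by (auto simp: borel_rep_def)
  have 1: "(LINT z|lebesgue_on \<Omega>. f z * frechet_derivative \<phi> (at z) e) = (LINT z|lborel. f' z * frechet_derivative \<phi> (at z) e)"
  proof (rule lebesgue_on_transfer(2)[OF \<Omega>m])
    have "AE z in lborel. z \<in> K \<longrightarrow> f z = f' z" using f by (simp add: borel_rep_def)
    then show "AE z in lborel. z \<in> \<Omega> \<longrightarrow> f z * frechet_derivative \<phi> (at z) e = f' z * frechet_derivative \<phi> (at z) e"
      by (rule eventually_mono) (use out in auto)
  qed (use out K in auto)
  have 2: "(LINT z|lebesgue_on \<Omega>. g z * \<phi> z) = (LINT z|lborel. g' z * \<phi> z)"
  proof (rule lebesgue_on_transfer(2)[OF \<Omega>m])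
    have "AE z in lborel. z \<in> K \<longrightarrow> g z = g' z" using g by (simp add: borel_rep_def)
    then show "AE z in lborel. z \<in> \<Omega> \<longrightarrow> g z * \<phi> z = g' z * \<phi> z"
      by (rule eventually_mono) (use \<phi> in auto)
  qed (use \<phi> K in auto)
  have "test_fn \<Omega> \<phi>" by (rule test_fnI[OF \<phi>(1) K]) (use \<phi> in auto)
  then show "(LINT z|lborel. f' z * frechet_derivative \<phi> (at z) e) = - (LINT z|lborel. g' z * \<phi> z)"
    using assms(1) unfolding weak_deriv_def 1[symmetric] 2[symmetric] by blast
qed

lemma borel_rep_comp_integrable:
  fixes F :: "real \<Rightarrow> real"
  assumes "borel_rep K f f'" "compact K" "integrable (lebesgue_on K) (\<lambda>z. F (f z))"
    "F \<in> borel_measurable borel" "F 0 = 0"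
  shows "integrable lborel (\<lambda>z. F (f' z))"
proof -
  have [measurable]: "f' \<in> borel_measurable borel" "F \<in> borel_measurable borel" using assms by (auto simp: borel_rep_def)
  have "K \<in> sets lebesgue" using assms(2) by (auto simp: borel_compact)
  then show ?thesis
    using assms(1,3,5) by (subst lebesgue_on_transfer(1)[of K _ "\<lambda>z. F (f z)", symmetric])
      (auto simp: borel_rep_def elim!: eventually_mono)
qed

text \<open>The integrand obtained by testing \<open>w\<^sub>t - div B \<ge> h\<close> with \<open>(w + \<epsilon>) powr (-s) \<zeta>\<close> after integration by parts in
  the direction \<open>e0\<close>. The vector fields \<open>B\<close> and \<open>G = \<nabla>w\<close> are given by their components in the directions \<open>d i\<close>.\<close>

definition test_density ::
  "'i set \<Rightarrow> ('i \<Rightarrow> 'a::euclidean_space) \<Rightarrow> 'a \<Rightarrow> real \<Rightarrow> real \<Rightarrow> ('a \<Rightarrow> real) \<Rightarrow> ('i \<Rightarrow> 'a \<Rightarrow> real) \<Rightarrow> ('a \<Rightarrow> real) \<Rightarrow>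
   ('a \<Rightarrow> real) \<Rightarrow> ('i \<Rightarrow> 'a \<Rightarrow> real) \<Rightarrow> 'a \<Rightarrow> real" where
  "test_density I d e0 s \<epsilon> \<zeta> B h w G z = (\<Sum>i\<in>I. B i z * ((w z + \<epsilon>) powr (-s) * frechet_derivative \<zeta> (at z) (d i)
                        + (-s) * (w z + \<epsilon>) powr (-s - 1) * G i z * \<zeta> z))
      - h z * ((w z + \<epsilon>) powr (-s) * \<zeta> z) - 1/(1-s) * ((w z + \<epsilon>) powr (1-s) * frechet_derivative \<zeta> (at z) e0)"

text \<open>The version of \<open>negative_power_inequality_borel\<close> on an open set for locally integrable functions: on a compact
  neighbourhood of the support of \<open>\<zeta>\<close> all of them are replaced by Borel representatives.\<close>

lemma weak_ineq_negative_power: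
  fixes w g0 h \<zeta> :: "'a::euclidean_space \<Rightarrow> real" and G B :: "'i \<Rightarrow> 'a \<Rightarrow> real" and d :: "'i \<Rightarrow> 'a"
  assumes \<Omega>: "open \<Omega>" and K: "compact K" "K \<subseteq> \<Omega>"
    and I: "finite I" "\<And>i. i \<in> I \<Longrightarrow> d i \<in> Basis" "e0 \<in> Basis"
    and w: "weak_deriv \<Omega> e0 w g0" "\<And>i. i \<in> I \<Longrightarrow> weak_deriv \<Omega> (d i) w (G i)" "AE z in lebesgue_on \<Omega>. w z \<ge> 0"
    and h: "L1_loc \<Omega> h"
    and B: "\<And>i. i \<in> I \<Longrightarrow> L1_loc \<Omega> (B i)" "\<And>i. i \<in> I \<Longrightarrow> L1_loc \<Omega> (\<lambda>z. \<bar>B i z\<bar> powr p')"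
    and G: "\<And>i. i \<in> I \<Longrightarrow> L1_loc \<Omega> (\<lambda>z. \<bar>G i z\<bar> powr p)"
    and p: "1 < p" "1 < p'" "1/p + 1/p' = 1"
    and ineq: "\<And>\<phi>. test_fn \<Omega> \<phi> \<Longrightarrow> (\<And>z. z \<in> \<Omega> \<Longrightarrow> \<phi> z \<ge> 0) \<Longrightarrow>
       0 \<le> (LINT z|lebesgue_on \<Omega>. g0 z * \<phi> z + (\<Sum>i\<in>I. B i z * frechet_derivative \<phi> (at z) (d i)) - h z * \<phi> z)"
    and \<zeta>: "smooth \<zeta>" "\<And>z. \<zeta> z \<ge> 0" "\<And>z. z \<notin> K \<Longrightarrow> \<zeta> z = 0"
    and s: "0 < s" "s < 1" "0 < \<epsilon>"
  shows "integrable (lebesgue_on K) (test_density I d e0 s \<epsilon> \<zeta> B h w G)"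
    "0 \<le> (LINT z|lebesgue_on K. test_density I d e0 s \<epsilon> \<zeta> B h w G z)"
proof -
  obtain \<delta> where \<delta>: "\<delta> > 0" "(\<Union>x\<in>K. cball x \<delta>) \<subseteq> \<Omega>"
    using compact_subset_open_imp_cball_epsilon_subset[OF K(1) \<Omega> K(2)] by blast
  define K' where "K' = {x + y |x y. x \<in> K \<and> y \<in> cball 0 \<delta>}"
  have K': "compact K'" unfolding K'_def by (intro compact_sums K compact_cball)
  have cb: "cball x \<delta> \<subseteq> K'" if "x \<in> K" for x
  proof
    fix z assume "z \<in> cball x \<delta>"
    then show "z \<in> K'" unfolding K'_def
      by (intro CollectI exI[of _ x] exI[of _ "z - x"]) (use that in \<open>auto simp: dist_norm norm_minus_commute\<close>)
  qed
  have K'\<Omega>: "K' \<subseteq> \<Omega>"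
  proof
    fix z assume "z \<in> K'"
    then obtain x y where "z = x + y" "x \<in> K" "y \<in> cball 0 \<delta>" by (auto simp: K'_def)
    then have "z \<in> (\<Union>x\<in>K. cball x \<delta>)" by (auto intro!: bexI[of _ x] simp: dist_norm)
    then show "z \<in> \<Omega>" using \<delta> by blast
  qed
  have KK': "K \<subseteq> K'" using cb \<delta>(1) by fastforce
  note rep = L1_loc_borel_rep[OF _ K' K'\<Omega>]
  have Lw: "L1_loc \<Omega> w" "L1_loc \<Omega> g0" using w(1) by (auto simp: weak_deriv_def)
  have LG: "L1_loc \<Omega> (G i)" if "i \<in> I" for i using w(2)[OF that] by (auto simp: weak_deriv_def)
  obtain w1 where w1: "borel_rep K' w w1" "integrable lborel w1" using rep[OF Lw(1)] by blast
  define w' where "w' z = max 0 (w1 z)" for z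
  have "AE z in lborel. z \<in> \<Omega> \<longrightarrow> w z \<ge> 0"
    using w(3) \<Omega> by (simp add: AE_restrict_space_iff AE_completion_iff)
  moreover have "AE z in lborel. z \<in> K' \<longrightarrow> w z = w1 z" using w1 by (simp add: borel_rep_def)
  ultimately have "AE z in lborel. z \<in> K' \<longrightarrow> w z = w' z"
    by eventually_elim (use K'\<Omega> in \<open>auto simp: w'_def\<close>)
  then have w': "borel_rep K' w w'" "integrable lborel w'"
    using w1 by (auto simp: borel_rep_def w'_def[abs_def])
  obtain g' where g': "borel_rep K' g0 g'" "integrable lborel g'" using rep[OF Lw(2)] by blast
  obtain h' where h': "borel_rep K' h h'" "integrable lborel h'" using rep[OF h] by blast
  have "\<forall>i\<in>I. \<exists>f'. borel_rep K' (G i) f' \<and> integrable lborel f'" using rep LG by blast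
  then obtain G' where G': "\<And>i. i \<in> I \<Longrightarrow> borel_rep K' (G i) (G' i)" "\<And>i. i \<in> I \<Longrightarrow> integrable lborel (G' i)" by metis
  have "\<forall>i\<in>I. \<exists>f'. borel_rep K' (B i) f' \<and> integrable lborel f'" using rep B(1) by blast
  then obtain B' where B': "\<And>i. i \<in> I \<Longrightarrow> borel_rep K' (B i) (B' i)" "\<And>i. i \<in> I \<Longrightarrow> integrable lborel (B' i)" by metis
  have B'p: "integrable lborel (\<lambda>z. \<bar>B' i z\<bar> powr p')" if "i \<in> I" for i
    using borel_rep_comp_integrable[OF B'(1)[OF that] K', of "\<lambda>x. \<bar>x\<bar> powr p'"] B(2)[OF that] K' K'\<Omega>
    by (auto simp: L1_loc_def)
  have G'p: "integrable lborel (\<lambda>z. \<bar>G' i z\<bar> powr p)" if "i \<in> I" for i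
    using borel_rep_comp_integrable[OF G'(1)[OF that] K', of "\<lambda>x. \<bar>x\<bar> powr p"] G[OF that] K' K'\<Omega>
    by (auto simp: L1_loc_def)
  have ae: "AE z in lborel. z \<in> K' \<longrightarrow> w z = w' z \<and> g0 z = g' z \<and> h z = h' z \<and> (\<forall>i\<in>I. G i z = G' i z \<and> B i z = B' i z)"
  proof -
    have "AE z in lborel. \<forall>i\<in>I. (z \<in> K' \<longrightarrow> G i z = G' i z) \<and> (z \<in> K' \<longrightarrow> B i z = B' i z)"
      using G'(1) B'(1) I(1) by (auto simp: borel_rep_def AE_finite_all)
    moreover have "AE z in lborel. z \<in> K' \<longrightarrow> w z = w' z" "AE z in lborel. z \<in> K' \<longrightarrow> g0 z = g' z"
      "AE z in lborel. z \<in> K' \<longrightarrow> h z = h' z"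
      using w' g' h' by (auto simp: borel_rep_def)
    ultimately show ?thesis by eventually_elim auto
  qed
  have [measurable]: "w' \<in> borel_measurable borel" "g' \<in> borel_measurable borel" "h' \<in> borel_measurable borel"
    using w' g' h' by (auto simp: borel_rep_def)
  have mGB: "G' i \<in> borel_measurable borel" "B' i \<in> borel_measurable borel" if "i \<in> I" for i
    using G' B' that by (auto simp: borel_rep_def)
  have ineq': "0 \<le> (LINT z|lborel. g' z * \<phi> z + (\<Sum>i\<in>I. B' i z * frechet_derivative \<phi> (at z) (d i)) - h' z * \<phi> z)"
    if \<phi>: "smooth \<phi>" "\<And>z. z \<notin> K \<Longrightarrow> \<phi> z = 0" "\<And>z. \<phi> z \<ge> 0" for \<phi>
  proof -
    have [measurable]: "\<phi> \<in> borel_measurable borel" 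
      using \<phi> by (auto intro!: borel_measurable_continuous_onI smooth_continuous)
    have mD: "(\<lambda>z. frechet_derivative \<phi> (at z) (d i)) \<in> borel_measurable borel" if "i \<in> I" for i
      using \<phi> I that by (auto intro!: borel_measurable_continuous_onI smooth_continuous smooth_dir_deriv)
    have out: "frechet_derivative \<phi> (at z) e = 0" if "z \<notin> K" for z e
      by (rule dir_deriv_outside[OF compact_imp_closed[OF K(1)] \<phi>(2) that])
    have "0 \<le> (LINT z|lebesgue_on \<Omega>. g0 z * \<phi> z + (\<Sum>i\<in>I. B i z * frechet_derivative \<phi> (at z) (d i)) - h z * \<phi> z)"
      by (rule ineq[OF test_fnI[OF \<phi>(1) K \<phi>(2)] \<phi>(3)])
    also have "\<dots> = (LINT z|lborel. g' z * \<phi> z + (\<Sum>i\<in>I. B' i z * frechet_derivative \<phi> (at z) (d i)) - h' z * \<phi> z)"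
    proof (rule lebesgue_on_transfer(2))
      show "AE z in lborel. z \<in> \<Omega> \<longrightarrow> g0 z * \<phi> z + (\<Sum>i\<in>I. B i z * frechet_derivative \<phi> (at z) (d i)) - h z * \<phi> z
        = g' z * \<phi> z + (\<Sum>i\<in>I. B' i z * frechet_derivative \<phi> (at z) (d i)) - h' z * \<phi> z"
        using ae
      proof eventually_elim
        case (elim z)
        show ?case
        proof (cases "z \<in> K")
          case True then show ?thesis using elim KK' by auto
        next
          case False then show ?thesis using out \<phi> by simp
        qed
      qed
      show "(\<lambda>z. g' z * \<phi> z + (\<Sum>i\<in>I. B' i z * frechet_derivative \<phi> (at z) (d i)) - h' z * \<phi> z) \<in> borel_measurable borel"
        by (intro borel_measurable_diff borel_measurable_add borel_measurable_sum borel_measurable_times mGB mD) auto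
      show "g' z * \<phi> z + (\<Sum>i\<in>I. B' i z * frechet_derivative \<phi> (at z) (d i)) - h' z * \<phi> z = 0" if "z \<notin> \<Omega>" for z
      proof -
        have "z \<notin> K" using that K by auto
        then show ?thesis by (simp add: out \<phi>(2))
      qed
    qed (use \<Omega> in auto)
    finally show ?thesis .
  qed
  have out: "frechet_derivative \<zeta> (at z) e = 0" if "z \<notin> K" for z e
    by (rule dir_deriv_outside[OF compact_imp_closed[OF K(1)] \<zeta>(3) that])
  let ?J' = "test_density I d e0 s \<epsilon> \<zeta> B' h' w' G'"
  have w'0: "w' z \<ge> 0" for z by (simp add: w'_def)
  have D0: "deriv_inside K' e0 w' g'"
    by (rule weak_deriv_deriv_inside[OF w(1) I(3) \<Omega> K' K'\<Omega> w' g'])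
  have D1: "deriv_inside K' (d i) w' (G' i)" if "i \<in> I" for i
    by (rule weak_deriv_deriv_inside[OF w(2)[OF that] I(2)[OF that] \<Omega> K' K'\<Omega> w' G'(1)[OF that] G'(2)[OF that]])
  have J': "integrable lborel ?J'" "0 \<le> (LINT z|lborel. ?J' z)"
    unfolding test_density_def[abs_def]
    by (rule negative_power_inequality_borel[where K=K and K'=K' and \<delta>=\<delta> and ?g0.0=g' and p=p and p'=p'],
        (fact K(1) \<delta>(1) cb I D0 D1 w'0 h'(2) B'(2) B'p G'p p ineq' \<zeta> s)+)+
  have J0: "?J' z = 0" if "z \<notin> K" for z
    using out \<zeta>(3) that by (simp add: test_density_def)
  have Jae: "AE z in lborel. z \<in> K \<longrightarrow> test_density I d e0 s \<epsilon> \<zeta> B h w G z = ?J' z"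
    using ae
  proof eventually_elim
    case (elim z)
    then show ?case using KK' by (auto simp: test_density_def)
  qed
  have Jm: "?J' \<in> borel_measurable borel"
    using borel_measurable_integrable[OF J'(1)] by simp
  have Km: "K \<in> sets lebesgue" using K by (auto simp: borel_compact)
  show "integrable (lebesgue_on K) (test_density I d e0 s \<epsilon> \<zeta> B h w G)"
    by (rule iffD2[OF lebesgue_on_transfer(1)[OF Km Jm J0 Jae] J'(1)])
  show "0 \<le> (LINT z|lebesgue_on K. test_density I d e0 s \<epsilon> \<zeta> B h w G z)"
    by (rule ord_le_eq_trans[OF J'(2) lebesgue_on_transfer(2)[OF Km Jm J0 Jae, symmetric]])
qed

section \<open>Pointwise inequalities\<close>

text \<open>With \<open>c = \<bar>a\<bar> powr (r-2)\<close> and \<open>d = \<bar>b\<bar> powr (r-2)\<close> the right-hand side equals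
  \<open>(c + d)/2 \<bar>a - b\<bar>\<^sup>2 + (c - d) (\<bar>a\<bar>\<^sup>2 - \<bar>b\<bar>\<^sup>2)/2\<close>, where the second summand is nonnegative.\<close>

lemma power_monotone:
  fixes a b :: "'a::real_inner"
  assumes "r \<ge> 2"
  shows "2 powr (1 - r) * norm (a - b) powr r
    \<le> (norm a powr (r - 2) *\<^sub>R a - norm b powr (r - 2) *\<^sub>R b) \<bullet> (a - b)"
proof (cases "a = b")
  case False
  define c where "c = norm a powr (r - 2)"
  define d where "d = norm b powr (r - 2)"
  define N where "N = norm (a - b)"
  have N: "N > 0" using False by (simp add: N_def)
  have id: "(c *\<^sub>R a - d *\<^sub>R b) \<bullet> (a - b) = (c + d) / 2 * N\<^sup>2 + (c - d) * ((norm a)\<^sup>2 - (norm b)\<^sup>2) / 2"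
    unfolding N_def power2_norm_eq_inner by (simp add: algebra_simps inner_commute add_divide_distrib diff_divide_distrib)
  have "(c - d) * ((norm a)\<^sup>2 - (norm b)\<^sup>2) \<ge> 0"
  proof (cases "norm a \<le> norm b")
    case True
    then have "c \<le> d" "(norm a)\<^sup>2 \<le> (norm b)\<^sup>2" using assms unfolding c_def d_def
      by (auto intro!: powr_mono2 power_mono)
    then show ?thesis by (intro mult_nonpos_nonpos) auto
  next
    case False
    then have "d \<le> c" "(norm b)\<^sup>2 \<le> (norm a)\<^sup>2" using assms unfolding c_def d_def
      by (auto intro!: powr_mono2 power_mono)
    then show ?thesis by (intro mult_nonneg_nonneg) auto
  qed
  moreover have "(N/2) powr (r - 2) \<le> c + d"
  proof -
    have "N \<le> norm a + norm b" unfolding N_def by (rule norm_triangle_ineq4)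
    then have "N/2 \<le> norm a \<or> N/2 \<le> norm b" by linarith
    then have "(N/2) powr (r-2) \<le> c \<or> (N/2) powr (r-2) \<le> d"
      unfolding c_def d_def using N assms by (auto intro!: powr_mono2)
    moreover have "c \<ge> 0" "d \<ge> 0" by (auto simp: c_def d_def)
    ultimately show ?thesis by linarith
  qed
  then have "(N/2) powr (r - 2) / 2 * N\<^sup>2 \<le> (c + d) / 2 * N\<^sup>2" by (intro mult_right_mono) auto
  moreover have "(N/2) powr (r - 2) / 2 * N\<^sup>2 = 2 powr (1 - r) * N powr r"
    using N by (simp add: powr_divide powr_diff powr_numeral field_simps)
  ultimately show ?thesis using id unfolding c_def d_def N_def by linarith
qed simp

text \<open>\<open>power_monotone\<close> with the exponent \<open>p/(p-1) \<ge> 2\<close>, applied to the fluxes: \<open>A\<close> is inverted by the map of the same form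
  with the conjugate exponent.\<close>

lemma flux_monotone:
  fixes x y :: "'a::real_inner"
  assumes p: "1 < p" "p \<le> 2"
  defines "A \<equiv> \<lambda>x::'a. norm x powr (p - 2) *\<^sub>R x"
  shows "2 powr (1 - p/(p-1)) * norm (A x - A y) powr (p/(p-1)) \<le> (A x - A y) \<bullet> (x - y)"
proof -
  have inv: "norm (A x) powr (p/(p-1) - 2) *\<^sub>R A x = x" for x
  proof (cases "x = 0")
    case False
    have "norm (A x) = norm x powr (p - 1)"
      using False by (simp add: A_def powr_mult_base[symmetric] powr_diff powr_numeral power2_eq_square field_simps)
    then have "norm (A x) powr (p/(p-1) - 2) *\<^sub>R A x = (norm x powr ((p-1) * (p/(p-1) - 2)) * norm x powr (p - 2)) *\<^sub>R x"
      by (simp add: A_def powr_powr)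
    also have "(p-1) * (p/(p-1) - 2) = 2 - p" using p by (simp add: field_simps)
    finally show ?thesis using False by (simp add: powr_add[symmetric])
  qed (simp add: A_def)
  have "p/(p-1) \<ge> 2" using p by (simp add: field_simps)
  from power_monotone[OF this, of "A x" "A y"] show ?thesis unfolding inv by (simp add: inner_commute)
qed

text \<open>The variable \<open>v\<close> stands for the negative of the smaller function.\<close>

lemma source_monotone:
  fixes u v :: real
  assumes "q > 1" "u + v \<ge> 0"
  shows "2 powr (- q) * (u + v) powr q \<le> \<bar>u\<bar> powr (q-1) * u + \<bar>v\<bar> powr (q-1) * v"
proof (cases "u + v = 0")
  case True
  then have "v = - u" by simp
  then show ?thesis by simp
next
  case False
  have "2 powr (- q) * (u + v) powr (q+1) \<le> (\<bar>u\<bar> powr (q-1) * u + \<bar>v\<bar> powr (q-1) * v) * (u + v)"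
    using power_monotone[of "q+1" u "-v"] assms by (simp add: algebra_simps)
  also have "(u + v) powr (q+1) = (u+v) powr q * (u+v)"
    using False assms by (simp add: powr_add)
  finally show ?thesis using False assms by (simp add: mult.assoc[symmetric])
qed

text \<open>Powers with an exponent in \<open>(0, 1)\<close> are bounded by an affine function of which either the constant term or, in the
  next lemma, the slope is as small as desired.\<close>

lemma powr_absorb_large:
  fixes \<theta> :: real
  assumes "0 < \<theta>" "\<theta> < 1" "\<nu> > 0"
  shows "\<exists>M\<ge>0. \<forall>A\<ge>0. A powr \<theta> \<le> \<nu> + M * A"
proof (intro exI[of _ "(\<nu> powr (1/\<theta>)) powr (\<theta> - 1)"] conjI allI impI)
  fix A :: real assume A: "A \<ge> 0"
  let ?c = "\<nu> powr (1/\<theta>)"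
  show "A powr \<theta> \<le> \<nu> + ?c powr (\<theta> - 1) * A"
  proof (cases "A \<le> ?c")
    case True
    then have "A powr \<theta> \<le> ?c powr \<theta>" using assms A by (intro powr_mono2) auto
    also have "\<dots> = \<nu>" using assms by (simp add: powr_powr)
    finally show ?thesis using A by (simp add: add_increasing2)
  next
    case False
    have "?c > 0" using assms by simp
    then have "A > 0" using False by linarith
    have "A powr \<theta> = A powr (\<theta> - 1) * A" using \<open>A > 0\<close> by (simp add: powr_diff)
    also have "\<dots> \<le> ?c powr (\<theta> - 1) * A"
      using False assms \<open>?c > 0\<close> A by (intro mult_right_mono powr_mono2') auto
    finally show ?thesis using assms by simp
  qed
qed simp

lemma powr_absorb_small:
  fixes \<theta> :: real
  assumes "0 < \<theta>" "\<theta> < 1" "\<tau> > 0"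
  shows "\<exists>N\<ge>0. \<forall>A\<ge>0. A powr \<theta> \<le> N + \<tau> * A"
proof (intro exI[of _ "(\<tau> powr (1/(\<theta>-1))) powr \<theta>"] conjI allI impI)
  fix A :: real assume A: "A \<ge> 0"
  let ?c = "\<tau> powr (1/(\<theta>-1))"
  show "A powr \<theta> \<le> ?c powr \<theta> + \<tau> * A"
  proof (cases "A \<le> ?c")
    case True
    then have "A powr \<theta> \<le> ?c powr \<theta>" using assms A by (intro powr_mono2) auto
    then show ?thesis using A assms by (simp add: add_increasing2)
  next
    case False
    have "?c > 0" using assms by simp
    then have "A > 0" using False by linarith
    have "A powr \<theta> = A powr (\<theta> - 1) * A" using \<open>A > 0\<close> by (simp add: powr_diff)
    also have "\<dots> \<le> ?c powr (\<theta> - 1) * A"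
      using False assms \<open>?c > 0\<close> A by (intro mult_right_mono powr_mono2') auto
    also have "?c powr (\<theta> - 1) = \<tau>" using assms by (simp add: powr_powr)
    finally show ?thesis by (simp add: add_increasing)
  qed
qed simp

lemma Young_with_weight:
  fixes p p' \<mu> :: real
  assumes "1 < p" "1 < p'" "1/p + 1/p' = 1" "\<mu> > 0"
  shows "\<exists>C\<ge>0. \<forall>X\<ge>0. \<forall>Y\<ge>0. X * Y \<le> \<mu> * X powr p' + C * Y powr p"
proof (intro exI[of _ "(\<mu> powr (-1/p')) powr p"] conjI allI impI)
  fix X Y :: real assume XY: "X \<ge> 0" "Y \<ge> 0"
  have "X * Y = (\<mu> powr (-1/p') * Y) * (\<mu> powr (1/p') * X)"
    using assms by (simp add: powr_minus divide_simps)
  also have "\<dots> \<le> (\<mu> powr (-1/p') * Y) powr p + (\<mu> powr (1/p') * X) powr p'"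
    using XY by (intro mult_Young_simple assms) auto
  also have "(\<mu> powr (1/p') * X) powr p' = \<mu> * X powr p'" using assms XY by (simp add: powr_mult powr_powr)
  finally show "X * Y \<le> \<mu> * X powr p' + (\<mu> powr (-1/p')) powr p * Y powr p"
    using XY by (simp add: powr_mult)
qed simp

lemma powr_sum_le: "(x + y) powr e \<le> 2 powr e * (x powr e + y powr e)" if "x \<ge> 0" "y \<ge> 0" "e \<ge> 0" for x y e :: real
proof -
  have "(x + y) powr e \<le> (2 * max x y) powr e" using that by (intro powr_mono2) (auto simp: max_def)
  also have "\<dots> = 2 powr e * max x y powr e" using that by (simp add: powr_mult)
  also have "max x y powr e \<le> x powr e + y powr e" by (auto simp: max_def)
  finally show ?thesis by simp
qed

text \<open>The integrand of the first estimate in dimensionless variables: \<open>W\<close> is the rescaled difference, \<open>b\<close> the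
  rescaled norm of \<open>B\<close>, \<open>z\<close> the value of the cutoff function, \<open>a1\<close> its rescaled time derivative (for which only a
  lower bound is available) and \<open>a2\<close> the rescaled size of its gradient. The condition on \<open>\<gamma>\<close> makes every
  power of \<open>z\<close> that comes out of Young's inequality large enough to be absorbed by \<open>W powr (q-s) z\<close>. The
  constant does not depend on \<open>\<epsilon>\<close>, because \<open>p - 1 - s > 0\<close>.\<close>

lemma pointwise_first:
  fixes p q s c1 c2 Cd \<gamma> :: real
  assumes p: "1 < p" "p \<le> 2" and q: "1 < q" and s: "0 < s" "s < p - 1"
    and c: "c1 > 0" "c2 > 0" "Cd \<ge> 0" and \<gamma>: "0 < \<gamma>" "2 * \<gamma> \<le> 1 - (1-s)/(q-s)"
  shows "\<exists>C\<ge>0. \<forall>W \<epsilon> z b a1 a2. 0 \<le> W \<longrightarrow> 0 < \<epsilon> \<longrightarrow> \<epsilon> \<le> 1 \<longrightarrow> 0 \<le> z \<longrightarrow> z \<le> 1 \<longrightarrow> 0 \<le> b \<longrightarrow>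
     - Cd * z powr (1 - \<gamma>) \<le> a1 \<longrightarrow> 0 \<le> a2 \<longrightarrow> a2 \<le> Cd * z powr (1 - \<gamma>) \<longrightarrow>
     - 1/(1-s) * ((W + \<epsilon>) powr (1-s) * a1) + b * a2 * (W + \<epsilon>) powr (-s)
       - s * c1 * b powr (p/(p-1)) * (W + \<epsilon>) powr (-s-1) * z - c2 * W powr q * (W + \<epsilon>) powr (-s) * z
     \<le> C - s * c1 / 2 * (b powr (p/(p-1)) * (W + \<epsilon>) powr (-s-1) * z)"
proof -
  define p' where "p' = p / (p-1)"
  define \<theta> where "\<theta> = (1-s)/(q-s)"
  have p': "1 < p'" "1/p + 1/p' = 1" using p by (auto simp: p'_def field_simps)
  have s1: "s < 1" using s p by simp
  have \<theta>: "0 < \<theta>" "\<theta> < 1" using s1 q by (auto simp: \<theta>_def)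
  have \<gamma>2: "\<theta> \<le> 1 - 2 * \<gamma>" using \<gamma> by (simp add: \<theta>_def)
  have p\<gamma>: "p * \<gamma> \<le> 2 * \<gamma>" using p \<gamma> by (intro mult_right_mono) auto
  have p\<gamma>1: "p * \<gamma> \<le> 1" "\<theta> \<le> 1 - p * \<gamma>" using p\<gamma> \<gamma>2 \<theta> by linarith+
  obtain CY where CY: "CY \<ge> 0" "\<And>X Y. X \<ge> 0 \<Longrightarrow> Y \<ge> 0 \<Longrightarrow> X * Y \<le> s * c1 / 2 * X powr p' + CY * Y powr p"
    using Young_with_weight[of p p' "s * c1 / 2"] p p' s c by auto
  define K1 where "K1 = Cd / (1-s)"
  define K2 where "K2 = CY * Cd powr p"
  have K: "K1 \<ge> 0" "K2 \<ge> 0" using c s1 CY by (auto simp: K1_def K2_def)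
  define \<tau> where "\<tau> = c2 / 2 / (2 * (K1 + K2) + 1)"
  have \<tau>: "\<tau> > 0" using K c by (auto simp: \<tau>_def)
  obtain N where N: "N \<ge> 0" "\<And>A. A \<ge> 0 \<Longrightarrow> A powr \<theta> \<le> N + \<tau> * A"
    using powr_absorb_small[OF \<theta> \<tau>] by blast
  define C where "C = 2 * (K1 + K2) * (N + 1)"
  have C0: "C \<ge> 0" using K N by (simp add: C_def)
  show ?thesis
  proof (intro exI[of _ C] conjI allI impI C0)
    fix W \<epsilon> z b a1 a2 :: real
    assume W: "0 \<le> W" and e: "0 < \<epsilon>" "\<epsilon> \<le> 1" and z: "0 \<le> z" "z \<le> 1" and b: "0 \<le> b"
      and a: "- Cd * z powr (1 - \<gamma>) \<le> a1" "0 \<le> a2" "a2 \<le> Cd * z powr (1 - \<gamma>)"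
    define V where "V = W + \<epsilon>"
    have V: "V > 0" using W e by (simp add: V_def)
    have T1: "- 1/(1-s) * (V powr (1-s) * a1) \<le> K1 * (V powr (1-s) * z powr (1-\<gamma>))"
    proof -
      have "V powr (1-s) * (- a1) \<le> V powr (1-s) * (Cd * z powr (1-\<gamma>))"
        using a by (intro mult_left_mono) auto
      then have "1/(1-s) * (V powr (1-s) * (- a1)) \<le> 1/(1-s) * (V powr (1-s) * (Cd * z powr (1-\<gamma>)))"
        by (rule mult_left_mono) (use s1 in auto)
      moreover have "- 1/(1-s) * (V powr (1-s) * a1) = 1/(1-s) * (V powr (1-s) * (- a1))" by simp
      moreover have "1/(1-s) * (V powr (1-s) * (Cd * z powr (1-\<gamma>))) = K1 * (V powr (1-s) * z powr (1-\<gamma>))"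
        by (simp add: K1_def)
      ultimately show ?thesis by linarith
    qed
    have T2: "b * a2 * V powr (-s) \<le> s * c1 / 2 * (b powr p' * V powr (-s-1) * z) + K2 * (V powr (p-1-s) * z powr (1 - p*\<gamma>))"
    proof (cases "z = 0")
      case True then show ?thesis using a by simp
    next
      case False
      then have z0: "z > 0" using z by simp
      define X where "X = b * (z powr (1/p') * V powr (-(s+1)/p'))"
      define Y where "Y = Cd * (z powr (1/p - \<gamma>) * V powr ((p-1-s)/p))"
      have "b * a2 * V powr (-s) \<le> b * (Cd * z powr (1-\<gamma>)) * V powr (-s)"
        using a b by (intro mult_right_mono mult_left_mono) auto
      also have "\<dots> = X * Y"
      proof -
        have "1 - \<gamma> = 1/p' + (1/p - \<gamma>)" using p' by simp
        moreover have "- s = -(s+1)/p' + (p-1-s)/p" using p unfolding p'_def by (simp add: field_simps)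
        ultimately have "z powr (1-\<gamma>) = z powr (1/p') * z powr (1/p - \<gamma>)" "V powr (-s) = V powr (-(s+1)/p') * V powr ((p-1-s)/p)"
          by (metis powr_add)+
        then show ?thesis by (simp add: X_def Y_def mult_ac)
      qed
      also have "\<dots> \<le> s * c1 / 2 * X powr p' + CY * Y powr p"
        using b c by (intro CY) (auto simp: X_def Y_def)
      also have "X powr p' = b powr p' * V powr (-s-1) * z"
      proof -
        have "-(s+1)/p' * p' = -s-1" using p' by simp
        then show ?thesis using b z p' unfolding X_def by (simp add: powr_mult powr_powr mult_ac)
      qed
      also have "Y powr p = Cd powr p * (V powr (p-1-s) * z powr (1 - p*\<gamma>))"
      proof -
        have "(1/p - \<gamma>) * p = 1 - p * \<gamma>" "(p-1-s)/p * p = p-1-s" using p by (auto simp: field_simps)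
        then show ?thesis using c unfolding Y_def by (simp add: powr_mult powr_powr mult_ac)
      qed
      finally show ?thesis by (simp add: K2_def)
    qed
    \<comment> \<open>The remaining terms are bounded for \<open>W \<le> 1\<close>; for \<open>W > 1\<close> they are at most a multiple of
      \<open>y powr \<theta>\<close> with \<open>y = z W powr (q-s)\<close> and \<open>\<theta> < 1\<close>, absorbed by the source.\<close>
    have T3: "K1 * (V powr (1-s) * z powr (1-\<gamma>)) + K2 * (V powr (p-1-s) * z powr (1 - p*\<gamma>))
        - c2 * W powr q * V powr (-s) * z \<le> C"
    proof (cases "W \<le> 1")
      case True
      have le2: "V powr a \<le> 2" if "0 \<le> a" "a \<le> 1" for a
      proof -
        have "V powr a \<le> 2 powr a" using that V True e unfolding V_def by (intro powr_mono2) auto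
        also have "\<dots> \<le> 2 powr 1" using that by (intro powr_mono) auto
        finally show ?thesis by simp
      qed
      have z1: "z powr a \<le> 1" if "0 \<le> a" for a using z that by (intro powr_le1) auto
      have "K1 * (V powr (1-s) * z powr (1-\<gamma>)) \<le> K1 * (2 * 1)"
        using s1 s \<gamma>2 \<theta> \<gamma> K by (intro mult_left_mono mult_mono le2 z1) auto
      moreover have "K2 * (V powr (p-1-s) * z powr (1 - p*\<gamma>)) \<le> K2 * (2 * 1)"
        using s1 s p p\<gamma>1 K by (intro mult_left_mono mult_mono le2 z1) auto
      moreover have "c2 * W powr q * V powr (-s) * z \<ge> 0" using c z by simp
      moreover have "K1 * (2*1) + K2 * (2*1) \<le> C" using K N by (simp add: C_def algebra_simps)
      ultimately show ?thesis by linarith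
    next
      case False
      then have W1: "W > 1" by simp
      have VW: "V \<le> 2 * W" "W \<le> V" using W1 e by (auto simp: V_def)
      have Vb: "V powr a \<le> 2 * W powr (1-s)" if "0 \<le> a" "a \<le> 1-s" for a
      proof -
        have "V powr a \<le> (2 * W) powr a" using that V VW by (intro powr_mono2) auto
        also have "\<dots> \<le> (2*W) powr (1-s)" using that W1 by (intro powr_mono) auto
        also have "\<dots> = 2 powr (1-s) * W powr (1-s)" using W1 by (simp add: powr_mult)
        also have "\<dots> \<le> 2 powr 1 * W powr (1-s)" using s by (intro mult_right_mono powr_mono) auto
        finally show ?thesis by simp
      qed
      have zb: "z powr a \<le> z powr \<theta>" if "\<theta> \<le> a" for a using z that by (intro powr_mono') auto
      define y where "y = z * W powr (q - s)"
      have y: "y \<ge> 0" using z by (simp add: y_def)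
      have y\<theta>: "y powr \<theta> = W powr (1-s) * z powr \<theta>"
        using z W1 s1 q by (simp add: y_def powr_mult powr_powr \<theta>_def mult.commute)
      have "K1 * (V powr (1-s) * z powr (1-\<gamma>)) \<le> K1 * ((2 * W powr (1-s)) * z powr \<theta>)"
        using s1 s \<gamma>2 \<theta> \<gamma> K by (intro mult_left_mono mult_mono Vb zb) auto
      moreover have "K2 * (V powr (p-1-s) * z powr (1 - p*\<gamma>)) \<le> K2 * ((2 * W powr (1-s)) * z powr \<theta>)"
        using s1 s p p\<gamma>1 K by (intro mult_left_mono mult_mono Vb zb) auto
      moreover have "c2 * W powr q * V powr (-s) * z \<ge> c2/2 * y"
      proof -
        have "V powr (-s) \<ge> (2*W) powr (-s)" using V VW s by (intro powr_mono2') auto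
        moreover have "(2*W) powr (-s) = 2 powr (-s) * W powr (-s)" using W1 by (simp add: powr_mult)
        moreover have "2 powr (-s) \<ge> 2 powr (-1::real)" using s1 by (intro powr_mono) auto
        then have "2 powr (-s) * W powr (-s) \<ge> 2 powr (-1) * W powr (-s)" by (intro mult_right_mono) auto
        ultimately have "V powr (-s) \<ge> W powr (-s) / 2" by (simp add: powr_minus)
        then have "(c2 * W powr q * z) * V powr (-s) \<ge> (c2 * W powr q * z) * (W powr (-s) / 2)"
          using c z by (intro mult_left_mono) auto
        moreover have "W powr q * W powr (-s) = W powr (q - s)" by (simp add: powr_add[symmetric])
        ultimately show ?thesis by (simp add: y_def mult_ac)
      qed
      moreover have "2 * (K1 + K2) * y powr \<theta> \<le> 2 * (K1 + K2) * N + c2/2 * y"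
      proof -
        have "2 * (K1 + K2) * y powr \<theta> \<le> 2 * (K1 + K2) * (N + \<tau> * y)"
          using K N(2)[OF y] by (intro mult_left_mono) auto
        also have "2 * (K1 + K2) * (\<tau> * y) \<le> c2/2 * y"
        proof -
          have "2 * (K1 + K2) * \<tau> \<le> c2/2" using K c by (simp add: \<tau>_def divide_simps)
          from mult_right_mono[OF this y] show ?thesis by (simp add: mult.assoc)
        qed
        then have "2 * (K1 + K2) * (N + \<tau> * y) \<le> 2 * (K1 + K2) * N + c2/2 * y" by (simp add: distrib_left)
        finally show ?thesis .
      qed
      moreover have "2 * (K1 + K2) * N \<le> C" using K by (simp add: C_def distrib_left)
      ultimately show ?thesis unfolding y\<theta> by (simp add: algebra_simps)
    qed
    have half: "s * c1 / 2 * (b powr p' * V powr (-s-1) * z) - s * c1 * b powr p' * V powr (-s-1) * z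
        = - (s * c1 / 2 * (b powr p' * V powr (-s-1) * z))" by (simp add: field_simps)
    show "- 1/(1-s) * ((W + \<epsilon>) powr (1-s) * a1) + b * a2 * (W + \<epsilon>) powr (-s)
       - s * c1 * b powr (p/(p-1)) * (W + \<epsilon>) powr (-s-1) * z - c2 * W powr q * (W + \<epsilon>) powr (-s) * z
     \<le> C - s * c1 / 2 * (b powr (p/(p-1)) * (W + \<epsilon>) powr (-s-1) * z)"
      using T1 T2 T3 half unfolding V_def[symmetric] p'_def[symmetric] by linarith
  qed
qed

text \<open>The integrand of the second estimate in the same dimensionless variables. The additional factor \<open>l\<close> in the bounds on
  the derivatives of the cutoff function is bounded and tends to \<open>0\<close> pointwise as \<open>R \<rightarrow> \<infinity>\<close>; apart from the power
  of \<open>\<epsilon>\<close>, the error terms carry it together with \<open>z W powr q\<close>. The exponents of these terms are smaller than \<open>1\<close>.\<close>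

lemma pointwise_second:
  fixes p q s Cd \<gamma> \<mu> :: real
  assumes p: "1 < p" "p \<le> 2" and q: "1 < q" and s: "0 < s" "(s+1) * (p-1) < q"
    and c: "Cd \<ge> 0" "\<mu> > 0" and \<gamma>: "0 < \<gamma>" "2 * \<gamma> \<le> 1 - (s+1)*(p-1)/q" "2 * \<gamma> \<le> 1 - 1/q"
  shows "\<exists>C\<ge>0. \<forall>W \<epsilon> z b a1 a2 l. 0 \<le> W \<longrightarrow> 0 < \<epsilon> \<longrightarrow> 0 \<le> z \<longrightarrow> z \<le> 1 \<longrightarrow> 0 \<le> b \<longrightarrow> 0 \<le> l \<longrightarrow> l \<le> 2 \<longrightarrow>
     - Cd * l * z powr (1 - \<gamma>) \<le> a1 \<longrightarrow> 0 \<le> a2 \<longrightarrow> a2 \<le> Cd * l * z powr (1 - \<gamma>) \<longrightarrow>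
     - (W * a1) + b * a2 \<le> \<mu> * (b powr (p/(p-1)) * (W + \<epsilon>) powr (-s-1) * z)
        + C * (\<epsilon> powr ((s+1)*(p-1)) + (l * (z * W powr q)) powr ((s+1)*(p-1)/q) + (l * (z * W powr q)) powr (1/q))"
proof -
  define p' where "p' = p / (p-1)"
  define e where "e = (s+1)*(p-1)"
  have p': "1 < p'" "1/p + 1/p' = 1" using p by (auto simp: p'_def field_simps)
  have e: "0 < e" "e < q" using p s by (auto simp: e_def)
  define \<kappa> where "\<kappa> = e / q"
  have \<kappa>: "0 < \<kappa>" "\<kappa> < 1" using e q by (auto simp: \<kappa>_def)
  have p\<gamma>: "p * \<gamma> \<le> 2 * \<gamma>" using p \<gamma> by (intro mult_right_mono) auto
  obtain CY where CY: "CY \<ge> 0" "\<And>X Y. X \<ge> 0 \<Longrightarrow> Y \<ge> 0 \<Longrightarrow> X * Y \<le> \<mu> * X powr p' + CY * Y powr p"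
    using Young_with_weight[of p p' \<mu>] p p' c by auto
  define C1 where "C1 = 2 * Cd"
  define C2 where "C2 = CY * Cd powr p * 2 powr e * 2 powr p"
  have C12: "C1 \<ge> 0" "C2 \<ge> 0" using c CY by (auto simp: C1_def C2_def)
  show ?thesis
  proof (intro exI[of _ "C1 + C2"] conjI allI impI)
    fix W \<epsilon> z b a1 a2 l :: real
    assume W: "0 \<le> W" and \<epsilon>: "0 < \<epsilon>" and z: "0 \<le> z" "z \<le> 1" and b: "0 \<le> b" and l: "0 \<le> l" "l \<le> 2"
      and a: "- Cd * l * z powr (1 - \<gamma>) \<le> a1" "0 \<le> a2" "a2 \<le> Cd * l * z powr (1 - \<gamma>)"
    define y where "y = z * W powr q"
    have y: "y \<ge> 0" using z by (simp add: y_def)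
    define V where "V = W + \<epsilon>"
    have V: "V > 0" using W \<epsilon> by (simp add: V_def)
    have lp: "l powr c \<le> 2 powr (c - d) * l powr d" if "d \<le> c" for c d
    proof (cases "l = 0")
      case False
      then have "l powr c = l powr (c - d) * l powr d" by (simp add: powr_add[symmetric])
      also have "\<dots> \<le> 2 powr (c - d) * l powr d" using l that by (intro mult_right_mono powr_mono2) auto
      finally show ?thesis .
    qed simp
    have T1: "- (W * a1) \<le> C1 * (l * y) powr (1/q)"
    proof -
      have "W * (- a1) \<le> W * (Cd * l * z powr (1 - \<gamma>))" using a W by (intro mult_left_mono) auto
      also have "\<dots> \<le> W * (Cd * l * z powr (1/q))" using z \<gamma> W c l by (intro mult_left_mono powr_mono') auto
      also have "\<dots> = Cd * l * (W * z powr (1/q))" by simp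
      also have "W * z powr (1/q) = y powr (1/q)" using W z q by (simp add: y_def powr_mult powr_powr)
      also have "Cd * l * y powr (1/q) \<le> Cd * (2 * l powr (1/q)) * y powr (1/q)"
      proof -
        have "l \<le> 2 powr (1 - 1/q) * l powr (1/q)" using lp[of "1/q" 1] q l by simp
        also have "\<dots> \<le> 2 powr 1 * l powr (1/q)" using q by (intro mult_right_mono powr_mono) auto
        finally show ?thesis using c by (intro mult_right_mono mult_left_mono) auto
      qed
      also have "\<dots> = C1 * (l * y) powr (1/q)" using l y by (simp add: C1_def powr_mult)
      finally show ?thesis by simp
    qed
    have T2: "b * a2 \<le> \<mu> * (b powr p' * V powr (-s-1) * z) + C2 * (\<epsilon> powr e + (l * y) powr \<kappa>)"
    proof (cases "z = 0")
      case True then show ?thesis using a C12 by simp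
    next
      case False
      then have z0: "z > 0" using z by simp
      define X where "X = b * (z powr (1/p') * V powr (-(s+1)/p'))"
      define Y where "Y = Cd * (l * (z powr (1/p - \<gamma>) * V powr ((s+1)/p')))"
      have "b * a2 \<le> b * (Cd * l * z powr (1-\<gamma>))"
        using a b by (intro mult_left_mono) auto
      also have "\<dots> = X * Y"
      proof -
        have "1 - \<gamma> = 1/p' + (1/p - \<gamma>)" using p' by simp
        then have "z powr (1-\<gamma>) = z powr (1/p') * z powr (1/p - \<gamma>)" by (metis powr_add)
        moreover have "V powr (-(s+1)/p') * V powr ((s+1)/p') = 1"
        proof -
          have "-(s+1)/p' + (s+1)/p' = 0" by (simp only: minus_divide_left[symmetric] left_minus)
          then show ?thesis using V by (simp only: powr_add[symmetric]) simp
        qed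
        ultimately show ?thesis by (simp add: X_def Y_def mult_ac)
      qed
      also have "\<dots> \<le> \<mu> * X powr p' + CY * Y powr p"
        using b c l by (intro CY) (auto simp: X_def Y_def)
      also have "X powr p' = b powr p' * V powr (-s-1) * z"
      proof -
        have "-(s+1)/p' * p' = -s-1" using p' by simp
        then show ?thesis using b z p' unfolding X_def by (simp add: powr_mult powr_powr mult_ac)
      qed
      also have "Y powr p = Cd powr p * (l powr p * (z powr (1 - p*\<gamma>) * V powr e))"
      proof -
        have "(1/p - \<gamma>) * p = 1 - p * \<gamma>" "(s+1)/p' * p = e" using p by (auto simp: field_simps e_def p'_def)
        then show ?thesis using c l unfolding Y_def by (simp add: powr_mult powr_powr mult_ac)
      qed
      also have "l powr p * (z powr (1 - p*\<gamma>) * V powr e) \<le> 2 powr e * 2 powr p * (\<epsilon> powr e + (l * y) powr \<kappa>)"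
      proof -
        have zz: "z powr (1 - p*\<gamma>) \<le> z powr \<kappa>" "z powr \<kappa> \<le> 1"
        proof -
          have "\<kappa> \<le> 1 - p * \<gamma>" using p\<gamma> \<gamma>(2) by (simp add: \<kappa>_def e_def)
          then show "z powr (1 - p*\<gamma>) \<le> z powr \<kappa>" using z by (intro powr_mono') auto
          show "z powr \<kappa> \<le> 1" using z \<kappa> by (intro powr_le1) auto
        qed
        have VV: "V powr e \<le> 2 powr e * (W powr e + \<epsilon> powr e)" unfolding V_def
          using W \<epsilon> e by (intro powr_sum_le) auto
        have ll: "l powr p \<le> 2 powr p" using l p by (intro powr_mono2) auto
        have ll2: "l powr p \<le> 2 powr p * l powr \<kappa>"
        proof -
          have "l powr p \<le> 2 powr (p - \<kappa>) * l powr \<kappa>" using \<kappa> p by (intro lp) auto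
          also have "\<dots> \<le> 2 powr p * l powr \<kappa>" using \<kappa> by (intro mult_right_mono powr_mono) auto
          finally show ?thesis .
        qed
        have "l powr p * (z powr (1 - p*\<gamma>) * V powr e) \<le> l powr p * (z powr \<kappa> * (2 powr e * (W powr e + \<epsilon> powr e)))"
          using zz VV by (intro mult_left_mono mult_mono) auto
        also have "\<dots> = 2 powr e * (l powr p * (z powr \<kappa> * W powr e) + l powr p * (z powr \<kappa> * \<epsilon> powr e))"
          by (simp add: algebra_simps)
        also have "\<dots> \<le> 2 powr e * ((2 powr p * l powr \<kappa>) * (z powr \<kappa> * W powr e) + 2 powr p * (1 * \<epsilon> powr e))"
          using ll ll2 zz by (intro mult_left_mono add_mono mult_right_mono mult_mono) auto
        also have "l powr \<kappa> * (z powr \<kappa> * W powr e) = (l * y) powr \<kappa>"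
          using l z W q by (simp add: y_def powr_mult powr_powr \<kappa>_def)
        then have "2 powr e * ((2 powr p * l powr \<kappa>) * (z powr \<kappa> * W powr e) + 2 powr p * (1 * \<epsilon> powr e))
           = 2 powr e * 2 powr p * (\<epsilon> powr e + (l * y) powr \<kappa>)" by (simp add: algebra_simps)
        finally show ?thesis .
      qed
      then have "CY * (Cd powr p * (l powr p * (z powr (1 - p*\<gamma>) * V powr e)))
         \<le> CY * (Cd powr p * (2 powr e * 2 powr p * (\<epsilon> powr e + (l * y) powr \<kappa>)))"
        using CY by (intro mult_left_mono) auto
      also have "\<dots> = C2 * (\<epsilon> powr e + (l * y) powr \<kappa>)" by (simp add: C2_def)
      finally show ?thesis by simp
    qed
    have "C1 * (l * y) powr (1/q) + C2 * (\<epsilon> powr e + (l * y) powr \<kappa>)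
       \<le> (C1 + C2) * (\<epsilon> powr e + (l * y) powr \<kappa> + (l * y) powr (1/q))"
      using C12 by (simp add: algebra_simps)
    then show "- (W * a1) + b * a2 \<le> \<mu> * (b powr (p/(p-1)) * (W + \<epsilon>) powr (-s-1) * z)
        + (C1 + C2) * (\<epsilon> powr ((s+1)*(p-1)) + (l * (z * W powr q)) powr ((s+1)*(p-1)/q) + (l * (z * W powr q)) powr (1/q))"
      using T1 T2 unfolding V_def[symmetric] p'_def[symmetric] e_def[symmetric] y_def[symmetric] \<kappa>_def[symmetric] by linarith
  qed (use C12 in auto)
qed

section \<open>Cutoff functions\<close>

lemma bump_nonneg: "0 \<le> bump x" and bump_le_1: "bump x \<le> 1"
  by (auto simp: bump_def)

text \<open>The derivative of \<open>x \<mapsto> exp (-1/(\<gamma> x))\<close> is controlled by a power of the function itself that is as close to \<open>1\<close> as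
  desired. This is what raising a cutoff function to a high power usually provides.\<close>

lemma bump_scaled_deriv:
  assumes \<gamma>: "0 < \<gamma>" "\<gamma> < 1"
  shows "\<exists>D. ((\<lambda>x. bump (\<gamma> * x)) has_field_derivative D) (at x) \<and> 0 \<le> D \<and> D \<le> 4/\<gamma> * bump (\<gamma> * x) powr (1 - \<gamma>)"
proof -
  let ?D = "bump_poly (monom 1 2) (\<gamma> * x) * \<gamma>"
  have "bump = bump_poly 1" by (auto simp: bump_def bump_poly_def)
  then have "(bump has_field_derivative bump_poly (monom 1 2) y) (at y)" for y
    using bump_poly_deriv[of 1 y] by simp
  then have "((\<lambda>x. bump (\<gamma> * x)) has_field_derivative ?D) (at x)"
    by (rule DERIV_chain2) (auto intro!: derivative_eq_intros)
  moreover have "0 \<le> ?D" using \<gamma> by (auto simp: bump_poly_def poly_monom)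
  moreover have "?D \<le> 4/\<gamma> * bump (\<gamma> * x) powr (1 - \<gamma>)"
  proof (cases "x > 0")
    case False
    then have "\<gamma> * x \<le> 0" using \<gamma> by (simp add: mult_le_0_iff)
    then show ?thesis using \<gamma> by (auto simp: bump_poly_def)
  next
    case True
    define y where "y = 1/x"
    have y: "y > 0" using True by (simp add: y_def)
    have "y\<^sup>2 * exp (- y) \<le> 4"
    proof -
      have "y / 2 \<le> exp (y/2)" using exp_ge_add_one_self[of "y/2"] by linarith
      then have "(y/2)^2 \<le> (exp (y/2))^2" using y by (intro power_mono) auto
      then have "y\<^sup>2 \<le> 4 * exp y" by (simp add: power2_eq_square exp_add[symmetric] field_simps)
      then show ?thesis by (simp add: exp_minus field_simps)
    qed
    have pos: "\<gamma> * x > 0" using True \<gamma> by simp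
    have e: "1 / (\<gamma> * x) = y / \<gamma>" by (simp add: y_def)
    have "?D = \<gamma> * ((y/\<gamma>)\<^sup>2 * exp (- (y/\<gamma>)))"
      using pos by (simp add: bump_poly_def poly_monom e)
    also have "\<dots> = 1/\<gamma> * (y\<^sup>2 * exp (- y)) * exp (- (y/\<gamma>) + y)"
      using \<gamma> by (simp add: exp_add[symmetric] power_divide power2_eq_square mult.assoc)
    also have "\<dots> \<le> 1/\<gamma> * 4 * exp (- (y/\<gamma>) + y)"
      using \<open>y\<^sup>2 * exp (- y) \<le> 4\<close> \<gamma> by (intro mult_right_mono mult_left_mono) auto
    also have "exp (- (y/\<gamma>) + y) = bump (\<gamma> * x) powr (1 - \<gamma>)"
      using pos \<gamma> by (simp add: bump_def e powr_def field_simps)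
    finally show ?thesis by simp
  qed
  ultimately show ?thesis by blast
qed

text \<open>The parabolic-type gauge \<open>(t/T)\<^sup>2 + (\<bar>x\<bar>/R)\<^sup>2\<close> of the point \<open>z = (t, x)\<close>.\<close>

definition cutoff_gauge :: "real \<Rightarrow> real \<Rightarrow> real \<times> 'b::euclidean_space \<Rightarrow> real" where
  "cutoff_gauge T R z = (fst z / T)\<^sup>2 + (snd z \<bullet> snd z) / R\<^sup>2"

text \<open>For positive parameters, a smooth function that vanishes for \<open>t \<le> \<delta>\<close> and where the gauge is at least \<open>2\<close>. It has no plateau; it
  converges to the positive constant \<open>bump (2 \<gamma>)\<close> as \<open>\<delta> \<rightarrow> 0\<close> and \<open>T, R \<rightarrow> \<infinity>\<close>.\<close>

definition cutoff :: "real \<Rightarrow> real \<Rightarrow> real \<Rightarrow> real \<Rightarrow> real \<times> 'b::euclidean_space \<Rightarrow> real" where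
  "cutoff \<gamma> \<delta> T R z = bump (\<gamma> * (fst z / \<delta> - 1)) * bump (\<gamma> * (2 - cutoff_gauge T R z))"

text \<open>The square root of the gauge, truncated at \<open>2\<close>, which is immaterial on the support of the cutoff function. It
  bounds the factors \<open>\<bar>t\<bar>/T\<close> and \<open>\<bar>x\<bar>/R\<close> that differentiation of the gauge produces.\<close>

definition cutoff_weight :: "real \<Rightarrow> real \<Rightarrow> real \<times> 'b::euclidean_space \<Rightarrow> real" where
  "cutoff_weight T R z = min 2 (sqrt (cutoff_gauge T R z))"

lemma cutoff_gauge_nonneg: "0 \<le> cutoff_gauge T R z" by (simp add: cutoff_gauge_def)

lemma smooth_fst: "smooth (fst :: real \<times> 'b::euclidean_space \<Rightarrow> real)"
  by (rule smooth_linear[OF bounded_linear_fst])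

lemma smooth_cutoff: "smooth (cutoff \<gamma> \<delta> T R :: real \<times> 'b::euclidean_space \<Rightarrow> real)"
proof -
  have g: "cutoff_gauge T R z = (1/T * fst z) * (1/T * fst z) + 1/R\<^sup>2 * (z \<bullet> z - fst z * fst z)" for z :: "real \<times> 'b"
    by (cases z) (simp add: cutoff_gauge_def power2_eq_square)
  have 1: "smooth (\<lambda>z::real \<times> 'b. 2 - cutoff_gauge T R z)" unfolding g
    by (intro smooth_diff smooth_add smooth_mult smooth_const smooth_fst smooth_inner_self)
  have 2: "smooth (\<lambda>z::real \<times> 'b. 1/\<delta> * fst z - 1)"
    by (intro smooth_diff smooth_mult smooth_const smooth_fst)
  have "smooth (\<lambda>z::real \<times> 'b. bump (\<gamma> * (1/\<delta> * fst z - 1)) * bump (\<gamma> * (2 - cutoff_gauge T R z)))"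
    by (intro smooth_mult smooth_bump smooth_const 1 2)
  then show ?thesis by (simp add: cutoff_def[abs_def])
qed

lemma cutoff_nonneg: "0 \<le> cutoff \<gamma> \<delta> T R z" and cutoff_le_1: "cutoff \<gamma> \<delta> T R z \<le> 1"
  by (auto simp: cutoff_def bump_nonneg bump_le_1 intro!: mult_le_one)

lemma cutoff_weight_bounds:
  "0 \<le> cutoff_weight T R z" "cutoff_weight T R z \<le> 2"
  by (auto simp: cutoff_weight_def cutoff_gauge_nonneg)

text \<open>A compact box outside which the cutoff function with positive parameters vanishes.\<close>

definition cutoff_box :: "real \<Rightarrow> real \<Rightarrow> real \<Rightarrow> (real \<times> (real ^ 'n)) set" where
  "cutoff_box \<delta> T R = {\<delta>..2*T} \<times> cbox (\<chi> i. - 2 * R) (\<chi> i. 2 * R)"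

lemma compact_cutoff_box: "compact (cutoff_box \<delta> T R)"
  unfolding cutoff_box_def by (intro compact_Times compact_Icc compact_cbox)

lemma cutoff_box_half_space: "\<delta> > 0 \<Longrightarrow> cutoff_box \<delta> T R \<subseteq> half_space"
  by (auto simp: cutoff_box_def half_space_def)

lemma bump_nonpos: "x \<le> 0 \<Longrightarrow> bump x = 0" by (simp add: bump_def)

lemma cutoff_outside:
  fixes z :: "real \<times> (real ^ 'n)"
  assumes "0 < \<gamma>" "0 < \<delta>" "0 < T" "0 < R" "z \<notin> cutoff_box \<delta> T R"
  shows "cutoff \<gamma> \<delta> T R z = 0"
proof -
  have c: "fst z < \<delta> \<or> fst z > 2 * T \<or> (\<exists>i. \<bar>snd z $ i\<bar> > 2 * R)"
  proof (rule ccontr)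
    assume "\<not> ?thesis"
    then have n: "\<delta> \<le> fst z" "fst z \<le> 2 * T" "\<And>i. \<bar>snd z $ i\<bar> \<le> 2 * R" by (auto simp: not_less)
    have "- 2 * R \<le> snd z $ i \<and> snd z $ i \<le> 2 * R" for i using n(3)[of i] by linarith
    then have "z \<in> cutoff_box \<delta> T R" using n by (cases z) (simp add: cutoff_box_def mem_box_cart)
    then show False using assms(5) by simp
  qed
  have big: "cutoff \<gamma> \<delta> T R z = 0" if "cutoff_gauge T R z \<ge> 2"
    using that assms by (auto simp: cutoff_def mult_le_0_iff intro!: bump_nonpos)
  from c show ?thesis
  proof (elim disjE exE)
    assume "fst z < \<delta>"
    then have "\<gamma> * (fst z / \<delta> - 1) \<le> 0" using assms by (simp add: mult_le_0_iff divide_le_eq)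
    then show ?thesis by (simp add: cutoff_def bump_nonpos)
  next
    assume "fst z > 2 * T"
    then have "2 \<le> fst z / T" using assms by (simp add: le_divide_eq)
    then have "2\<^sup>2 \<le> (fst z / T)\<^sup>2" by (intro power_mono) auto
    moreover have "0 \<le> (snd z \<bullet> snd z) / R\<^sup>2" by simp
    moreover have "(2::real)\<^sup>2 = 4" by simp
    ultimately have "2 \<le> cutoff_gauge T R z" unfolding cutoff_gauge_def by linarith
    then show ?thesis by (rule big)
  next
    fix i assume "\<bar>snd z $ i\<bar> > 2 * R"
    then have "2 * R \<le> norm (snd z)" using component_le_norm_cart[of "snd z" i] by linarith
    then have "(2 * R)\<^sup>2 \<le> snd z \<bullet> snd z" unfolding dot_square_norm using assms by (intro power_mono) auto
    then have "2\<^sup>2 \<le> (snd z \<bullet> snd z) / R\<^sup>2" using assms by (simp add: le_divide_eq power_mult_distrib)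
    moreover have "0 \<le> (fst z / T)\<^sup>2" by simp
    moreover have "(2::real)\<^sup>2 = 4" by simp
    ultimately have "2 \<le> cutoff_gauge T R z" unfolding cutoff_gauge_def by linarith
    then show ?thesis by (rule big)
  qed
qed

lemma measure_cutoff_box:
  assumes "0 < \<delta>" "0 < T" "0 < R"
  shows "measure lebesgue (cutoff_box \<delta> T R :: (real \<times> (real ^ 'n)) set) \<le> 2 * T * (4 * R) ^ CARD('n)"
proof -
  have eq: "(cutoff_box \<delta> T R :: (real \<times> (real ^ 'n)) set) = cbox (\<delta>, \<chi> i. - 2 * R) (2 * T, \<chi> i. 2 * R)"
    by (simp add: cutoff_box_def cbox_Pair_eq)
  have "measure lborel (cbox (\<chi> i. - 2 * R) (\<chi> i. 2 * R) :: (real^'n) set) = (4 * R) ^ CARD('n)"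
  proof -
    have "cbox (\<chi> i. - 2 * R) (\<chi> i. 2 * R) \<noteq> ({} :: (real^'n) set)"
      using assms by (auto simp: interval_ne_empty_cart)
    then show ?thesis by (simp add: content_cbox_cart)
  qed
  moreover have "measure lborel (cbox \<delta> (2*T)) \<le> 2 * T" using assms by (simp add: content_real_if)
  ultimately have "measure lborel (cutoff_box \<delta> T R :: (real \<times> (real ^ 'n)) set) \<le> 2 * T * (4 * R) ^ CARD('n)"
    unfolding eq content_Pair using assms by (auto intro!: mult_right_mono)
  moreover have "(cutoff_box \<delta> T R :: (real \<times> (real ^ 'n)) set) \<in> sets lborel"
    by (simp add: borel_compact compact_cutoff_box)
  ultimately show ?thesis by (simp add: measure_completion)
qed

text \<open>The factor of the cutoff function that vanishes for \<open>t \<le> \<delta>\<close> is increasing, so it only contributes to the time derivative with a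
  positive sign. Hence the lower bound does not involve \<open>\<delta>\<close>.\<close>

lemma cutoff_derivatives:
  fixes z :: "real \<times> (real ^ 'n)"
  assumes \<gamma>: "0 < \<gamma>" "\<gamma> < 1" and pos: "0 < \<delta>" "0 < T" "0 < R"
  defines "\<zeta> \<equiv> cutoff \<gamma> \<delta> T R"
  shows "- (16/\<gamma>) * cutoff_weight T R z * \<zeta> z powr (1 - \<gamma>) \<le> T * frechet_derivative \<zeta> (at z) (1, 0)"
    and "\<exists>a. 0 \<le> a \<and> a \<le> 16/\<gamma> * cutoff_weight T R z * \<zeta> z powr (1 - \<gamma>) \<and>
      (\<forall>v. R * frechet_derivative \<zeta> (at z) (0, v) \<le> a * norm v)"
proof -
  define A where "A = bump (\<gamma> * (fst z / \<delta> - 1))"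
  define B where "B = bump (\<gamma> * (2 - cutoff_gauge T R z))"
  obtain A' where A': "((\<lambda>x. bump (\<gamma> * x)) has_field_derivative A') (at (fst z / \<delta> - 1))" "0 \<le> A'"
    using bump_scaled_deriv[OF \<gamma>] by blast
  obtain B' where B': "((\<lambda>x. bump (\<gamma> * x)) has_field_derivative B') (at (2 - cutoff_gauge T R z))" "0 \<le> B'"
    "B' \<le> 4/\<gamma> * B powr (1 - \<gamma>)"
    using bump_scaled_deriv[OF \<gamma>] unfolding B_def by blast
  have d1: "((\<lambda>z::real \<times> (real^'n). fst z / \<delta> - 1) has_derivative (\<lambda>h. fst h / \<delta>)) (at z)"
    using pos by (auto intro!: derivative_eq_intros)
  have d2: "((\<lambda>z. 2 - cutoff_gauge T R z) has_derivative (\<lambda>h. - (2 * fst z * fst h / T\<^sup>2 + 2 * (snd z \<bullet> snd h) / R\<^sup>2))) (at z)"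
    unfolding cutoff_gauge_def using pos
    by (auto intro!: derivative_eq_intros simp: inner_commute power2_eq_square field_simps)
  have "(\<zeta> has_derivative (\<lambda>h. A * ((- (2 * fst z * fst h / T\<^sup>2 + 2 * (snd z \<bullet> snd h) / R\<^sup>2)) * B') + fst h / \<delta> * A' * B)) (at z)"
    unfolding \<zeta>_def cutoff_def[abs_def] A_def B_def
    by (rule has_derivative_mult[OF DERIV_compose_FDERIV[OF A'(1) d1] DERIV_compose_FDERIV[OF B'(1) d2]])
  from fun_cong[OF frechet_derivative_at[OF this]]
  have D: "frechet_derivative \<zeta> (at z) h = A * ((- (2 * fst z * fst h / T\<^sup>2 + 2 * (snd z \<bullet> snd h) / R\<^sup>2)) * B') + fst h / \<delta> * A' * B" for h
    by simp
  define l where "l = cutoff_weight T R z"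
  have l: "0 \<le> l" unfolding l_def by (rule cutoff_weight_bounds)
  have A: "0 \<le> A" "A \<le> A powr (1 - \<gamma>)"
  proof -
    show A0: "0 \<le> A" by (simp add: A_def bump_nonneg)
    have "A powr 1 \<le> A powr (1 - \<gamma>)" using A0 \<gamma> by (intro powr_mono') (auto simp: A_def bump_le_1)
    then show "A \<le> A powr (1 - \<gamma>)" using A0 by simp
  qed
  have B0: "0 \<le> B" by (simp add: B_def bump_nonneg)
  have AB: "A * B' * r \<le> 4/\<gamma> * l * \<zeta> z powr (1 - \<gamma>)" if r: "0 \<le> r" "r\<^sup>2 \<le> cutoff_gauge T R z" for r
  proof (cases "B = 0")
    case True
    then have "B' = 0" using B' by simp
    then show ?thesis using l \<gamma> by simp
  next
    case False
    then have "\<gamma> * (2 - cutoff_gauge T R z) > 0" unfolding B_def bump_def by (auto split: if_splits)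
    then have "cutoff_gauge T R z < 4" using \<gamma> by (simp add: zero_less_mult_iff)
    then have "sqrt (cutoff_gauge T R z) \<le> 2" using real_sqrt_le_iff[of "cutoff_gauge T R z" 4] by simp
    then have "l = sqrt (cutoff_gauge T R z)" by (simp add: l_def cutoff_weight_def)
    then have "r \<le> l" using r by (simp add: real_le_rsqrt)
    then have "A * B' * r \<le> A powr (1-\<gamma>) * (4/\<gamma> * B powr (1 - \<gamma>)) * l"
      using A B' r \<gamma> by (intro mult_mono) auto
    also have "\<dots> = 4/\<gamma> * l * \<zeta> z powr (1 - \<gamma>)"
      using A B0 unfolding \<zeta>_def cutoff_def A_def[symmetric] B_def[symmetric] by (simp add: powr_mult)
    finally show ?thesis .
  qed
  define M where "M = 4/\<gamma> * l * \<zeta> z powr (1 - \<gamma>)"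
  have M: "0 \<le> M" using l \<gamma> by (simp add: M_def)
  have t: "A * B' * (\<bar>fst z\<bar> / T) \<le> M" unfolding M_def
    by (rule AB) (use pos in \<open>auto simp: cutoff_gauge_def power_divide\<close>)
  have x: "A * B' * (norm (snd z) / R) \<le> M" unfolding M_def
    by (rule AB) (use pos in \<open>auto simp: cutoff_gauge_def power_divide dot_square_norm\<close>)
  have 4: "16/\<gamma> * cutoff_weight T R z * \<zeta> z powr (1 - \<gamma>) = 4 * M" by (simp add: M_def l_def)
  show "- (16/\<gamma>) * cutoff_weight T R z * \<zeta> z powr (1 - \<gamma>) \<le> T * frechet_derivative \<zeta> (at z) (1, 0)"
  proof -
    have "T * frechet_derivative \<zeta> (at z) (1, 0) = - 2 * (A * B' * (fst z / T)) + T * (A' * B) / \<delta>"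
      unfolding D using pos by (simp add: power2_eq_square field_simps)
    moreover have "0 \<le> T * (A' * B) / \<delta>" using A' B0 pos by simp
    moreover have "A * B' * (fst z / T) \<le> A * B' * (\<bar>fst z\<bar> / T)"
      using A B' pos by (intro mult_left_mono divide_right_mono) auto
    ultimately have "- 4 * M \<le> T * frechet_derivative \<zeta> (at z) (1, 0)" using t M by linarith
    then show ?thesis using 4 by (simp add: algebra_simps)
  qed
  show "\<exists>a. 0 \<le> a \<and> a \<le> 16/\<gamma> * cutoff_weight T R z * \<zeta> z powr (1 - \<gamma>) \<and>
      (\<forall>v. R * frechet_derivative \<zeta> (at z) (0, v) \<le> a * norm v)"
  proof (intro exI[of _ "2 * (A * B' * (norm (snd z) / R))"] conjI allI)
    show "0 \<le> 2 * (A * B' * (norm (snd z) / R))" using A B' pos by simp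
    show "2 * (A * B' * (norm (snd z) / R)) \<le> 16/\<gamma> * cutoff_weight T R z * \<zeta> z powr (1 - \<gamma>)"
      unfolding 4 using x M by linarith
    fix v
    have "R * frechet_derivative \<zeta> (at z) (0, v) = 2 * (A * B') / R * (- (snd z \<bullet> v))"
      unfolding D using pos by (simp add: power2_eq_square field_simps)
    also have "\<dots> \<le> 2 * (A * B') / R * (norm (snd z) * norm v)"
    proof (rule mult_left_mono)
      show "- (snd z \<bullet> v) \<le> norm (snd z) * norm v" using Cauchy_Schwarz_ineq2[of "snd z" v] by linarith
    qed (use A B' pos in auto)
    finally show "R * frechet_derivative \<zeta> (at z) (0, v) \<le> 2 * (A * B' * (norm (snd z) / R)) * norm v"
      by (simp add: mult_ac)
  qed
qed

section \<open>Weak derivatives and local integrability\<close>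

lemma L1_loc_times_continuous:
  fixes f g :: "'a::euclidean_space \<Rightarrow> real"
  assumes f: "L1_loc \<Omega> f" and \<Omega>: "open \<Omega>" and g: "continuous_on \<Omega> g"
    and K: "compact K" "K \<subseteq> \<Omega>" "\<And>z. z \<in> \<Omega> \<Longrightarrow> z \<notin> K \<Longrightarrow> g z = 0"
  shows "integrable (lebesgue_on \<Omega>) (\<lambda>z. f z * g z)"
proof -
  have Km: "K \<in> sets lebesgue" "\<Omega> \<in> sets lebesgue" using K \<Omega> by (auto simp: borel_compact)
  have gK: "continuous_on K g" using g K continuous_on_subset by blast
  have "bounded (g ` K)" using compact_continuous_image[OF gK K(1)] compact_imp_bounded by blast
  then obtain C where C: "\<And>z. z \<in> K \<Longrightarrow> \<bar>g z\<bar> \<le> C" unfolding bounded_real by auto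
  have "integrable (lebesgue_on K) (\<lambda>z. g z * f z)"
  proof (rule integrable_bounded_mult[where C=C])
    show "integrable (lebesgue_on K) f" using f K by (auto simp: L1_loc_def)
    show "g \<in> borel_measurable (lebesgue_on K)"
      by (rule continuous_imp_measurable_on_sets_lebesgue[OF gK Km(1)])
  qed (use C in auto)
  then have "integrable lebesgue (\<lambda>z. indicator K z *\<^sub>R (g z * f z))"
    using Km by (subst (asm) integrable_restrict_space) auto
  also have "(\<lambda>z. indicator K z *\<^sub>R (g z * f z)) = (\<lambda>z. indicator \<Omega> z *\<^sub>R (f z * g z))"
  proof
    fix z show "indicator K z *\<^sub>R (g z * f z) = indicator \<Omega> z *\<^sub>R (f z * g z)"
      using K(2) K(3)[of z] by (cases "z \<in> K"; cases "z \<in> \<Omega>") auto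
  qed
  finally show ?thesis using Km by (subst integrable_restrict_space) auto
qed

lemma test_fn_support:
  fixes \<phi> :: "'a::euclidean_space \<Rightarrow> real"
  assumes "test_fn \<Omega> \<phi>" "open \<Omega>"
  obtains K where "compact K" "K \<subseteq> \<Omega>" "\<And>z. z \<in> \<Omega> \<Longrightarrow> z \<notin> K \<Longrightarrow> \<phi> z = 0"
    "\<And>z e. z \<in> \<Omega> \<Longrightarrow> z \<notin> K \<Longrightarrow> frechet_derivative \<phi> (at z) e = 0"
proof (rule that[of "closure {z\<in>\<Omega>. \<phi> z \<noteq> 0}"])
  show "compact (closure {z\<in>\<Omega>. \<phi> z \<noteq> 0})" "closure {z\<in>\<Omega>. \<phi> z \<noteq> 0} \<subseteq> \<Omega>"
    using assms(1) by (auto simp: test_fn_def)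
  show z: "\<phi> z = 0" if "z \<in> \<Omega>" "z \<notin> closure {z\<in>\<Omega>. \<phi> z \<noteq> 0}" for z
    using that closure_subset[of "{z\<in>\<Omega>. \<phi> z \<noteq> 0}"] by auto
  show "frechet_derivative \<phi> (at z) e = 0" if "z \<in> \<Omega>" "z \<notin> closure {z\<in>\<Omega>. \<phi> z \<noteq> 0}" for z e
  proof -
    have "((\<lambda>z. 0) has_derivative (\<lambda>h. 0)) (at z)" by simp
    then have "(\<phi> has_derivative (\<lambda>h. 0)) (at z)"
      by (rule has_derivative_transform_within_open[where s="\<Omega> - closure {z\<in>\<Omega>. \<phi> z \<noteq> 0}"])
        (use that z assms in auto)
    from fun_cong[OF frechet_derivative_at[OF this], of e] show ?thesis by simp
  qed
qed

lemma test_fn_times_integrable: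
  fixes \<phi> f :: "'a::euclidean_space \<Rightarrow> real"
  assumes "test_fn \<Omega> \<phi>" "open \<Omega>" "L1_loc \<Omega> f"
  shows "integrable (lebesgue_on \<Omega>) (\<lambda>z. f z * \<phi> z)"
    and "e \<in> Basis \<Longrightarrow> integrable (lebesgue_on \<Omega>) (\<lambda>z. f z * frechet_derivative \<phi> (at z) e)"
proof -
  obtain K where K: "compact K" "K \<subseteq> \<Omega>" "\<And>z. z \<in> \<Omega> \<Longrightarrow> z \<notin> K \<Longrightarrow> \<phi> z = 0"
    "\<And>z e. z \<in> \<Omega> \<Longrightarrow> z \<notin> K \<Longrightarrow> frechet_derivative \<phi> (at z) e = 0"
    using test_fn_support[OF assms(1,2)] by metis
  have "Ck_on 0 \<Omega> \<phi>" "Ck_on (Suc 0) \<Omega> \<phi>" using assms(1) unfolding test_fn_def by blast+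
  then have c: "continuous_on \<Omega> \<phi>" "e \<in> Basis \<Longrightarrow> continuous_on \<Omega> (\<lambda>z. frechet_derivative \<phi> (at z) e)" for e
    by auto
  show "integrable (lebesgue_on \<Omega>) (\<lambda>z. f z * \<phi> z)"
    by (rule L1_loc_times_continuous[OF assms(3,2) c(1) K(1-3)])
  show "e \<in> Basis \<Longrightarrow> integrable (lebesgue_on \<Omega>) (\<lambda>z. f z * frechet_derivative \<phi> (at z) e)"
    by (rule L1_loc_times_continuous[OF assms(3,2) c(2) K(1,2,4)])
qed

lemma L1_loc_add: "L1_loc \<Omega> f \<Longrightarrow> L1_loc \<Omega> g \<Longrightarrow> L1_loc \<Omega> (\<lambda>z. f z + g z)"
  by (auto simp: L1_loc_def)

lemma weak_deriv_add:
  fixes f1 f2 g1 g2 :: "'a::euclidean_space \<Rightarrow> real"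
  assumes "weak_deriv \<Omega> e f1 g1" "weak_deriv \<Omega> e f2 g2" "open \<Omega>" "e \<in> Basis"
  shows "weak_deriv \<Omega> e (\<lambda>z. f1 z + f2 z) (\<lambda>z. g1 z + g2 z)"
proof -
  have L: "L1_loc \<Omega> f1" "L1_loc \<Omega> f2" "L1_loc \<Omega> g1" "L1_loc \<Omega> g2" using assms by (auto simp: weak_deriv_def)
  show ?thesis unfolding weak_deriv_def
  proof (intro conjI allI impI L1_loc_add L)
    fix \<phi> assume \<phi>: "test_fn \<Omega> \<phi>"
    note i = test_fn_times_integrable(1)[OF \<phi> assms(3)] test_fn_times_integrable(2)[OF \<phi> assms(3) _ assms(4)]
    have "(LINT z|lebesgue_on \<Omega>. f1 z * frechet_derivative \<phi> (at z) e) = - (LINT z|lebesgue_on \<Omega>. g1 z * \<phi> z)"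
      "(LINT z|lebesgue_on \<Omega>. f2 z * frechet_derivative \<phi> (at z) e) = - (LINT z|lebesgue_on \<Omega>. g2 z * \<phi> z)"
      using assms(1,2) \<phi> by (auto simp: weak_deriv_def)
    then show "(LINT z|lebesgue_on \<Omega>. (f1 z + f2 z) * frechet_derivative \<phi> (at z) e)
        = - (LINT z|lebesgue_on \<Omega>. (g1 z + g2 z) * \<phi> z)"
      by (simp add: distrib_right i L)
  qed
qed

section \<open>The scaled first estimate\<close>

lemma lebesgue_on_shrink:
  fixes F :: "'a::euclidean_space \<Rightarrow> real"
  assumes "K \<subseteq> \<Omega>" "K \<in> sets lebesgue" "\<Omega> \<in> sets lebesgue" "\<And>z. z \<in> \<Omega> \<Longrightarrow> z \<notin> K \<Longrightarrow> F z = 0"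
  shows "integrable (lebesgue_on \<Omega>) F \<longleftrightarrow> integrable (lebesgue_on K) F"
    "(LINT z|lebesgue_on \<Omega>. F z) = (LINT z|lebesgue_on K. F z)"
proof -
  have eq: "(\<lambda>z. indicator \<Omega> z *\<^sub>R F z) = (\<lambda>z. indicator K z *\<^sub>R F z)"
  proof
    fix z show "indicator \<Omega> z *\<^sub>R F z = indicator K z *\<^sub>R F z"
      using assms(1) assms(4)[of z] by (cases "z \<in> K"; cases "z \<in> \<Omega>") auto
  qed
  show "integrable (lebesgue_on \<Omega>) F \<longleftrightarrow> integrable (lebesgue_on K) F"
    using assms(2,3) eq by (subst (1 2) integrable_restrict_space) auto
  show "(LINT z|lebesgue_on \<Omega>. F z) = (LINT z|lebesgue_on K. F z)"
    using assms(2,3) eq by (subst (1 2) integral_restrict_space) auto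
qed

lemma integrable_const_compact:
  fixes C :: "'a::euclidean_space set"
  assumes "compact C" shows "integrable (lebesgue_on C) (\<lambda>_. c :: real)"
proof (rule finite_measure.integrable_const)
  show "finite_measure (lebesgue_on C)"
  proof
    show "emeasure (lebesgue_on C) (space (lebesgue_on C)) \<noteq> \<infinity>"
      using lmeasurable_compact[OF assms] by (auto simp: emeasure_restrict_space fmeasurable_def simp del: emeasure_completion)
  qed
qed

lemma open_half_space: "open (half_space :: (real \<times> (real ^ 'n)) set)"
  unfolding half_space_def by (intro open_Times) auto

lemma space_direction_Basis: "(0, axis i 1) \<in> (Basis :: (real \<times> (real ^ 'n)) set)"
  by (auto simp: Basis_prod_def)

lemma time_direction_Basis: "(1, 0) \<in> (Basis :: (real \<times> (real ^ 'n)) set)"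
  by (auto simp: Basis_prod_def)

text \<open>What is used about the difference \<open>w\<close> of a super-solution and a sub-solution: \<open>G\<close> is its weak spatial gradient,
  \<open>g0\<close> its weak time derivative, \<open>B\<close> the difference of the fluxes and \<open>h\<close> the difference of the source terms.\<close>

locale comparison =
  fixes p q :: real and w g0 h :: "real \<times> (real ^ 'n) \<Rightarrow> real" and G B :: "real \<times> (real ^ 'n) \<Rightarrow> real ^ 'n"
  assumes p: "1 < p" "p \<le> 2" and q: "1 < q" "q \<le> p - 1 + p / real CARD('n)"
    and w_nonneg: "AE z in lebesgue_on half_space. 0 \<le> w z"
    and dt: "weak_deriv half_space (1, 0) w g0"
    and dx: "\<And>i. weak_deriv half_space (0, axis i 1) w (\<lambda>z. G z $ i)"
    and h_loc: "L1_loc half_space h"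
    and B_loc: "\<And>i. L1_loc half_space (\<lambda>z. B z $ i)"
    and Bp_loc: "\<And>i. L1_loc half_space (\<lambda>z. \<bar>B z $ i\<bar> powr (p/(p-1)))"
    and Gp_loc: "\<And>i. L1_loc half_space (\<lambda>z. \<bar>G z $ i\<bar> powr p)"
    and flux: "\<And>z. 2 powr (1 - p/(p-1)) * norm (B z) powr (p/(p-1)) \<le> B z \<bullet> G z"
    and source: "AE z in lebesgue_on half_space. 2 powr (-q) * w z powr q \<le> h z"
    and ineq: "\<And>\<phi>. test_fn half_space \<phi> \<Longrightarrow> (\<And>z. z \<in> half_space \<Longrightarrow> 0 \<le> \<phi> z) \<Longrightarrow>
      0 \<le> (LINT z|lebesgue_on half_space. g0 z * \<phi> z
             + (\<Sum>i\<in>UNIV. B z $ i * frechet_derivative \<phi> (at z) (0, axis i 1)) - h z * \<phi> z)"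
begin

text \<open>The small exponent in the test function \<open>(w + \<epsilon>) powr (-s) \<zeta>\<close>.\<close>

definition s :: real where "s = min (p-1) (q-1) / 2"

text \<open>The loss in the exponent of the cutoff function under differentiation, small enough for both pointwise inequalities.\<close>

definition \<gamma> :: real where
  "\<gamma> = min (1 - (1-s)/(q-s)) (min (1 - (s+1)*(p-1)/q) (1 - 1/q)) / 4"

text \<open>The scaling of the equation: at spatial scale \<open>R\<close> the natural units of \<open>w\<close>, \<open>t\<close> and \<open>\<bar>B\<bar>\<close> are \<open>1 / L R\<close>,
  \<open>T R\<close> and \<open>\<beta> R\<close>.\<close>

definition \<kappa> :: real where "\<kappa> = p / (q - p + 1)"
definition L :: "real \<Rightarrow> real" where "L R = R powr \<kappa>"
definition T :: "real \<Rightarrow> real" where "T R = R powr (\<kappa> * (q-1))"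
definition \<beta> :: "real \<Rightarrow> real" where "\<beta> R = R powr (-(\<kappa>+1)*(p-1))"

text \<open>The cutoff function at scale \<open>R\<close>, a box containing its support, and the weight in the bounds on its derivatives.\<close>

definition \<zeta> :: "real \<Rightarrow> real \<Rightarrow> real \<times> (real ^ 'n) \<Rightarrow> real" where "\<zeta> \<delta> R = cutoff \<gamma> \<delta> (T R) R"
definition K :: "real \<Rightarrow> real \<Rightarrow> (real \<times> (real ^ 'n)) set" where "K \<delta> R = cutoff_box \<delta> (T R) R"
definition lam :: "real \<Rightarrow> real \<times> (real ^ 'n) \<Rightarrow> real" where "lam R = cutoff_weight (T R) R"

text \<open>The quantity controlled by the first estimate, in natural units; \<open>\<epsilon>\<close> is rescaled with \<open>w\<close>.\<close>

definition P :: "real \<Rightarrow> real \<Rightarrow> real \<Rightarrow> real \<times> (real ^ 'n) \<Rightarrow> real" where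
  "P R \<delta> \<epsilon> z = (norm (B z) / \<beta> R) powr (p/(p-1)) * (L R * w z + \<epsilon>) powr (-s-1) * \<zeta> \<delta> R z"

lemma s: "0 < s" "s < p - 1" "s < q - 1" "s < 1" and s2: "(s+1)*(p-1) < q"
proof -
  show s: "0 < s" "s < p - 1" "s < q - 1" "s < 1" using p q by (auto simp: s_def min_def)
  have "(s+1)*(p-1) \<le> (s+1) * 1" using s p by (intro mult_left_mono) auto
  also have "(s+1) * 1 < q" using s by simp
  finally show "(s+1)*(p-1) < q" .
qed

lemma \<gamma>: "0 < \<gamma>" "\<gamma> < 1" "2 * \<gamma> \<le> 1 - (1-s)/(q-s)" "2 * \<gamma> \<le> 1 - (s+1)*(p-1)/q" "2 * \<gamma> \<le> 1 - 1/q"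
proof -
  have pos: "0 < 1 - (1-s)/(q-s)" "0 < 1 - (s+1)*(p-1)/q" "0 < 1 - 1/q"
    using s s2 q by (auto simp: divide_less_eq)
  then show "0 < \<gamma>" by (simp add: \<gamma>_def)
  have m: "4 * \<gamma> \<le> 1 - (1-s)/(q-s)" "4 * \<gamma> \<le> 1 - (s+1)*(p-1)/q" "4 * \<gamma> \<le> 1 - 1/q"
    by (auto simp: \<gamma>_def)
  then show "2 * \<gamma> \<le> 1 - (1-s)/(q-s)" "2 * \<gamma> \<le> 1 - (s+1)*(p-1)/q" "2 * \<gamma> \<le> 1 - 1/q"
    using \<open>0 < \<gamma>\<close> by linarith+
  have "0 < 1/q" using q by simp
  then show "\<gamma> < 1" using m(3) by linarith
qed

lemma qp: "q - p + 1 > 0" using p q by linarith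
lemma \<kappa>_pos: "\<kappa> > 0" using p qp by (simp add: \<kappa>_def)
lemma \<kappa>_eq: "\<kappa> * (q - p + 1) = p" using qp by (simp add: \<kappa>_def)
lemma \<kappa>_ge: "real CARD('n) \<le> \<kappa>"
proof -
  have n: "real CARD('n) > 0" by simp
  have "(q - p + 1) * real CARD('n) \<le> p" using q(2) n by (simp add: field_simps)
  then show ?thesis using qp by (simp add: \<kappa>_def le_divide_eq mult.commute)
qed

lemma scale_pos: "R \<ge> 1 \<Longrightarrow> 0 < L R" "R \<ge> 1 \<Longrightarrow> 0 < T R" "R \<ge> 1 \<Longrightarrow> 0 < \<beta> R"
  by (auto simp: L_def T_def \<beta>_def)

lemma T_eq: "T R = L R powr (q - 1)" by (simp add: T_def L_def powr_powr)

lemma \<beta>_div: assumes "R \<ge> 1" shows "\<beta> R / R = L R powr (-q)"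
proof -
  have "\<beta> R / R = R powr (-(\<kappa>+1)*(p-1) - 1)" using assms by (simp add: \<beta>_def powr_diff)
  also have "-(\<kappa>+1)*(p-1) - 1 = \<kappa> * (-q)" using \<kappa>_eq by (simp add: algebra_simps)
  finally show ?thesis by (simp add: L_def powr_powr)
qed

lemma \<beta>_powr: assumes "R \<ge> 1" shows "\<beta> R powr (p/(p-1)) = L R powr (-q-1)"
proof -
  have "\<beta> R powr (p/(p-1)) = R powr (-(\<kappa>+1)*(p-1) * (p/(p-1)))" by (simp add: \<beta>_def powr_powr)
  also have "-(\<kappa>+1)*(p-1) * (p/(p-1)) = -(\<kappa>+1)*p" using p by simp
  also have "\<dots> = \<kappa> * (-q-1)" 
  proof -
    have "p = \<kappa> * q - \<kappa> * p + \<kappa>" using \<kappa>_eq by (simp add: algebra_simps)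
    then show ?thesis by (simp add: algebra_simps)
  qed
  finally show ?thesis by (simp add: L_def powr_powr)
qed

text \<open>The left-hand side is at most a constant times \<open>R powr (n - \<kappa>)\<close>. The upper bound on \<open>q\<close> enters here and only here, through \<open>n \<le> \<kappa>\<close>.\<close>

lemma volume: assumes "R \<ge> 1" "0 < \<delta>"
  shows "L R powr (-q) * measure lebesgue (K \<delta> R) \<le> 2 * 4 ^ CARD('n)"
proof -
  have "measure lebesgue (K \<delta> R) \<le> 2 * T R * (4 * R) ^ CARD('n)" unfolding K_def
    by (rule measure_cutoff_box) (use assms scale_pos in auto)
  then have "L R powr (-q) * measure lebesgue (K \<delta> R) \<le> L R powr (-q) * (2 * T R * (4 * R) ^ CARD('n))"
    by (rule mult_left_mono) simp
  also have "\<dots> = 2 * 4 ^ CARD('n) * (R powr (\<kappa> * (-q) + \<kappa> * (q-1) + real CARD('n)))"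
  proof -
    have "0 < R" using assms by simp
    then have "R powr (\<kappa> * (-q) + \<kappa> * (q-1) + real CARD('n)) = L R powr (-q) * T R * R ^ CARD('n)"
      by (simp only: powr_add L_def T_def powr_powr powr_realpow)
    then show ?thesis by (simp add: power_mult_distrib)
  qed
  also have "\<kappa> * (-q) + \<kappa> * (q-1) + real CARD('n) = real CARD('n) - \<kappa>" by (simp add: algebra_simps)
  also have "R powr (real CARD('n) - \<kappa>) \<le> R powr 0" using assms \<kappa>_ge by (intro powr_mono) auto
  finally show ?thesis using assms by simp
qed

lemma compact_K: "compact (K \<delta> R)" unfolding K_def by (rule compact_cutoff_box)
lemma K_half_space: "\<delta> > 0 \<Longrightarrow> K \<delta> R \<subseteq> half_space" unfolding K_def by (rule cutoff_box_half_space)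
lemma sets_K: "K \<delta> R \<in> sets lebesgue" using compact_K by (auto simp: borel_compact)
lemma sets_half_space: "(half_space :: (real \<times> (real ^ 'n)) set) \<in> sets lebesgue"
  by (rule sets_completionI_sets) (simp add: borel_open open_half_space)

lemma integral_const_K: "integrable (lebesgue_on (K \<delta> R)) (\<lambda>_. c)"
  "(LINT z|lebesgue_on (K \<delta> R). c) = c * measure lebesgue (K \<delta> R)"
proof -
  show "integrable (lebesgue_on (K \<delta> R)) (\<lambda>_. c)" by (rule integrable_const_compact[OF compact_K])
  show "(LINT z|lebesgue_on (K \<delta> R). c) = c * measure lebesgue (K \<delta> R)"
    using sets_K by (simp add: measure_restrict_space)
qed

lemma AE_K: "\<delta> > 0 \<Longrightarrow> AE z in lebesgue_on half_space. Q z \<Longrightarrow> AE z in lebesgue_on (K \<delta> R). Q z"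
  using K_half_space[of \<delta> R] sets_K[of \<delta> R] sets_half_space
  by (auto simp: AE_restrict_space_iff elim!: eventually_mono)

lemma \<zeta>: assumes "R \<ge> 1" "\<delta> > 0"
  shows "smooth (\<zeta> \<delta> R)" "0 \<le> \<zeta> \<delta> R z" "\<zeta> \<delta> R z \<le> 1" "z \<notin> K \<delta> R \<Longrightarrow> \<zeta> \<delta> R z = 0"
  using assms scale_pos[of R] \<gamma> cutoff_outside[of \<gamma> \<delta> "T R" R z]
  by (auto simp: \<zeta>_def K_def smooth_cutoff cutoff_nonneg cutoff_le_1)

lemma lam: "0 \<le> lam R z" "lam R z \<le> 2" by (simp_all add: lam_def cutoff_weight_bounds)

lemma \<zeta>_deriv: assumes "R \<ge> 1" "\<delta> > 0"
  shows "- (16/\<gamma>) * lam R z * \<zeta> \<delta> R z powr (1 - \<gamma>) \<le> T R * frechet_derivative (\<zeta> \<delta> R) (at z) (1, 0)"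
    "\<exists>a. 0 \<le> a \<and> a \<le> 16/\<gamma> * lam R z * \<zeta> \<delta> R z powr (1 - \<gamma>) \<and>
      R * (\<Sum>i\<in>UNIV. v $ i * frechet_derivative (\<zeta> \<delta> R) (at z) (0, axis i 1)) \<le> a * norm v"
proof -
  have pos: "0 < T R" "0 < R" using assms scale_pos by auto
  note D = cutoff_derivatives[OF \<gamma>(1,2) assms(2) pos, of z]
  show "- (16/\<gamma>) * lam R z * \<zeta> \<delta> R z powr (1 - \<gamma>) \<le> T R * frechet_derivative (\<zeta> \<delta> R) (at z) (1, 0)"
    using D(1) unfolding \<zeta>_def lam_def .
  let ?D = "frechet_derivative (\<zeta> \<delta> R) (at z)"
  have lin: "linear ?D"
    using smooth_has_derivative[OF \<zeta>(1)[OF assms]] has_derivative_linear by blast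
  have "?D (0, v) = ?D (\<Sum>i\<in>UNIV. v $ i *\<^sub>R (0, axis i 1))"
  proof -
    have "(0, v) = (\<Sum>i\<in>UNIV. v $ i *\<^sub>R (0::real, axis i 1 :: real^'n))"
      using basis_expansion[of v] by (simp add: prod_eq_iff fst_sum snd_sum scalar_mult_eq_scaleR)
    then show ?thesis by simp
  qed
  also have "\<dots> = (\<Sum>i\<in>UNIV. v $ i * ?D (0, axis i 1))"
    by (simp only: linear_sum[OF lin] linear_scale[OF lin] real_scaleR_def)
  finally have sum: "(\<Sum>i\<in>UNIV. v $ i * ?D (0, axis i 1)) = ?D (0, v)" by simp
  obtain a where a: "0 \<le> a" "a \<le> 16/\<gamma> * lam R z * \<zeta> \<delta> R z powr (1 - \<gamma>)" "\<And>v. R * ?D (0, v) \<le> a * norm v"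
    using D(2) unfolding \<zeta>_def[symmetric] lam_def[symmetric] by blast
  show "\<exists>a. 0 \<le> a \<and> a \<le> 16/\<gamma> * lam R z * \<zeta> \<delta> R z powr (1 - \<gamma>) \<and>
      R * (\<Sum>i\<in>UNIV. v $ i * ?D (0, axis i 1)) \<le> a * norm v"
    unfolding sum using a by blast
qed

lemma norm_B_measurable: assumes "\<delta> > 0" shows "(\<lambda>z. norm (B z)) \<in> borel_measurable (lebesgue_on (K \<delta> R))"
proof -
  have [measurable]: "(\<lambda>z. B z $ i) \<in> borel_measurable (lebesgue_on (K \<delta> R))" for i
    by (rule borel_measurable_integrable)
       (use B_loc[of i] compact_K[of \<delta> R] K_half_space[OF assms, of R] in \<open>auto simp: L1_loc_def\<close>)
  show ?thesis unfolding norm_vec_def L2_set_def by measurable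
qed

lemma w_integrable: assumes "\<delta> > 0" shows "integrable (lebesgue_on (K \<delta> R)) w"
  using dt compact_K[of \<delta> R] K_half_space[OF assms, of R] by (auto simp: L1_loc_def weak_deriv_def)

lemma h_integrable: assumes "\<delta> > 0" shows "integrable (lebesgue_on (K \<delta> R)) h"
  using h_loc compact_K[of \<delta> R] K_half_space[OF assms, of R] by (auto simp: L1_loc_def)

lemma \<zeta>_measurable: assumes "R \<ge> 1" "\<delta> > 0" "S \<in> sets lebesgue" 
  shows "\<zeta> \<delta> R \<in> borel_measurable (lebesgue_on S)"
  by (rule continuous_imp_measurable_on_sets_lebesgue[OF smooth_continuous[OF \<zeta>(1)[OF assms(1,2)]] assms(3)])

lemma P_measurable: assumes "R \<ge> 1" "\<delta> > 0" shows "P R \<delta> \<epsilon> \<in> borel_measurable (lebesgue_on (K \<delta> R))"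
proof -
  note [measurable] = norm_B_measurable[OF assms(2)] \<zeta>_measurable[OF assms sets_K]
  have [measurable]: "w \<in> borel_measurable (lebesgue_on (K \<delta> R))" using w_integrable[OF assms(2)] by auto
  show ?thesis unfolding P_def[abs_def] by measurable
qed

lemma P_nonneg: "R \<ge> 1 \<Longrightarrow> \<delta> > 0 \<Longrightarrow> 0 \<le> P R \<delta> \<epsilon> z" using \<zeta> by (simp add: P_def)

abbreviation (input) p' where "p' \<equiv> p/(p-1)"

lemma norm_B_scale: assumes "R \<ge> 1"
  shows "norm (B z) / R = L R powr (-q) * (norm (B z) / \<beta> R)"
    "norm (B z) powr p' = L R powr (-q-1) * (norm (B z) / \<beta> R) powr p'"
proof -
  show "norm (B z) / R = L R powr (-q) * (norm (B z) / \<beta> R)"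
    unfolding \<beta>_div[OF assms, symmetric] using scale_pos[OF assms] by simp
  show "norm (B z) powr p' = L R powr (-q-1) * (norm (B z) / \<beta> R) powr p'"
    unfolding \<beta>_powr[OF assms, symmetric] using scale_pos[OF assms] by (simp add: powr_divide)
qed

text \<open>In natural units every term of the tested inequality carries the same factor \<open>L R powr (s - q)\<close>.\<close>

lemma test_density_bound:
  assumes R: "R \<ge> 1" and \<delta>: "\<delta> > 0" and \<epsilon>: "0 < \<epsilon>" and w: "0 \<le> w z" and h: "2 powr (-q) * w z powr q \<le> h z"
    and a: "R * (\<Sum>i\<in>UNIV. B z $ i * frechet_derivative (\<zeta> \<delta> R) (at z) (0, axis i 1)) \<le> a * norm (B z)"
  defines "W \<equiv> L R * w z" and "b \<equiv> norm (B z) / \<beta> R" and "a1 \<equiv> T R * frechet_derivative (\<zeta> \<delta> R) (at z) (1, 0)"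
  shows "test_density UNIV (\<lambda>i. (0, axis i 1)) (1, 0) s (\<epsilon> / L R) (\<zeta> \<delta> R) (\<lambda>i z. B z $ i) h w (\<lambda>i z. G z $ i) z
    \<le> L R powr (s - q) * (- 1/(1-s) * ((W + \<epsilon>) powr (1-s) * a1) + b * a * (W + \<epsilon>) powr (-s)
       - s * 2 powr (1 - p') * b powr p' * (W + \<epsilon>) powr (-s-1) * \<zeta> \<delta> R z
       - 2 powr (-q) * W powr q * (W + \<epsilon>) powr (-s) * \<zeta> \<delta> R z)"
proof -
  define l where "l = L R"
  have l: "l > 0" using scale_pos[OF R] by (simp add: l_def)
  define X where "X = W + \<epsilon>"
  have X: "X > 0" using w \<epsilon> l by (simp add: X_def W_def l_def add_nonneg_pos)
  define V where "V = w z + \<epsilon> / l"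
  have VX: "V = X / l" using l by (simp add: V_def X_def W_def l_def field_simps)
  have Vp: "V powr r = X powr r * l powr (- r)" for r
    unfolding VX using X l by (simp add: powr_divide powr_minus field_simps)
  define z0 where "z0 = \<zeta> \<delta> R z"
  have z0: "z0 \<ge> 0" using \<zeta> R \<delta> by (simp add: z0_def)
  define S where "S = (\<Sum>i\<in>UNIV. B z $ i * frechet_derivative (\<zeta> \<delta> R) (at z) (0, axis i 1))"
  have ll: "l powr x * l powr y = l powr (x + y)" for x y by (simp add: powr_add)
  have eq: "test_density UNIV (\<lambda>i. (0, axis i 1)) (1, 0) s (\<epsilon> / L R) (\<zeta> \<delta> R) (\<lambda>i z. B z $ i) h w (\<lambda>i z. G z $ i) z
     = V powr (-s) * S - s * V powr (-s-1) * (B z \<bullet> G z) * z0 - h z * (V powr (-s) * z0)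
       - 1/(1-s) * (V powr (1-s) * frechet_derivative (\<zeta> \<delta> R) (at z) (1, 0))"
    unfolding test_density_def l_def[symmetric] V_def[symmetric] z0_def[symmetric] S_def inner_vec_def
    by (simp add: distrib_left sum.distrib sum_subtractf sum_distrib_left sum_distrib_right algebra_simps)
  have 1: "V powr (-s) * S \<le> l powr (s - q) * (b * a * X powr (-s))"
  proof -
    have "S \<le> a * (norm (B z) / R)" using a R by (simp add: S_def field_simps)
    then have "V powr (-s) * S \<le> V powr (-s) * (a * (norm (B z) / R))" by (intro mult_left_mono) auto
    also have "\<dots> = (l powr s * l powr (-q)) * (b * a * X powr (-s))"
      unfolding norm_B_scale[OF R] Vp by (simp add: b_def l_def)
    finally show ?thesis unfolding ll by simp
  qed
  have 2: "l powr (s - q) * (s * 2 powr (1 - p') * b powr p' * X powr (-s-1) * z0) \<le> s * V powr (-s-1) * (B z \<bullet> G z) * z0"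
  proof -
    have "s * V powr (-s-1) * (2 powr (1 - p') * norm (B z) powr p') * z0 \<le> s * V powr (-s-1) * (B z \<bullet> G z) * z0"
      using flux s z0 by (intro mult_right_mono mult_left_mono) auto
    also have "s * V powr (-s-1) * (2 powr (1 - p') * norm (B z) powr p') * z0
       = (l powr (s+1) * l powr (-q-1)) * (s * 2 powr (1 - p') * b powr p' * X powr (-s-1) * z0)"
      unfolding norm_B_scale[OF R] Vp by (simp add: b_def l_def add.commute)
    finally show ?thesis unfolding ll by simp
  qed
  have 3: "l powr (s - q) * (2 powr (-q) * W powr q * X powr (-s) * z0) \<le> h z * (V powr (-s) * z0)"
  proof -
    have "W powr q = l powr q * w z powr q" using l w by (simp add: W_def l_def powr_mult)
    then have wq: "w z powr q = W powr q * l powr (- q)" using l by (simp add: powr_minus)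
    have "(2 powr (-q) * w z powr q) * (V powr (-s) * z0) \<le> h z * (V powr (-s) * z0)"
      using h z0 by (intro mult_right_mono) auto
    also have "(2 powr (-q) * w z powr q) * (V powr (-s) * z0) = (l powr s * l powr (-q)) * (2 powr (-q) * W powr q * X powr (-s) * z0)"
      unfolding wq Vp by simp
    finally show ?thesis unfolding ll by simp
  qed
  have 4: "- (1/(1-s) * (V powr (1-s) * frechet_derivative (\<zeta> \<delta> R) (at z) (1, 0))) = l powr (s - q) * (- 1/(1-s) * (X powr (1-s) * a1))"
  proof -
    have "frechet_derivative (\<zeta> \<delta> R) (at z) (1, 0) = l powr (1 - q) * a1"
    proof -
      have "l powr (1 - q) * l powr (q - 1) = 1" unfolding ll using l by simp
      then show ?thesis by (simp add: a1_def T_eq l_def mult.assoc[symmetric])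
    qed
    then have "- (1/(1-s) * (V powr (1-s) * frechet_derivative (\<zeta> \<delta> R) (at z) (1, 0)))
      = (l powr (-(1-s)) * l powr (1-q)) * (- 1/(1-s) * (X powr (1-s) * a1))"
      unfolding Vp by simp
    then show ?thesis unfolding ll by simp
  qed
  show ?thesis unfolding eq unfolding X_def[symmetric] l_def[symmetric] z0_def[symmetric]
    using 1 2 3 4 unfolding right_diff_distrib distrib_left by linarith
qed

text \<open>The constant is uniform in \<open>R\<close>, \<open>\<delta>\<close> and \<open>\<epsilon>\<close>.\<close>

lemma first_estimate:
  "\<exists>C\<ge>0. \<forall>R \<delta> \<epsilon>. 1 \<le> R \<longrightarrow> 0 < \<delta> \<longrightarrow> 0 < \<epsilon> \<longrightarrow> \<epsilon> \<le> 1 \<longrightarrow>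
     integrable (lebesgue_on (K \<delta> R)) (P R \<delta> \<epsilon>) \<and> L R powr (-q) * (LINT z|lebesgue_on (K \<delta> R). P R \<delta> \<epsilon> z) \<le> C"
proof -
  define c1 :: real where "c1 = 2 powr (1 - p')"
  define c2 :: real where "c2 = 2 powr (-q)"
  have c: "c1 > 0" "c2 > 0" "32/\<gamma> \<ge> 0" using \<gamma> by (auto simp: c1_def c2_def)
  obtain C where C: "C \<ge> 0" "\<And>W \<epsilon> z b a1 a2. 0 \<le> W \<Longrightarrow> 0 < \<epsilon> \<Longrightarrow> \<epsilon> \<le> 1 \<Longrightarrow> 0 \<le> z \<Longrightarrow> z \<le> 1 \<Longrightarrow> 0 \<le> b \<Longrightarrow>
     - (32/\<gamma>) * z powr (1 - \<gamma>) \<le> a1 \<Longrightarrow> 0 \<le> a2 \<Longrightarrow> a2 \<le> 32/\<gamma> * z powr (1 - \<gamma>) \<Longrightarrow>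
     - 1/(1-s) * ((W + \<epsilon>) powr (1-s) * a1) + b * a2 * (W + \<epsilon>) powr (-s)
       - s * c1 * b powr p' * (W + \<epsilon>) powr (-s-1) * z - c2 * W powr q * (W + \<epsilon>) powr (-s) * z
     \<le> C - s * c1 / 2 * (b powr p' * (W + \<epsilon>) powr (-s-1) * z)"
    using pointwise_first[OF p q(1) s(1,2) c \<gamma>(1,3)] by blast
  define c where "c = s * c1 / 2"
  have c0: "c > 0" using s c by (simp add: c_def)
  define C' where "C' = C / c * (2 * 4 ^ CARD('n))"
  show ?thesis
  proof (intro exI[of _ C'] conjI allI impI)
    show "0 \<le> C'" using C(1) c0 by (simp add: C'_def)
    fix R \<delta> \<epsilon> :: real
    assume R: "1 \<le> R" and \<delta>: "0 < \<delta>" and \<epsilon>: "0 < \<epsilon>" "\<epsilon> \<le> 1"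
    define J where "J = test_density UNIV (\<lambda>i. (0, axis i 1)) (1, 0) s (\<epsilon> / L R) (\<zeta> \<delta> R) (\<lambda>i z. B z $ i) h w (\<lambda>i z. G z $ i)"
    define l where "l = L R powr (s - q)"
    have l: "l > 0" using scale_pos[OF R] by (simp add: l_def)
    have pp: "1 < p'" "1/p + 1/p' = 1" using p by (auto simp: field_simps)
    have J: "integrable (lebesgue_on (K \<delta> R)) J" "0 \<le> (LINT z|lebesgue_on (K \<delta> R). J z)"
      unfolding J_def
      by (rule weak_ineq_negative_power[where \<Omega>=half_space and ?g0.0=g0 and p=p and p'=p'],
        (rule open_half_space compact_K K_half_space[OF \<delta>] finite space_direction_Basis time_direction_Basis dt dx w_nonneg
          h_loc B_loc Bp_loc Gp_loc p pp \<zeta>[OF R \<delta>] s divide_pos_pos \<epsilon> scale_pos[OF R] ineq; assumption?)+)+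
    have bnd: "AE z in lebesgue_on (K \<delta> R). J z \<le> l * (C - c * P R \<delta> \<epsilon> z)"
      using AE_K[OF \<delta> w_nonneg] AE_K[OF \<delta> source]
    proof eventually_elim
      case (elim z)
      obtain a where a: "0 \<le> a" "a \<le> 16/\<gamma> * lam R z * \<zeta> \<delta> R z powr (1 - \<gamma>)"
        "R * (\<Sum>i\<in>UNIV. B z $ i * frechet_derivative (\<zeta> \<delta> R) (at z) (0, axis i 1)) \<le> a * norm (B z)"
        using \<zeta>_deriv(2)[OF R \<delta>] by blast
      have le: "16/\<gamma> * lam R z * \<zeta> \<delta> R z powr (1 - \<gamma>) \<le> 32/\<gamma> * \<zeta> \<delta> R z powr (1 - \<gamma>)"
        using lam[of R z] \<gamma> by (intro mult_right_mono) (auto simp: divide_simps)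
      have "J z \<le> l * (- 1/(1-s) * ((L R * w z + \<epsilon>) powr (1-s) * (T R * frechet_derivative (\<zeta> \<delta> R) (at z) (1, 0)))
         + (norm (B z) / \<beta> R) * a * (L R * w z + \<epsilon>) powr (-s)
         - s * c1 * (norm (B z) / \<beta> R) powr p' * (L R * w z + \<epsilon>) powr (-s-1) * \<zeta> \<delta> R z
         - c2 * (L R * w z) powr q * (L R * w z + \<epsilon>) powr (-s) * \<zeta> \<delta> R z)"
        unfolding J_def l_def c1_def c2_def
        by (rule test_density_bound[OF R \<delta> \<epsilon>(1) elim(1) elim(2) a(3)])
      also have "\<dots> \<le> l * (C - c * P R \<delta> \<epsilon> z)"
        unfolding P_def c_def
      proof (intro mult_left_mono C(2))
        show "- (32/\<gamma>) * \<zeta> \<delta> R z powr (1 - \<gamma>) \<le> T R * frechet_derivative (\<zeta> \<delta> R) (at z) (1, 0)"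
          using \<zeta>_deriv(1)[OF R \<delta>, of z] le by linarith
        show "a \<le> 32/\<gamma> * \<zeta> \<delta> R z powr (1 - \<gamma>)" using a le by linarith
      qed (use elim scale_pos[OF R] \<epsilon> \<zeta>[OF R \<delta>] a l in auto)
      finally show ?case .
    qed
    have iP: "integrable (lebesgue_on (K \<delta> R)) (P R \<delta> \<epsilon>)"
    proof (rule Bochner_Integration.integrable_bound)
      show "integrable (lebesgue_on (K \<delta> R)) (\<lambda>z. (C - J z / l) / c)"
        using J(1) integral_const_K by (intro integrable_divide Bochner_Integration.integrable_diff) auto
      show "AE z in lebesgue_on (K \<delta> R). norm (P R \<delta> \<epsilon> z) \<le> norm ((C - J z / l) / c)"
        using bnd
      proof eventually_elim
        case (elim z)
        then have "J z / l \<le> C - c * P R \<delta> \<epsilon> z" using l by (simp add: divide_le_eq mult.commute)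
        then have "P R \<delta> \<epsilon> z \<le> (C - J z / l) / c" using c0 by (simp add: le_divide_eq mult.commute)
        then show ?case using P_nonneg[OF R \<delta>, of \<epsilon> z] by (simp only: real_norm_def abs_of_nonneg)
      qed
    qed (rule P_measurable[OF R \<delta>])
    have "0 \<le> (LINT z|lebesgue_on (K \<delta> R). l * (C - c * P R \<delta> \<epsilon> z))"
      using J(2) by (rule order_trans) (intro integral_mono_AE J bnd integrable_mult_right Bochner_Integration.integrable_diff iP integral_const_K)
    also have "\<dots> = l * (C * measure lebesgue (K \<delta> R) - c * (LINT z|lebesgue_on (K \<delta> R). P R \<delta> \<epsilon> z))"
      using iP integral_const_K[of \<delta> R C] by simp
    finally have "c * (LINT z|lebesgue_on (K \<delta> R). P R \<delta> \<epsilon> z) \<le> C * measure lebesgue (K \<delta> R)"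
      using l by (simp add: zero_le_mult_iff)
    then have "(LINT z|lebesgue_on (K \<delta> R). P R \<delta> \<epsilon> z) \<le> C / c * measure lebesgue (K \<delta> R)"
      using c0 by (simp add: field_simps)
    then have "L R powr (-q) * (LINT z|lebesgue_on (K \<delta> R). P R \<delta> \<epsilon> z) \<le> L R powr (-q) * (C / c * measure lebesgue (K \<delta> R))"
      by (rule mult_left_mono) simp
    also have "\<dots> = C / c * (L R powr (-q) * measure lebesgue (K \<delta> R))" by simp
    also have "\<dots> \<le> C'" unfolding C'_def using volume[OF R \<delta>] C(1) c0 by (intro mult_left_mono) auto
    finally show "L R powr (-q) * (LINT z|lebesgue_on (K \<delta> R). P R \<delta> \<epsilon> z) \<le> C'" .
    show "integrable (lebesgue_on (K \<delta> R)) (P R \<delta> \<epsilon>)" by (rule iP)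
  qed
qed

end

section \<open>The second estimate and the vanishing of the difference\<close>

lemma isCont_bump: "isCont bump x"
proof -
  have "bump = bump_poly 1" by (auto simp: bump_def bump_poly_def)
  then show ?thesis using DERIV_isCont[OF bump_poly_deriv[of 1 x]] by simp
qed

lemma bump_at_top: "(bump \<longlongrightarrow> 1) at_top"
proof -
  have "((\<lambda>x::real. exp (- (1/x))) \<longlongrightarrow> exp (- 0)) at_top"
    by (intro tendsto_exp tendsto_minus tendsto_divide_0[OF tendsto_const] filterlim_at_top_imp_at_infinity filterlim_ident)
  then have "((\<lambda>x::real. exp (- (1/x))) \<longlongrightarrow> 1) at_top" by simp
  then show ?thesis
    by (rule tendsto_cong[THEN iffD1, rotated])
       (auto simp: bump_def intro: eventually_mono[OF eventually_gt_at_top[of 0]])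
qed

context comparison
begin

text \<open>The power of \<open>w\<close> that bounds the source term from below, localised by the cutoff function.\<close>

definition Y :: "real \<Rightarrow> real \<Rightarrow> real \<times> (real ^ 'n) \<Rightarrow> real" where
  "Y \<delta> R z = \<zeta> \<delta> R z * w z powr q"

lemma Y_nonneg: "R \<ge> 1 \<Longrightarrow> \<delta> > 0 \<Longrightarrow> 0 \<le> Y \<delta> R z" using \<zeta> by (simp add: Y_def)

lemma Y_integrable: assumes R: "R \<ge> 1" and \<delta>: "\<delta> > 0" shows "integrable (lebesgue_on (K \<delta> R)) (Y \<delta> R)"
proof (rule Bochner_Integration.integrable_bound)
  show "integrable (lebesgue_on (K \<delta> R)) (\<lambda>z. 2 powr q * h z)"
    by (intro integrable_mult_right h_integrable[OF \<delta>])
  have [measurable]: "w \<in> borel_measurable (lebesgue_on (K \<delta> R))" using w_integrable[OF \<delta>] by auto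
  note [measurable] = \<zeta>_measurable[OF assms sets_K]
  show "Y \<delta> R \<in> borel_measurable (lebesgue_on (K \<delta> R))" unfolding Y_def[abs_def] by measurable
  show "AE z in lebesgue_on (K \<delta> R). norm (Y \<delta> R z) \<le> norm (2 powr q * h z)"
    using AE_K[OF \<delta> source]
  proof eventually_elim
    case (elim z)
    have "Y \<delta> R z \<le> 1 * w z powr q" unfolding Y_def using \<zeta>(2,3)[OF R \<delta>, of z] by (intro mult_right_mono) auto
    also have "\<dots> = 2 powr q * (2 powr (-q) * w z powr q)" by (simp add: powr_minus)
    also have "\<dots> \<le> 2 powr q * h z" using elim by (intro mult_left_mono) auto
    finally show ?case using Y_nonneg[OF R \<delta>, of z] by simp
  qed
qed

text \<open>The integrand obtained by testing the inequality with the cutoff function itself and integrating by parts in time.\<close>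

definition D :: "real \<Rightarrow> real \<Rightarrow> real \<times> (real ^ 'n) \<Rightarrow> real" where
  "D \<delta> R z = - (w z * frechet_derivative (\<zeta> \<delta> R) (at z) (1, 0))
     + (\<Sum>i\<in>UNIV. B z $ i * frechet_derivative (\<zeta> \<delta> R) (at z) (0, axis i 1)) - h z * \<zeta> \<delta> R z"

lemma D_integral: assumes R: "R \<ge> 1" and \<delta>: "\<delta> > 0"
  shows "integrable (lebesgue_on (K \<delta> R)) (D \<delta> R)" "0 \<le> (LINT z|lebesgue_on (K \<delta> R). D \<delta> R z)"
proof -
  have t: "test_fn half_space (\<zeta> \<delta> R)"
    by (rule test_fnI[OF \<zeta>(1)[OF R \<delta>] compact_K K_half_space[OF \<delta>] \<zeta>(4)[OF R \<delta>]])
  note i = test_fn_times_integrable(1)[OF t open_half_space] test_fn_times_integrable(2)[OF t open_half_space]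
  have Lw: "L1_loc half_space w" "L1_loc half_space g0" using dt by (auto simp: weak_deriv_def)
  let ?\<Omega> = "lebesgue_on (half_space :: (real \<times> (real ^ 'n)) set)"
  have i1: "integrable ?\<Omega> (\<lambda>z. g0 z * \<zeta> \<delta> R z)" by (rule i(1)[OF Lw(2)])
  have i2: "integrable ?\<Omega> (\<lambda>z. w z * frechet_derivative (\<zeta> \<delta> R) (at z) (1, 0))"
    by (rule i(2)[OF Lw(1) time_direction_Basis])
  have i3: "integrable ?\<Omega> (\<lambda>z. \<Sum>i\<in>UNIV. B z $ i * frechet_derivative (\<zeta> \<delta> R) (at z) (0, axis i 1))"
    by (intro Bochner_Integration.integrable_sum i(2)[OF B_loc space_direction_Basis])
  have i4: "integrable ?\<Omega> (\<lambda>z. h z * \<zeta> \<delta> R z)" by (rule i(1)[OF h_loc])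
  have wt: "(LINT z|?\<Omega>. w z * frechet_derivative (\<zeta> \<delta> R) (at z) (1, 0)) = - (LINT z|?\<Omega>. g0 z * \<zeta> \<delta> R z)"
    using dt t by (auto simp: weak_deriv_def)
  have "0 \<le> (LINT z|?\<Omega>. g0 z * \<zeta> \<delta> R z
       + (\<Sum>i\<in>UNIV. B z $ i * frechet_derivative (\<zeta> \<delta> R) (at z) (0, axis i 1)) - h z * \<zeta> \<delta> R z)"
    by (rule ineq[OF t \<zeta>(2)[OF R \<delta>]])
  also have "\<dots> = (LINT z|?\<Omega>. g0 z * \<zeta> \<delta> R z)
       + (LINT z|?\<Omega>. (\<Sum>i\<in>UNIV. B z $ i * frechet_derivative (\<zeta> \<delta> R) (at z) (0, axis i 1))) - (LINT z|?\<Omega>. h z * \<zeta> \<delta> R z)"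
    using i1 i3 i4 by simp
  also have "\<dots> = (LINT z|?\<Omega>. D \<delta> R z)"
    unfolding D_def using i2 i3 i4 wt by simp
  finally have nn: "0 \<le> (LINT z|?\<Omega>. D \<delta> R z)" .
  have iD: "integrable ?\<Omega> (D \<delta> R)" unfolding D_def[abs_def] using i2 i3 i4 by simp
  have out: "D \<delta> R z = 0" if "z \<notin> K \<delta> R" for z
    using \<zeta>(4)[OF R \<delta> that] dir_deriv_outside[OF compact_imp_closed[OF compact_K] \<zeta>(4)[OF R \<delta>] that]
    by (simp add: D_def)
  note sh = lebesgue_on_shrink[OF K_half_space[OF \<delta>] sets_K sets_half_space, of R "D \<delta> R"]
  show "integrable (lebesgue_on (K \<delta> R)) (D \<delta> R)" using sh(1) iD out by blast
  show "0 \<le> (LINT z|lebesgue_on (K \<delta> R). D \<delta> R z)" using sh(2) nn out by metis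
qed

lemma D_bound:
  assumes \<mu>: "\<mu> > 0"
  shows "\<exists>C\<ge>0. \<forall>R \<delta> \<epsilon>. 1 \<le> R \<longrightarrow> 0 < \<delta> \<longrightarrow> 0 < \<epsilon> \<longrightarrow> (AE z in lebesgue_on (K \<delta> R).
     D \<delta> R z \<le> L R powr (-q) * (\<mu> * P R \<delta> \<epsilon> z + C * (\<epsilon> powr ((s+1)*(p-1))
        + (lam R z * (\<zeta> \<delta> R z * (L R * w z) powr q)) powr ((s+1)*(p-1)/q)
        + (lam R z * (\<zeta> \<delta> R z * (L R * w z) powr q)) powr (1/q))) - 2 powr (-q) * Y \<delta> R z)"
proof -
  have c: "16/\<gamma> \<ge> 0" using \<gamma> by simp
  obtain C where C: "C \<ge> 0" "\<And>W \<epsilon> z b a1 a2 l. 0 \<le> W \<Longrightarrow> 0 < \<epsilon> \<Longrightarrow> 0 \<le> z \<Longrightarrow> z \<le> 1 \<Longrightarrow> 0 \<le> b \<Longrightarrow> 0 \<le> l \<Longrightarrow> l \<le> 2 \<Longrightarrow>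
     - (16/\<gamma>) * l * z powr (1 - \<gamma>) \<le> a1 \<Longrightarrow> 0 \<le> a2 \<Longrightarrow> a2 \<le> 16/\<gamma> * l * z powr (1 - \<gamma>) \<Longrightarrow>
     - (W * a1) + b * a2 \<le> \<mu> * (b powr (p/(p-1)) * (W + \<epsilon>) powr (-s-1) * z)
        + C * (\<epsilon> powr ((s+1)*(p-1)) + (l * (z * W powr q)) powr ((s+1)*(p-1)/q) + (l * (z * W powr q)) powr (1/q))"
    using pointwise_second[OF p q(1) s(1) s2 c \<mu> \<gamma>(1,4,5)] by blast
  show ?thesis
  proof (intro exI[of _ C] conjI allI impI C(1))
    fix R \<delta> \<epsilon> :: real
    assume R: "1 \<le> R" and \<delta>: "0 < \<delta>" and \<epsilon>: "0 < \<epsilon>"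
    show "AE z in lebesgue_on (K \<delta> R).
     D \<delta> R z \<le> L R powr (-q) * (\<mu> * P R \<delta> \<epsilon> z + C * (\<epsilon> powr ((s+1)*(p-1))
        + (lam R z * (\<zeta> \<delta> R z * (L R * w z) powr q)) powr ((s+1)*(p-1)/q)
        + (lam R z * (\<zeta> \<delta> R z * (L R * w z) powr q)) powr (1/q))) - 2 powr (-q) * Y \<delta> R z"
      using AE_K[OF \<delta> w_nonneg] AE_K[OF \<delta> source]
    proof eventually_elim
      case (elim z)
      define l where "l = L R"
      have l: "l > 0" using scale_pos[OF R] by (simp add: l_def)
      define a1 where "a1 = T R * frechet_derivative (\<zeta> \<delta> R) (at z) (1, 0)"
      define b where "b = norm (B z) / \<beta> R"
      obtain a where a: "0 \<le> a" "a \<le> 16/\<gamma> * lam R z * \<zeta> \<delta> R z powr (1 - \<gamma>)"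
        "R * (\<Sum>i\<in>UNIV. B z $ i * frechet_derivative (\<zeta> \<delta> R) (at z) (0, axis i 1)) \<le> a * norm (B z)"
        using \<zeta>_deriv(2)[OF R \<delta>] by blast
      have 1: "- (w z * frechet_derivative (\<zeta> \<delta> R) (at z) (1, 0)) = l powr (-q) * (- (l * w z * a1))"
      proof -
        have one: "l powr (-q) * (l * l powr (q-1)) = 1" using l by (simp add: powr_minus powr_diff)
        have "l powr (-q) * (- (l * w z * a1)) = - (w z * frechet_derivative (\<zeta> \<delta> R) (at z) (1, 0)) * (l powr (-q) * (l * l powr (q-1)))"
          unfolding a1_def T_eq l_def[symmetric] by simp
        then show ?thesis unfolding one mult_1_right by (rule sym)
      qed
      have "(\<Sum>i\<in>UNIV. B z $ i * frechet_derivative (\<zeta> \<delta> R) (at z) (0, axis i 1)) \<le> a * (norm (B z) / R)"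
        using a(3) R by (simp add: field_simps)
      then have 2: "(\<Sum>i\<in>UNIV. B z $ i * frechet_derivative (\<zeta> \<delta> R) (at z) (0, axis i 1)) \<le> l powr (-q) * (b * a)"
        unfolding norm_B_scale[OF R] by (simp add: b_def l_def mult_ac)
      have 3: "2 powr (-q) * Y \<delta> R z \<le> h z * \<zeta> \<delta> R z"
        using mult_right_mono[OF elim(2) \<zeta>(2)[OF R \<delta>, of z]] by (simp add: Y_def mult_ac)
      have 4: "- (l * w z * a1) + b * a \<le> \<mu> * (b powr (p/(p-1)) * (l * w z + \<epsilon>) powr (-s-1) * \<zeta> \<delta> R z)
        + C * (\<epsilon> powr ((s+1)*(p-1)) + (lam R z * (\<zeta> \<delta> R z * (l * w z) powr q)) powr ((s+1)*(p-1)/q)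
          + (lam R z * (\<zeta> \<delta> R z * (l * w z) powr q)) powr (1/q))"
      proof (rule C(2))
        show "- (16/\<gamma>) * lam R z * \<zeta> \<delta> R z powr (1 - \<gamma>) \<le> a1"
          using \<zeta>_deriv(1)[OF R \<delta>, of z] by (simp add: a1_def)
      qed (use elim \<epsilon> \<zeta>[OF R \<delta>] a l lam scale_pos[OF R] in \<open>auto simp: b_def\<close>)
      have "D \<delta> R z \<le> l powr (-q) * (- (l * w z * a1) + b * a) - 2 powr (-q) * Y \<delta> R z"
        unfolding D_def distrib_left using 1 2 3 by linarith
      also have "\<dots> \<le> l powr (-q) * (\<mu> * (b powr (p/(p-1)) * (l * w z + \<epsilon>) powr (-s-1) * \<zeta> \<delta> R z)
        + C * (\<epsilon> powr ((s+1)*(p-1)) + (lam R z * (\<zeta> \<delta> R z * (l * w z) powr q)) powr ((s+1)*(p-1)/q)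
          + (lam R z * (\<zeta> \<delta> R z * (l * w z) powr q)) powr (1/q))) - 2 powr (-q) * Y \<delta> R z"
        using 4 by (intro diff_right_mono mult_left_mono) auto
      finally show ?case unfolding P_def l_def b_def .
    qed
  qed
qed

lemma Y_scale: assumes "R \<ge> 1" "0 \<le> w z" shows "L R powr (-q) * (\<zeta> \<delta> R z * (L R * w z) powr q) = Y \<delta> R z"
  using scale_pos[OF assms(1)] assms by (simp add: Y_def powr_mult powr_minus)

lemma Y_integral_from_D:
  assumes R: "1 \<le> R" and \<delta>: "0 < \<delta>" and \<epsilon>: "0 < \<epsilon>" "\<epsilon> \<le> 1" and iP: "integrable (lebesgue_on (K \<delta> R)) (P R \<delta> \<epsilon>)"
    and iZ: "integrable (lebesgue_on (K \<delta> R)) Z"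
    and bnd: "AE z in lebesgue_on (K \<delta> R). D \<delta> R z \<le> L R powr (-q) * (\<mu> * P R \<delta> \<epsilon> z + N) + Z z - c * Y \<delta> R z"
    and N: "N \<ge> 0" and \<mu>: "\<mu> \<ge> 0" and C: "L R powr (-q) * (LINT z|lebesgue_on (K \<delta> R). P R \<delta> \<epsilon> z) \<le> C"
  shows "c * (LINT z|lebesgue_on (K \<delta> R). Y \<delta> R z) \<le> \<mu> * C + N * (2 * 4 ^ CARD('n)) + (LINT z|lebesgue_on (K \<delta> R). Z z)"
proof -
  note i = iP iZ Y_integrable[OF R \<delta>] integral_const_K(1)[of \<delta> R N]
  have "0 \<le> (LINT z|lebesgue_on (K \<delta> R). D \<delta> R z)" by (rule D_integral[OF R \<delta>])
  also have "\<dots> \<le> (LINT z|lebesgue_on (K \<delta> R). L R powr (-q) * (\<mu> * P R \<delta> \<epsilon> z + N) + Z z - c * Y \<delta> R z)"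
    using i by (intro integral_mono_AE D_integral[OF R \<delta>] bnd) auto
  also have "\<dots> = L R powr (-q) * (\<mu> * (LINT z|lebesgue_on (K \<delta> R). P R \<delta> \<epsilon> z) + N * measure lebesgue (K \<delta> R))
      + (LINT z|lebesgue_on (K \<delta> R). Z z) - c * (LINT z|lebesgue_on (K \<delta> R). Y \<delta> R z)"
    using i integral_const_K(2)[of \<delta> R N] by simp
  also have "L R powr (-q) * (\<mu> * (LINT z|lebesgue_on (K \<delta> R). P R \<delta> \<epsilon> z) + N * measure lebesgue (K \<delta> R))
     = \<mu> * (L R powr (-q) * (LINT z|lebesgue_on (K \<delta> R). P R \<delta> \<epsilon> z)) + N * (L R powr (-q) * measure lebesgue (K \<delta> R))"
    by (simp add: algebra_simps)
  also have "\<mu> * (L R powr (-q) * (LINT z|lebesgue_on (K \<delta> R). P R \<delta> \<epsilon> z)) \<le> \<mu> * C"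
    using C \<mu> by (rule mult_left_mono)
  also have "N * (L R powr (-q) * measure lebesgue (K \<delta> R)) \<le> N * (2 * 4 ^ CARD('n))"
    using volume[OF R \<delta>] N by (rule mult_left_mono)
  finally show ?thesis by simp
qed

lemma exponents: "0 < (s+1)*(p-1)/q" "(s+1)*(p-1)/q < 1" "0 < 1/q" "1/q < 1" "0 < (s+1)*(p-1)"
  using s s2 p q by auto

text \<open>Half of the source term absorbs all the terms that grow with \<open>w\<close>, up to constants that are uniform in \<open>R\<close> and \<open>\<delta>\<close>.\<close>

lemma Y_bounded: "\<exists>N. \<forall>R \<delta>. 1 \<le> R \<longrightarrow> 0 < \<delta> \<longrightarrow> (LINT z|lebesgue_on (K \<delta> R). Y \<delta> R z) \<le> N"
proof -
  define c2 :: real where "c2 = 2 powr (-q)"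
  have c2: "c2 > 0" by (simp add: c2_def)
  obtain C1 where C1: "C1 \<ge> 0" "\<And>R \<delta> \<epsilon>. 1 \<le> R \<Longrightarrow> 0 < \<delta> \<Longrightarrow> 0 < \<epsilon> \<Longrightarrow> \<epsilon> \<le> 1 \<Longrightarrow>
     integrable (lebesgue_on (K \<delta> R)) (P R \<delta> \<epsilon>) \<and> L R powr (-q) * (LINT z|lebesgue_on (K \<delta> R). P R \<delta> \<epsilon> z) \<le> C1"
    using first_estimate by blast
  obtain C where C: "C \<ge> 0" "\<And>R \<delta> \<epsilon>. 1 \<le> R \<Longrightarrow> 0 < \<delta> \<Longrightarrow> 0 < \<epsilon> \<Longrightarrow> AE z in lebesgue_on (K \<delta> R).
     D \<delta> R z \<le> L R powr (-q) * (1 * P R \<delta> \<epsilon> z + C * (\<epsilon> powr ((s+1)*(p-1))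
        + (lam R z * (\<zeta> \<delta> R z * (L R * w z) powr q)) powr ((s+1)*(p-1)/q)
        + (lam R z * (\<zeta> \<delta> R z * (L R * w z) powr q)) powr (1/q))) - 2 powr (-q) * Y \<delta> R z"
    using D_bound[of 1] by auto
  define \<tau> where "\<tau> = c2 / (8 * (C + 1))"
  have \<tau>: "\<tau> > 0" using c2 C(1) by (simp add: \<tau>_def)
  obtain N1 where N1: "N1 \<ge> 0" "\<And>A. A \<ge> 0 \<Longrightarrow> A powr ((s+1)*(p-1)/q) \<le> N1 + \<tau> * A"
    using powr_absorb_small[OF exponents(1,2) \<tau>] by blast
  obtain N2 where N2: "N2 \<ge> 0" "\<And>A. A \<ge> 0 \<Longrightarrow> A powr (1/q) \<le> N2 + \<tau> * A"
    using powr_absorb_small[OF exponents(3,4) \<tau>] by blast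
  define N where "N = C * (1 + N1 + N2)"
  have N: "N \<ge> 0" using C N1 N2 by (simp add: N_def)
  have "(LINT z|lebesgue_on (K \<delta> R). Y \<delta> R z) \<le> (C1 + N * (2 * 4 ^ CARD('n))) / (c2/2)" if R: "1 \<le> R" and \<delta>: "0 < \<delta>" for R \<delta>
  proof -
    have "AE z in lebesgue_on (K \<delta> R). D \<delta> R z \<le> L R powr (-q) * (1 * P R \<delta> 1 z + N) + 0 - c2/2 * Y \<delta> R z"
      using AE_K[OF \<delta> w_nonneg] C(2)[OF R \<delta>, of 1, OF zero_less_one]
    proof eventually_elim
      case (elim z)
      define y where "y = \<zeta> \<delta> R z * (L R * w z) powr q"
      have y: "y \<ge> 0" using \<zeta>[OF R \<delta>] by (simp add: y_def)
      have ly: "0 \<le> lam R z * y" "lam R z * y \<le> 2 * y" using lam[of R z] y by (auto intro: mult_right_mono)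
      have "(lam R z * y) powr ((s+1)*(p-1)/q) + (lam R z * y) powr (1/q) \<le> N1 + N2 + 4 * \<tau> * y"
        using N1(2)[OF ly(1)] N2(2)[OF ly(1)] mult_left_mono[OF ly(2), of \<tau>] \<tau> by linarith
      then have "C * (1 powr ((s+1)*(p-1)) + (lam R z * y) powr ((s+1)*(p-1)/q) + (lam R z * y) powr (1/q))
        \<le> C * ((1 + N1 + N2) + 4 * \<tau> * y)" using C(1) by (intro mult_left_mono) auto
      also have "\<dots> = N + (4 * C * \<tau>) * y" by (simp add: N_def algebra_simps)
      also have "\<dots> \<le> N + c2/2 * y"
      proof -
        have "4 * C * \<tau> \<le> c2/2" using C(1) c2 by (simp add: \<tau>_def divide_simps mult_left_mono)
        then show ?thesis using y by (intro add_left_mono mult_right_mono) auto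
      qed
      finally have "L R powr (-q) * (1 * P R \<delta> 1 z + C * (1 powr ((s+1)*(p-1)) + (lam R z * y) powr ((s+1)*(p-1)/q) + (lam R z * y) powr (1/q)))
          \<le> L R powr (-q) * (1 * P R \<delta> 1 z + (N + c2/2 * y))" by (intro mult_left_mono add_left_mono) auto
      also have "\<dots> = L R powr (-q) * (1 * P R \<delta> 1 z + N) + c2/2 * (L R powr (-q) * y)" by (simp add: algebra_simps)
      also have "L R powr (-q) * y = Y \<delta> R z" unfolding y_def by (rule Y_scale[OF R elim(1)])
      finally show ?case using elim(2) unfolding y_def[symmetric] c2_def[symmetric] by linarith
    qed
    from Y_integral_from_D[OF R \<delta> _ _ _ _ this N] C1(2)[OF R \<delta>, of 1]
    have "c2/2 * (LINT z|lebesgue_on (K \<delta> R). Y \<delta> R z) \<le> C1 + N * (2 * 4 ^ CARD('n))" by simp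
    then show ?thesis using c2 by (simp add: field_simps)
  qed
  then show ?thesis by blast
qed

lemma lamY_integrable: assumes R: "R \<ge> 1" and \<delta>: "\<delta> > 0"
  shows "integrable (lebesgue_on (K \<delta> R)) (\<lambda>z. lam R z * Y \<delta> R z)"
proof (rule integrable_bounded_mult[where C=2, OF Y_integrable[OF R \<delta>]])
  have "continuous_on UNIV (lam R)" unfolding lam_def cutoff_weight_def cutoff_gauge_def
    using R scale_pos[OF R] by (intro continuous_intros) auto
  then show "lam R \<in> borel_measurable (lebesgue_on (K \<delta> R))"
    by (intro continuous_imp_measurable_on_sets_lebesgue sets_K) (auto intro: continuous_on_subset)
qed (use lam in auto)

text \<open>Here the constants in Young's inequality, and \<open>\<epsilon>\<close>, are chosen so that the part of the bound without the factor \<open>lam\<close> is as small as desired.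
  The price is a large multiple of the integral of \<open>lam * Y\<close>, which still tends to \<open>0\<close> once \<open>w powr q\<close> is
  known to be integrable.\<close>

lemma Y_small:
  assumes \<eta>: "\<eta> > 0"
  shows "\<exists>M\<ge>0. \<forall>R \<delta>. 1 \<le> R \<longrightarrow> 0 < \<delta> \<longrightarrow>
    (LINT z|lebesgue_on (K \<delta> R). Y \<delta> R z) \<le> \<eta> + M * (LINT z|lebesgue_on (K \<delta> R). lam R z * Y \<delta> R z)"
proof -
  define c2 :: real where "c2 = 2 powr (-q)"
  have c2: "c2 > 0" by (simp add: c2_def)
  obtain C1 where C1: "C1 \<ge> 0" "\<And>R \<delta> \<epsilon>. 1 \<le> R \<Longrightarrow> 0 < \<delta> \<Longrightarrow> 0 < \<epsilon> \<Longrightarrow> \<epsilon> \<le> 1 \<Longrightarrow>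
     integrable (lebesgue_on (K \<delta> R)) (P R \<delta> \<epsilon>) \<and> L R powr (-q) * (LINT z|lebesgue_on (K \<delta> R). P R \<delta> \<epsilon> z) \<le> C1"
    using first_estimate by blast
  define \<mu> where "\<mu> = c2 * \<eta> / (2 * (C1 + 1))"
  have \<mu>: "\<mu> > 0" "\<mu> * C1 \<le> c2 * \<eta> / 2" using c2 \<eta> C1(1) by (simp_all add: \<mu>_def divide_simps mult_left_mono)
  obtain C where C: "C \<ge> 0" "\<And>R \<delta> \<epsilon>. 1 \<le> R \<Longrightarrow> 0 < \<delta> \<Longrightarrow> 0 < \<epsilon> \<Longrightarrow> AE z in lebesgue_on (K \<delta> R).
     D \<delta> R z \<le> L R powr (-q) * (\<mu> * P R \<delta> \<epsilon> z + C * (\<epsilon> powr ((s+1)*(p-1))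
        + (lam R z * (\<zeta> \<delta> R z * (L R * w z) powr q)) powr ((s+1)*(p-1)/q)
        + (lam R z * (\<zeta> \<delta> R z * (L R * w z) powr q)) powr (1/q))) - 2 powr (-q) * Y \<delta> R z"
    using D_bound[OF \<mu>(1)] by auto
  define V0 :: real where "V0 = 2 * 4 ^ CARD('n)"
  have V0: "V0 > 0" by (simp add: V0_def)
  define \<nu> where "\<nu> = c2 * \<eta> / (6 * V0 * (C + 1))"
  have \<nu>: "\<nu> > 0" using c2 \<eta> C(1) V0 by (simp add: \<nu>_def)
  have \<nu>2: "3 * C * \<nu> * V0 \<le> c2 * \<eta> / 2"
    using c2 \<eta> C(1) V0 by (simp add: \<nu>_def divide_simps mult_left_mono)
  define \<epsilon> where "\<epsilon> = min 1 (\<nu> powr (1 / ((s+1)*(p-1))))"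
  have \<epsilon>: "0 < \<epsilon>" "\<epsilon> \<le> 1" using \<nu> by (auto simp: \<epsilon>_def)
  have \<epsilon>2: "\<epsilon> powr ((s+1)*(p-1)) \<le> \<nu>"
  proof -
    have "\<epsilon> powr ((s+1)*(p-1)) \<le> (\<nu> powr (1 / ((s+1)*(p-1)))) powr ((s+1)*(p-1))"
      using exponents(5) \<epsilon> by (intro powr_mono2) (auto simp: \<epsilon>_def)
    also have "\<dots> = \<nu>" using \<nu> s(1) p(1) by (simp add: powr_powr)
    finally show ?thesis .
  qed
  obtain M1 where M1: "M1 \<ge> 0" "\<And>A. A \<ge> 0 \<Longrightarrow> A powr ((s+1)*(p-1)/q) \<le> \<nu> + M1 * A"
    using powr_absorb_large[OF exponents(1,2) \<nu>] by blast
  obtain M2 where M2: "M2 \<ge> 0" "\<And>A. A \<ge> 0 \<Longrightarrow> A powr (1/q) \<le> \<nu> + M2 * A"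
    using powr_absorb_large[OF exponents(3,4) \<nu>] by blast
  define M where "M = C * (M1 + M2)"
  have M: "M \<ge> 0" using C M1 M2 by (simp add: M_def)
  have "(LINT z|lebesgue_on (K \<delta> R). Y \<delta> R z) \<le> \<eta> + M / c2 * (LINT z|lebesgue_on (K \<delta> R). lam R z * Y \<delta> R z)"
    if R: "1 \<le> R" and \<delta>: "0 < \<delta>" for R \<delta>
  proof -
    have bnd: "AE z in lebesgue_on (K \<delta> R). D \<delta> R z \<le> L R powr (-q) * (\<mu> * P R \<delta> \<epsilon> z + 3 * C * \<nu>)
        + M * (lam R z * Y \<delta> R z) - c2 * Y \<delta> R z"
      using AE_K[OF \<delta> w_nonneg] C(2)[OF R \<delta> \<epsilon>(1)]
    proof eventually_elim
      case (elim z)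
      define y where "y = \<zeta> \<delta> R z * (L R * w z) powr q"
      have y: "y \<ge> 0" using \<zeta>[OF R \<delta>] by (simp add: y_def)
      have ly: "0 \<le> lam R z * y" using lam[of R z] y by auto
      have "\<epsilon> powr ((s+1)*(p-1)) + (lam R z * y) powr ((s+1)*(p-1)/q) + (lam R z * y) powr (1/q)
         \<le> 3 * \<nu> + (M1 + M2) * (lam R z * y)"
        using M1(2)[OF ly] M2(2)[OF ly] \<epsilon>2 unfolding distrib_right by linarith
      then have "C * (\<epsilon> powr ((s+1)*(p-1)) + (lam R z * y) powr ((s+1)*(p-1)/q) + (lam R z * y) powr (1/q))
        \<le> C * (3 * \<nu> + (M1 + M2) * (lam R z * y))" using C(1) by (intro mult_left_mono) auto
      also have "\<dots> = 3 * C * \<nu> + M * (lam R z * y)" by (simp add: M_def algebra_simps)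
      finally have "L R powr (-q) * (\<mu> * P R \<delta> \<epsilon> z + C * (\<epsilon> powr ((s+1)*(p-1)) + (lam R z * y) powr ((s+1)*(p-1)/q) + (lam R z * y) powr (1/q)))
          \<le> L R powr (-q) * (\<mu> * P R \<delta> \<epsilon> z + (3 * C * \<nu> + M * (lam R z * y)))" by (intro mult_left_mono add_left_mono) auto
      also have "\<dots> = L R powr (-q) * (\<mu> * P R \<delta> \<epsilon> z + 3 * C * \<nu>) + M * (lam R z * (L R powr (-q) * y))" by (simp add: algebra_simps)
      also have "L R powr (-q) * y = Y \<delta> R z" unfolding y_def by (rule Y_scale[OF R elim(1)])
      finally show ?case using elim(2) unfolding y_def[symmetric] c2_def[symmetric] by linarith
    qed
    have CP: "integrable (lebesgue_on (K \<delta> R)) (P R \<delta> \<epsilon>)" "L R powr (-q) * (LINT z|lebesgue_on (K \<delta> R). P R \<delta> \<epsilon> z) \<le> C1"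
      using C1(2)[OF R \<delta> \<epsilon>] by auto
    have "c2 * (LINT z|lebesgue_on (K \<delta> R). Y \<delta> R z) \<le> \<mu> * C1 + 3 * C * \<nu> * (2 * 4 ^ CARD('n))
        + (LINT z|lebesgue_on (K \<delta> R). M * (lam R z * Y \<delta> R z))"
      by (rule Y_integral_from_D[OF R \<delta> \<epsilon> CP(1) _ bnd _ _ CP(2)])
         (use lamY_integrable[OF R \<delta>] C(1) \<nu> \<mu> in auto)
    also have "\<dots> \<le> c2 * \<eta> + M * (LINT z|lebesgue_on (K \<delta> R). lam R z * Y \<delta> R z)"
      using \<mu>(2) \<nu>2 unfolding V0_def by simp
    finally show ?thesis using c2 by (simp add: field_simps)
  qed
  then show ?thesis using M c2 by (intro exI[of _ "M / c2"]) auto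
qed

text \<open>The scales \<open>R \<rightarrow> \<infinity>\<close> and \<open>\<delta> \<rightarrow> 0\<close> along which the limit is taken; the shift by one keeps both of them positive.\<close>

definition Rk :: "nat \<Rightarrow> real" where "Rk k = real (Suc k)"
definition \<delta>k :: "nat \<Rightarrow> real" where "\<delta>k k = 1 / real (Suc k)"

lemma Rk: "1 \<le> Rk k" and \<delta>k: "0 < \<delta>k k" by (auto simp: Rk_def \<delta>k_def)

lemma Rk_at_top: "filterlim Rk at_top sequentially"
  unfolding Rk_def by (rule filterlim_compose[OF filterlim_real_sequentially filterlim_Suc])

lemma gauge_tendsto: "(\<lambda>k. cutoff_gauge (T (Rk k)) (Rk k) z) \<longlonglongrightarrow> 0"
proof -
  have neg: "(\<lambda>k. Rk k powr (- a)) \<longlonglongrightarrow> 0" if "a > 0" for a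
    by (rule tendsto_neg_powr[OF _ Rk_at_top]) (use that in auto)
  have T: "(\<lambda>k. fst z * Rk k powr (- (\<kappa> * (q-1)))) \<longlonglongrightarrow> 0"
    by (rule tendsto_mult_right_zero[OF neg]) (use \<kappa>_pos q in simp)
  have "(\<lambda>k. (fst z * Rk k powr (- (\<kappa> * (q-1))))\<^sup>2 + (snd z \<bullet> snd z) * Rk k powr (- 2)) \<longlonglongrightarrow> 0\<^sup>2 + (snd z \<bullet> snd z) * 0"
    by (intro tendsto_add tendsto_power tendsto_mult tendsto_const T neg) auto
  moreover have "(fst z * Rk k powr (- (\<kappa> * (q-1))))\<^sup>2 + (snd z \<bullet> snd z) * Rk k powr (- 2)
     = cutoff_gauge (T (Rk k)) (Rk k) z" for k
    using Rk[of k] by (simp add: cutoff_gauge_def T_def powr_minus powr_numeral divide_inverse)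
  ultimately show ?thesis by simp
qed

lemma lam_tendsto: "(\<lambda>k. lam (Rk k) z) \<longlonglongrightarrow> 0"
proof -
  have "(\<lambda>k. min 2 (sqrt (cutoff_gauge (T (Rk k)) (Rk k) z))) \<longlonglongrightarrow> min 2 (sqrt 0)"
    by (intro tendsto_min tendsto_const tendsto_real_sqrt gauge_tendsto)
  then show ?thesis by (simp add: lam_def cutoff_weight_def)
qed

lemma \<zeta>_tendsto: assumes "z \<in> half_space" shows "(\<lambda>k. \<zeta> (\<delta>k k) (Rk k) z) \<longlonglongrightarrow> bump (\<gamma> * 2)"
proof -
  have t: "fst z > 0" using assms by (auto simp: half_space_def)
  have "filterlim (\<lambda>k. (\<gamma> * fst z) * Rk k) at_top sequentially"
    by (rule filterlim_tendsto_pos_mult_at_top[OF tendsto_const _ Rk_at_top]) (use \<gamma> t in simp)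
  from filterlim_tendsto_add_at_top[OF tendsto_const[of "- \<gamma>"] this]
  have "filterlim (\<lambda>k. - \<gamma> + (\<gamma> * fst z) * Rk k) at_top sequentially" .
  from filterlim_compose[OF bump_at_top this]
  have 1: "(\<lambda>k. bump (- \<gamma> + (\<gamma> * fst z) * Rk k)) \<longlonglongrightarrow> 1" .
  have "(\<lambda>k. \<gamma> * (2 - cutoff_gauge (T (Rk k)) (Rk k) z)) \<longlonglongrightarrow> \<gamma> * (2 - 0)"
    by (intro tendsto_mult tendsto_diff tendsto_const gauge_tendsto)
  then have 2: "(\<lambda>k. bump (\<gamma> * (2 - cutoff_gauge (T (Rk k)) (Rk k) z))) \<longlonglongrightarrow> bump (\<gamma> * (2 - 0))"
    by (rule isCont_tendsto_compose[OF isCont_bump])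
  have "- \<gamma> + (\<gamma> * fst z) * Rk k = \<gamma> * (fst z / \<delta>k k - 1)" for k
    by (simp add: Rk_def \<delta>k_def algebra_simps)
  then show ?thesis using tendsto_mult[OF 1 2] by (simp add: \<zeta>_def cutoff_def)
qed

lemma difference_zero: "AE z in lebesgue_on half_space. w z = 0"
proof -
  let ?\<Omega> = "lebesgue_on (half_space :: (real \<times> (real ^ 'n)) set)"
  define F where "F k = Y (\<delta>k k) (Rk k)" for k
  define c where "c = bump (\<gamma> * 2)"
  define F0 where "F0 z = c * w z powr q" for z
  have c: "c > 0" using \<gamma> by (simp add: c_def bump_def)
  have out: "F k z = 0" if "z \<notin> K (\<delta>k k) (Rk k)" for k z
    using \<zeta>(4)[OF Rk \<delta>k that] by (simp add: F_def Y_def)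
  note sh = lebesgue_on_shrink[OF K_half_space[OF \<delta>k] sets_K sets_half_space]
  have iF: "integrable ?\<Omega> (F k)" for k
    using sh(1)[of k "Rk k" "F k"] out Y_integrable[OF Rk \<delta>k] unfolding F_def by blast
  have eF: "(LINT z|?\<Omega>. F k z) = (LINT z|lebesgue_on (K (\<delta>k k) (Rk k)). Y (\<delta>k k) (Rk k) z)" for k
    using sh(2)[of k "Rk k" "F k"] out unfolding F_def by blast
  have eL: "(LINT z|?\<Omega>. lam (Rk k) z * F k z) = (LINT z|lebesgue_on (K (\<delta>k k) (Rk k)). lam (Rk k) z * Y (\<delta>k k) (Rk k) z)"
    and iL: "integrable ?\<Omega> (\<lambda>z. lam (Rk k) z * F k z)" for k
    using sh[of k "Rk k" "\<lambda>z. lam (Rk k) z * F k z"] out lamY_integrable[OF Rk \<delta>k] unfolding F_def by auto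
  have Fnn: "0 \<le> F k z" for k z unfolding F_def by (rule Y_nonneg[OF Rk \<delta>k])
  have Fle: "F k z \<le> w z powr q" for k z
    unfolding F_def Y_def using \<zeta>(2,3)[OF Rk \<delta>k] by (simp add: mult_left_le_one_le)
  have lim: "(\<lambda>k. F k z) \<longlonglongrightarrow> F0 z" if "z \<in> half_space" for z
    unfolding F_def Y_def F0_def c_def by (intro tendsto_mult \<zeta>_tendsto[OF that] tendsto_const)
  have mF[measurable]: "F k \<in> borel_measurable ?\<Omega>" for k using iF by auto
  have mF0: "F0 \<in> borel_measurable ?\<Omega>"
    by (rule borel_measurable_LIMSEQ_real[OF _ mF]) (use lim in auto)
  obtain N where N: "\<And>k. (LINT z|?\<Omega>. F k z) \<le> N"
    using Y_bounded Rk \<delta>k unfolding eF by blast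
  \<comment> \<open>Fatou's lemma: \<open>w powr q\<close> is integrable over the whole half-space.\<close>
  have "(\<integral>\<^sup>+z. ennreal (F0 z) \<partial>?\<Omega>) = (\<integral>\<^sup>+z. liminf (\<lambda>k. ennreal (F k z)) \<partial>?\<Omega>)"
  proof (rule nn_integral_cong)
    fix z assume "z \<in> space ?\<Omega>"
    then have "(\<lambda>k. ennreal (F k z)) \<longlonglongrightarrow> ennreal (F0 z)" using lim by (intro tendsto_ennrealI) auto
    then show "ennreal (F0 z) = liminf (\<lambda>k. ennreal (F k z))" by (simp add: lim_imp_Liminf)
  qed
  also have "\<dots> \<le> liminf (\<lambda>k. \<integral>\<^sup>+z. ennreal (F k z) \<partial>?\<Omega>)" by (rule nn_integral_liminf) measurable
  also have "\<dots> \<le> liminf (\<lambda>k. ennreal N)"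
    using N Fnn iF by (intro Liminf_mono always_eventually allI) (simp add: nn_integral_eq_integral ennreal_leI)
  also have "\<dots> < \<infinity>" by (simp add: Liminf_const)
  finally have iF0: "integrable ?\<Omega> F0"
    using mF0 c by (intro integrableI_nonneg) (auto simp: F0_def)
  have iw: "integrable ?\<Omega> (\<lambda>z. w z powr q)"
    using integrable_mult_right[OF iF0, of "1/c"] c by (simp add: F0_def)
  have cF: "(\<lambda>k. LINT z|?\<Omega>. F k z) \<longlonglongrightarrow> (LINT z|?\<Omega>. F0 z)"
    by (rule integral_dominated_convergence[where w="\<lambda>z. w z powr q"])
       (use mF0 iw lim Fnn Fle in \<open>auto intro!: AE_I2\<close>)
  have cL: "(\<lambda>k. LINT z|?\<Omega>. lam (Rk k) z * F k z) \<longlonglongrightarrow> (LINT z|?\<Omega>. 0)"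
  proof (rule integral_dominated_convergence[where w="\<lambda>z. 2 * w z powr q"])
    show "AE z in ?\<Omega>. (\<lambda>k. lam (Rk k) z * F k z) \<longlonglongrightarrow> 0"
      using tendsto_mult[OF lam_tendsto lim] by (intro AE_I2) auto
    show "AE z in ?\<Omega>. norm (lam (Rk k) z * F k z) \<le> 2 * w z powr q" for k
      using lam Fnn Fle by (intro AE_I2) (auto simp: abs_mult intro!: mult_mono)
  qed (use iL iw in auto)
  have le: "(LINT z|?\<Omega>. F0 z) \<le> \<eta>" if \<eta>: "\<eta> > 0" for \<eta>
  proof -
    obtain M where M: "\<And>k. (LINT z|?\<Omega>. F k z) \<le> \<eta> + M * (LINT z|?\<Omega>. lam (Rk k) z * F k z)"
      using Y_small[OF \<eta>] Rk \<delta>k unfolding eF eL by blast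
    have "(\<lambda>k. \<eta> + M * (LINT z|?\<Omega>. lam (Rk k) z * F k z)) \<longlonglongrightarrow> \<eta> + M * (LINT z|?\<Omega>. 0)"
      by (intro tendsto_add tendsto_mult tendsto_const cL)
    then have "(\<lambda>k. \<eta> + M * (LINT z|?\<Omega>. lam (Rk k) z * F k z)) \<longlonglongrightarrow> \<eta>" by simp
    then show ?thesis using M by (intro LIMSEQ_le[OF cF]) auto
  qed
  have F0nn: "0 \<le> F0 z" for z using c by (simp add: F0_def)
  have "(LINT z|?\<Omega>. F0 z) \<le> 0" by (rule field_le_epsilon) (use le in simp)
  moreover have "0 \<le> (LINT z|?\<Omega>. F0 z)" using F0nn by simp
  ultimately have "(LINT z|?\<Omega>. F0 z) = 0" by linarith
  then have "AE z in ?\<Omega>. F0 z = 0"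
    using integral_nonneg_eq_0_iff_AE[OF iF0] F0nn by simp
  then show ?thesis
    by eventually_elim (use c in \<open>simp add: F0_def\<close>)
qed

end

section \<open>Reduction to the difference of the two solutions\<close>

lemma L1_loc_measurable: "L1_loc \<Omega> f \<Longrightarrow> compact C \<Longrightarrow> C \<subseteq> \<Omega> \<Longrightarrow> f \<in> borel_measurable (lebesgue_on C)"
  unfolding L1_loc_def using borel_measurable_integrable by blast

lemma L1_loc_bound:
  assumes "L1_loc \<Omega> g" "\<And>C. compact C \<Longrightarrow> C \<subseteq> \<Omega> \<Longrightarrow> f \<in> borel_measurable (lebesgue_on C)" "\<And>z. \<bar>f z\<bar> \<le> g z"
  shows "L1_loc \<Omega> f"
  unfolding L1_loc_def
proof (intro allI impI)
  fix C assume C: "compact C \<and> C \<subseteq> \<Omega>"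
  show "integrable (lebesgue_on C) f"
  proof (rule Bochner_Integration.integrable_bound)
    show "integrable (lebesgue_on C) g" using assms(1) C by (auto simp: L1_loc_def)
    show "f \<in> borel_measurable (lebesgue_on C)" using assms(2) C by blast
    show "AE z in lebesgue_on C. norm (f z) \<le> norm (g z)"
      using order_trans[OF assms(3) abs_ge_self] by (intro AE_I2) simp
  qed
qed

lemma L1_loc_const: "L1_loc \<Omega> (\<lambda>z::'a::euclidean_space. c)"
  by (simp add: L1_loc_def integrable_const_compact)

lemma L1_loc_cmult: "L1_loc \<Omega> f \<Longrightarrow> L1_loc \<Omega> (\<lambda>z. c * f z)"
  by (auto simp: L1_loc_def)

lemma norm_vec_measurable:
  assumes "\<And>i. (\<lambda>z. G z $ i) \<in> borel_measurable M"
  shows "(\<lambda>z. norm (G z :: real ^ 'n)) \<in> borel_measurable M"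
proof -
  note [measurable] = assms
  show ?thesis unfolding norm_vec_def L2_set_def by measurable
qed

lemma norm_flux: "1 < p \<Longrightarrow> norm (norm x powr (p - 2) *\<^sub>R x) = norm x powr (p - 1)"
  for x :: "'a::real_normed_vector"
proof (cases "x = 0")
  case False
  then have "norm x powr (p - 2) * norm x powr 1 = norm x powr (p - 1)" by (simp only: powr_add[symmetric]) simp
  then show ?thesis using False by simp
qed simp

lemma flux_L1_loc:
  fixes G :: "'a::euclidean_space \<Rightarrow> real ^ 'n"
  assumes p: "1 < p" and G: "\<And>i. L1_loc \<Omega> (\<lambda>z. G z $ i)" "L1_loc \<Omega> (\<lambda>z. norm (G z) powr p)"
  shows "L1_loc \<Omega> (\<lambda>z. norm (G z) powr (p - 2) * G z $ i)"
proof (rule L1_loc_bound[OF L1_loc_add[OF L1_loc_const[of \<Omega> 1] G(2)]])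
  fix C :: "'a set" assume C: "compact C" "C \<subseteq> \<Omega>"
  note [measurable] = L1_loc_measurable[OF G(1) C] norm_vec_measurable[OF L1_loc_measurable[OF G(1) C]]
  show "(\<lambda>z. norm (G z) powr (p - 2) * G z $ i) \<in> borel_measurable (lebesgue_on C)" by measurable
next
  fix z
  have "\<bar>norm (G z) powr (p - 2) * G z $ i\<bar> \<le> norm (norm (G z) powr (p - 2) *\<^sub>R G z)"
    using component_le_norm_cart[of "norm (G z) powr (p - 2) *\<^sub>R G z" i] by simp
  also have "\<dots> = norm (G z) powr (p - 1)" by (rule norm_flux[OF p])
  also have "\<dots> \<le> 1 + norm (G z) powr p"
  proof (cases "norm (G z) \<le> 1")
    case True
    then have "norm (G z) powr (p - 1) \<le> 1" using p by (intro powr_le1) auto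
    then show ?thesis by (simp add: add_increasing2)
  next
    case False
    then have "norm (G z) powr (p - 1) \<le> norm (G z) powr p" by (intro powr_mono) auto
    then show ?thesis by simp
  qed
  finally show "\<bar>norm (G z) powr (p - 2) * G z $ i\<bar> \<le> 1 + norm (G z) powr p" .
qed

lemma source_L1_loc:
  fixes u :: "'a::euclidean_space \<Rightarrow> real"
  assumes "L1_loc \<Omega> u" "L1_loc \<Omega> (\<lambda>z. \<bar>u z\<bar> powr q)"
  shows "L1_loc \<Omega> (\<lambda>z. \<bar>u z\<bar> powr (q - 1) * u z)"
proof (rule L1_loc_bound[OF assms(2)])
  fix C :: "'a set" assume C: "compact C" "C \<subseteq> \<Omega>"
  note [measurable] = L1_loc_measurable[OF assms(1) C]
  show "(\<lambda>z. \<bar>u z\<bar> powr (q - 1) * u z) \<in> borel_measurable (lebesgue_on C)" by measurable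
next
  fix z show "\<bar>\<bar>u z\<bar> powr (q - 1) * u z\<bar> \<le> \<bar>u z\<bar> powr q"
    by (cases "u z = 0") (simp_all add: abs_mult powr_diff)
qed

lemma sum_power_L1_loc:
  fixes X :: "'a::euclidean_space \<Rightarrow> real ^ 'n" and a b :: "'a \<Rightarrow> real"
  assumes X: "\<And>i. L1_loc \<Omega> (\<lambda>z. X z $ i)" and ab: "L1_loc \<Omega> (\<lambda>z. a z powr r)" "L1_loc \<Omega> (\<lambda>z. b z powr r)"
    and nn: "\<And>z. 0 \<le> a z" "\<And>z. 0 \<le> b z" and r: "0 \<le> r" and le: "\<And>z. norm (X z) \<le> a z + b z"
  shows "L1_loc \<Omega> (\<lambda>z. \<bar>X z $ i\<bar> powr r)"
proof (rule L1_loc_bound[OF L1_loc_cmult[OF L1_loc_add[OF ab], of "2 powr r"]])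
  fix C :: "'a set" assume C: "compact C" "C \<subseteq> \<Omega>"
  note [measurable] = L1_loc_measurable[OF X C]
  show "(\<lambda>z. \<bar>X z $ i\<bar> powr r) \<in> borel_measurable (lebesgue_on C)" by measurable
next
  fix z
  have "\<bar>X z $ i\<bar> powr r \<le> (a z + b z) powr r"
    using component_le_norm_cart[of "X z" i] le[of z] r by (intro powr_mono2) auto
  also have "\<dots> \<le> 2 powr r * (a z powr r + b z powr r)" by (rule powr_sum_le[OF nn r])
  finally show "\<bar>\<bar>X z $ i\<bar> powr r\<bar> \<le> 2 powr r * (a z powr r + b z powr r)" by simp
qed

lemma test_inequality_integrable:
  fixes G :: "real \<times> (real ^ 'n) \<Rightarrow> real ^ 'n"
  assumes "test_fn half_space \<phi>" "L1_loc half_space f" "\<And>i. L1_loc half_space (A i)" "L1_loc half_space g"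
  shows "integrable (lebesgue_on half_space) (\<lambda>z. f z * \<phi> z
     + (\<Sum>i\<in>UNIV. A i z * frechet_derivative \<phi> (at z) (0, axis i 1)) - g z * \<phi> (z :: real \<times> (real ^ 'n)))"
  by (intro Bochner_Integration.integrable_diff Bochner_Integration.integrable_add Bochner_Integration.integrable_sum
      test_fn_times_integrable[OF assms(1) open_half_space] assms space_direction_Basis)

theorem theorem1:
  fixes p q :: real
    and u v :: "real \<times> (real ^ 'n) \<Rightarrow> real"
  assumes "1 < p" and "p \<le> 2"
    and "1 < q" and "q \<le> p - 1 + p / real CARD('n)"
    and "weak_super_solution p q u"
    and "weak_sub_solution p q v"
    and "AE z in lebesgue_on half_space. v z \<le> u z"
  shows "AE z in lebesgue_on half_space. u z = v z"
proof -
  let ?\<Omega> = "lebesgue_on (half_space :: (real \<times> (real ^ 'n)) set)"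
  define F where "F x = norm x powr (p - 2) *\<^sub>R x" for x :: "real ^ 'n"
  define g where "g x = \<bar>x\<bar> powr (q - 1) * x" for x :: real
  \<comment> \<open>With \<open>v' = - v\<close> both hypotheses speak of super-solutions, and differences become sums.\<close>
  define v' where "v' z = - v z" for z
  note super = assms(5)[unfolded weak_super_solution_def]
    and sub = assms(6)[unfolded weak_sub_solution_def weak_super_solution_def, folded v'_def]
  obtain ut Gu where u: "Lq_loc q half_space u" "weak_deriv half_space (1, 0) u ut"
    "\<And>i. weak_deriv half_space (0, axis i 1) u (\<lambda>z. Gu z $ i)"
    "L1_loc half_space (\<lambda>z. norm (Gu z) powr p)"
    "\<And>\<phi>. test_fn half_space \<phi> \<Longrightarrow> (\<And>z. z \<in> half_space \<Longrightarrow> 0 \<le> \<phi> z) \<Longrightarrow>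
          0 \<le> (LINT z|?\<Omega>. ut z * \<phi> z + (\<Sum>i\<in>UNIV. F (Gu z) $ i * frechet_derivative \<phi> (at z) (0, axis i 1)) - g (u z) * \<phi> z)"
    using super unfolding F_def g_def vector_scaleR_component real_scaleR_def by blast
  obtain vt Gv where v: "Lq_loc q half_space v'" "weak_deriv half_space (1, 0) v' vt"
    "\<And>i. weak_deriv half_space (0, axis i 1) v' (\<lambda>z. Gv z $ i)"
    "L1_loc half_space (\<lambda>z. norm (Gv z) powr p)"
    "\<And>\<phi>. test_fn half_space \<phi> \<Longrightarrow> (\<And>z. z \<in> half_space \<Longrightarrow> 0 \<le> \<phi> z) \<Longrightarrow>
          0 \<le> (LINT z|?\<Omega>. vt z * \<phi> z + (\<Sum>i\<in>UNIV. F (Gv z) $ i * frechet_derivative \<phi> (at z) (0, axis i 1)) - g (v' z) * \<phi> z)"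
    using sub unfolding F_def g_def vector_scaleR_component real_scaleR_def by blast
  have Lu: "L1_loc half_space u" "L1_loc half_space ut" "L1_loc half_space (\<lambda>z. Gu z $ i)"
    and Lv: "L1_loc half_space v'" "L1_loc half_space vt" "L1_loc half_space (\<lambda>z. Gv z $ i)" for i
    using u(2,3) v(2,3) by (auto simp: weak_deriv_def)
  have FG: "L1_loc half_space (\<lambda>z. F (Gu z) $ i)" "L1_loc half_space (\<lambda>z. F (Gv z) $ i)" for i
    using flux_L1_loc[OF assms(1) Lu(3) u(4)] flux_L1_loc[OF assms(1) Lv(3) v(4)] by (simp_all add: F_def)
  have gL: "L1_loc half_space (\<lambda>z. g (u z))" "L1_loc half_space (\<lambda>z. g (v' z))"
    unfolding g_def using source_L1_loc Lu(1) Lv(1) u(1) v(1) by (auto simp: Lq_loc_def)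
  have p': "norm (F x) powr (p/(p-1)) = norm x powr p" for x
    unfolding F_def norm_flux[OF assms(1)] using assms(1) by (simp add: powr_powr)
  have Fodd: "F x + F y = F x - F (- y)" for x y by (simp add: F_def)
  define B where "B z = F (Gu z) + F (Gv z)" for z
  define G where "G z = Gu z + Gv z" for z
  interpret comparison p q "\<lambda>z. u z + v' z" "\<lambda>z. ut z + vt z" "\<lambda>z. g (u z) + g (v' z)" G B
  proof
    show w: "AE z in ?\<Omega>. 0 \<le> u z + v' z"
      using assms(7) by eventually_elim (simp add: v'_def)
    show "weak_deriv half_space (1, 0) (\<lambda>z. u z + v' z) (\<lambda>z. ut z + vt z)"
      by (rule weak_deriv_add[OF u(2) v(2) open_half_space time_direction_Basis])
    show "weak_deriv half_space (0, axis i 1) (\<lambda>z. u z + v' z) (\<lambda>z. G z $ i)" for i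
      unfolding G_def vector_add_component
      by (rule weak_deriv_add[OF u(3) v(3) open_half_space space_direction_Basis])
    show "L1_loc half_space (\<lambda>z. g (u z) + g (v' z))" by (rule L1_loc_add[OF gL])
    show BL: "L1_loc half_space (\<lambda>z. B z $ i)" for i
      unfolding B_def vector_add_component by (rule L1_loc_add[OF FG])
    show "L1_loc half_space (\<lambda>z. \<bar>B z $ i\<bar> powr (p/(p-1)))" for i
      by (rule sum_power_L1_loc[where a="\<lambda>z. norm (F (Gu z))" and b="\<lambda>z. norm (F (Gv z))", OF BL])
         (use u(4) v(4) assms(1) in \<open>auto simp: p' B_def norm_triangle_ineq\<close>)
    have GL: "L1_loc half_space (\<lambda>z. G z $ i)" for i
      unfolding G_def vector_add_component by (rule L1_loc_add[OF Lu(3) Lv(3)])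
    show "L1_loc half_space (\<lambda>z. \<bar>G z $ i\<bar> powr p)" for i
      by (rule sum_power_L1_loc[where a="\<lambda>z. norm (Gu z)" and b="\<lambda>z. norm (Gv z)", OF GL u(4) v(4)])
         (use assms(1) in \<open>auto simp: G_def norm_triangle_ineq\<close>)
    show "2 powr (1 - p/(p-1)) * norm (B z) powr (p/(p-1)) \<le> B z \<bullet> G z" for z
      using flux_monotone[OF assms(1,2), of "Gu z" "- Gv z", folded F_def] by (simp add: B_def G_def Fodd)
    show "AE z in ?\<Omega>. 2 powr (-q) * (u z + v' z) powr q \<le> g (u z) + g (v' z)"
      using w by eventually_elim (use source_monotone[OF assms(3)] in \<open>simp add: g_def\<close>)
    fix \<phi> :: "real \<times> (real ^ 'n) \<Rightarrow> real"
    assume \<phi>: "test_fn half_space \<phi>" "\<And>z. z \<in> half_space \<Longrightarrow> 0 \<le> \<phi> z"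
    have "0 \<le> (LINT z|?\<Omega>. ut z * \<phi> z + (\<Sum>i\<in>UNIV. F (Gu z) $ i * frechet_derivative \<phi> (at z) (0, axis i 1)) - g (u z) * \<phi> z)
       + (LINT z|?\<Omega>. vt z * \<phi> z + (\<Sum>i\<in>UNIV. F (Gv z) $ i * frechet_derivative \<phi> (at z) (0, axis i 1)) - g (v' z) * \<phi> z)"
      by (intro add_nonneg_nonneg u(5) v(5) \<phi>)
    also have "\<dots> = (LINT z|?\<Omega>. (ut z * \<phi> z + (\<Sum>i\<in>UNIV. F (Gu z) $ i * frechet_derivative \<phi> (at z) (0, axis i 1)) - g (u z) * \<phi> z)
       + (vt z * \<phi> z + (\<Sum>i\<in>UNIV. F (Gv z) $ i * frechet_derivative \<phi> (at z) (0, axis i 1)) - g (v' z) * \<phi> z))"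
      by (intro Bochner_Integration.integral_add[symmetric] test_inequality_integrable[OF \<phi>(1)] Lu(2) Lv(2) FG gL)
    also have "\<dots> = (LINT z|?\<Omega>. (ut z + vt z) * \<phi> z + (\<Sum>i\<in>UNIV. B z $ i * frechet_derivative \<phi> (at z) (0, axis i 1))
       - (g (u z) + g (v' z)) * \<phi> z)"
      by (intro Bochner_Integration.integral_cong refl) (simp add: B_def algebra_simps sum.distrib)
    finally show "0 \<le> (LINT z|?\<Omega>. (ut z + vt z) * \<phi> z + (\<Sum>i\<in>UNIV. B z $ i * frechet_derivative \<phi> (at z) (0, axis i 1))
       - (g (u z) + g (v' z)) * \<phi> z)" .
  qed (use assms in auto)
  show ?thesis
    using difference_zero by eventually_elim (simp add: v'_def)
qed

end
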